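(* Let $\Phi$ be an admissible test class on $\mathbb{R}^d$ with constants $A_1,A_2,A_3$ (as defined in the context), let $T>0$, and let $\mu$ be a probability measure on $C([0,T];\mathbb{R}^d)$ such that $$\int_{C([0,T];\mathbb{R}^d)}\sup_{0\le t\le T}\|x_t\|^2\,\mathrm{d}\mu(x)<+\infty$$ and such that, for some constants $Q,\alpha,\beta>0$ and all $0<h\le T$, $$\int_{C([0,T];\mathbb{R}^d)}\Delta(x,h)\,\mathrm{d}\mu(x)\le Qh^\alpha\log^\beta\left(\frac{2T}{h}\right),\qquad\Delta(x,h)=\sup_{t,s\in[0,T],|t-s|\le h}\|x_t-x_s\|.$$ (a) Let $X^1,\dots,X^n$ be i.i.d. random processes with law $\mu$, let $\bar\mu_t^n=\frac1n\sum_{i=1}^n\delta_{X_t^i}$ and let $\mu_t$ be the law of $X_t^1$. Then $$\mathbb{E}\left[\sup_{0\le t\le T}\mathrm{D}_\Phi(\mu_t,\bar\mu_t^n)\right]\le\phi(n),$$ where $$\phi(n)=2\left[\frac{A_3+8\max\{A_1,A_2\}}{\sqrt n}+8\max\{A_1,A_2\}\sqrt{\frac{\log(2^{2\alpha}n)}{2\alpha n}}\right]\left(\int_{C([0,T];\mathbb{R}^d)}\sup_{0\le t\le T}\|x_t\|^2\mathrm{d}\mu(x)+1\right)^{1/2}+\frac{2A_1QT^\alpha}{\sqrt n}\left(\frac{\log(2^{4\alpha}n)}{2\alpha}\right)^{\beta},$$ so that $\phi(n)=O\bigl(n^{-1/2}(\log n)^{\max\{\beta,1/2\}}\bigr)$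 as $n\to\infty$. In addition, $$\mathbb{E}\left[\sup_{0\le t\le T}\mathrm{D}^2_\Phi(\mu_t,\bar\mu_t^n)\right]\le\frac{A_1^2}{n}\int_{C([0,T];\mathbb{R}^d)}\sup_{0\le t\le T}\|x_t\|^2\mathrm{d}\mu(x)+\phi^2(n).$$ (b) If moreover $\mu$ satisfies the $\mathrm{T}_1$ inequality with constant $\kappa>0$, i.e. $\mathcal{W}_1^2(\mu,\tilde\mu)\le2\kappa^2\mathcal{H}(\tilde\mu|\mu)$ for all $\tilde\mu\ll\mu$, then for every $a>0$, $$\mathbb{P}\left(\sup_{0\le t\le T}\mathrm{D}_\Phi(\mu_t,\bar\mu_t^n)-\phi(n)\ge a\right)\le\exp\left(-\frac{na^2}{2A_1^2\kappa^2}\right).$$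
   Context: $\|\cdot\|$ is the Euclidean norm; $\mathrm{Lip}(f)=\sup_{x\ne y}|f(x)-f(y)|/\|x-y\|$. $\mathcal{P}^1(\mathbb{R}^d)$ is the set of Borel probability measures on $\mathbb{R}^d$ with finite first moment. Admissible test class: a class $\Phi$ of functions $f:\mathbb{R}^d\to\mathbb{R}$ is an admissible test class with constants $A_1,A_2,A_3$ if (a) whenever $\mu$ is a finite signed Borel measure on $\mathbb{R}^d$ with $\int\|x\|\,\mathrm{d}|\mu|<\infty$ and $\int f\,\mathrm{d}\mu=0$ for all $f\in\Phi$, then $\mu=0$; (b) $A_1=\sup_{f\in\Phi}\mathrm{Lip}(f)<\infty$ and $A_2=\sup_{f\in\Phi}|f(0)|<\infty$; (c) $A_3>0$ and for every $n\ge1$ and all points $x^1,\dots,x^n\in\mathbb{R}^d$, $$\frac1n\mathbb{E}\sup_{f\in\Phi}\Bigl|\sum_{i=1}^n\xi_if(x^i)\Bigr|\le\frac{A_3}{n}\sqrt{\sum_{i=1}^n(\|x^i\|^2+1)},$$ where $\xi_1,\dots,\xi_n$ are i.i.d. with $\mathbb{P}(\xi_i=1)=\mathbb{P}(\xi_i=-1)=\frac12$. Integral probability metric: for $\mu,\mu'\in\mathcal{P}^1(\mathbb{R}^d)$, $\mathrm{D}_\Phi(\mu,\mu')=\sup_{f\in\Phi}\left|\int_{\mathbb{R}^d}f\,\mathrm{d}(\mu-\mu')\right|$. In (b), $\mathcal{W}_1$ is the 1-Wasserstein distance on probability measures on $C([0,T];\mathbb{R}^d)$ for the distance $\sup_{0\le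 t\le T}\|x_t-y_t\|$, and $\mathcal{H}(\mu|\mu')=\mathbb{E}^{\mu}[\log(\mathrm{d}\mu/\mathrm{d}\mu')]$ is the relative entropy. *)

theory Defs
  imports "HOL-Probability.Probability" "HOL-Library.Landau_Symbols"
begin

section \<open>Finite signed measures\<close>

definition finite_signed_measure :: "'a measure \<Rightarrow> ('a set \<Rightarrow> real) \<Rightarrow> bool" where
  "finite_signed_measure M \<nu> \<longleftrightarrow>
     \<nu> {} = 0 \<and>
     (\<forall>A. range A \<subseteq> sets M \<longrightarrow> disjoint_family A \<longrightarrow> (\<lambda>i::nat. \<nu> (A i)) sums \<nu> (\<Union>i. A i))"

text \<open>Jordan decomposition. The coercion \<^const>\<open>ennreal\<close> sends negative reals to 0, which
  does not change the supremum because \<open>B = {}\<close> contributes the value 0.\<close>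

definition pos_variation :: "'a measure \<Rightarrow> ('a set \<Rightarrow> real) \<Rightarrow> 'a measure" where
  "pos_variation M \<nu> =
     measure_of (space M) (sets M) (\<lambda>A. SUP B\<in>{B \<in> sets M. B \<subseteq> A}. ennreal (\<nu> B))"

definition neg_variation :: "'a measure \<Rightarrow> ('a set \<Rightarrow> real) \<Rightarrow> 'a measure" where
  "neg_variation M \<nu> = pos_variation M (\<lambda>A. - \<nu> A)"

definition total_variation :: "'a measure \<Rightarrow> ('a set \<Rightarrow> real) \<Rightarrow> 'a measure" where
  "total_variation M \<nu> =
     measure_of (space M) (sets M)
       (\<lambda>A. emeasure (pos_variation M \<nu>) A + emeasure (neg_variation M \<nu>) A)"

definition signed_integral :: "'a measure \<Rightarrow> ('a set \<Rightarrow> real) \<Rightarrow> ('a \<Rightarrow> real) \<Rightarrow> real" where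
  "signed_integral M \<nu> f = (\<integral>x. f x \<partial>pos_variation M \<nu>) - (\<integral>x. f x \<partial>neg_variation M \<nu>)"

section \<open>Admissible test classes and integral probability metrics\<close>

definition Lip :: "('a::real_normed_vector \<Rightarrow> real) \<Rightarrow> ereal" where
  "Lip f = (SUP (x, y)\<in>{(x, y). x \<noteq> y}. ereal (\<bar>f x - f y\<bar> / norm (x - y)))"

text \<open>Since \<open>A1\<close> and \<open>A2\<close> are reals, the two equations between extended reals
  include the finiteness of the suprema; they also force \<open>\<Phi> \<noteq> {}\<close>, as the empty supremum
  is \<open>-\<infinity>\<close>. Hence the supremum in the last condition is that of a nonempty bounded set of reals.\<close>

definition admissible_test_class ::
    "('a::euclidean_space \<Rightarrow> real) set \<Rightarrow> real \<Rightarrow> real \<Rightarrow> real \<Rightarrow> bool" where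
  "admissible_test_class \<Phi> A1 A2 A3 \<longleftrightarrow>
     (\<forall>\<nu>. finite_signed_measure borel \<nu> \<longrightarrow>
          (\<integral>\<^sup>+x. ennreal (norm x) \<partial>total_variation borel \<nu>) < \<infinity> \<longrightarrow>
          (\<forall>f\<in>\<Phi>. signed_integral borel \<nu> f = 0) \<longrightarrow>
          (\<forall>A\<in>sets borel. \<nu> A = 0)) \<and>
     ereal A1 = (SUP f\<in>\<Phi>. Lip f) \<and>
     ereal A2 = (SUP f\<in>\<Phi>. ereal \<bar>f 0\<bar>) \<and>
     A3 > 0 \<and>
     (\<forall>n\<ge>1. \<forall>x :: nat \<Rightarrow> 'a.
        1 / real n *
          measure_pmf.expectation (Pi_pmf {1..n} 0 (\<lambda>_. pmf_of_set {-1, 1 :: real}))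
            (\<lambda>\<xi>. SUP f\<in>\<Phi>. \<bar>\<Sum>i=1..n. \<xi> i * f (x i)\<bar>)
        \<le> A3 / real n * sqrt (\<Sum>i=1..n. (norm (x i))\<^sup>2 + 1))"

definition ipm :: "('a \<Rightarrow> real) set \<Rightarrow> 'a measure \<Rightarrow> 'a measure \<Rightarrow> real" where
  "ipm \<Phi> \<mu> \<mu>' = (SUP f\<in>\<Phi>. \<bar>(\<integral>x. f x \<partial>\<mu>) - (\<integral>x. f x \<partial>\<mu>')\<bar>)"

definition empirical_measure :: "nat \<Rightarrow> (nat \<Rightarrow> 'a::topological_space) \<Rightarrow> 'a measure" where
  "empirical_measure n x =
     measure_of UNIV (sets borel) (\<lambda>A. (\<Sum>i=1..n. emeasure (return borel (x i)) A) / of_nat n)"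

section \<open>Path space\<close>

text \<open>The members of \<open>path_space T\<close> are continuous on \<open>{0..T}\<close> and \<^const>\<open>undefined\<close>
  outside; its \<^const>\<open>mdist\<close> is the uniform distance on \<open>{0..T}\<close>.\<close>

definition path_space :: "real \<Rightarrow> (real \<Rightarrow> 'a::euclidean_space) metric" where
  "path_space T = cfunspace (top_of_set {0..T}) euclidean_metric"

definition metric_borel :: "'a metric \<Rightarrow> 'a measure" where
  "metric_borel m = sigma (mspace m) {U. openin (mtopology_of m) U}"

definition path_sup_norm :: "real \<Rightarrow> (real \<Rightarrow> 'a::real_normed_vector) \<Rightarrow> real" where
  "path_sup_norm T x = (SUP t\<in>{0..T}. norm (x t))"

definition path_modulus :: "real \<Rightarrow> (real \<Rightarrow> 'a::real_normed_vector) \<Rightarrow> real \<Rightarrow> real" where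
  "path_modulus T x h =
     (SUP (t, s)\<in>{(t, s). t \<in> {0..T} \<and> s \<in> {0..T} \<and> \<bar>t - s\<bar> \<le> h}. norm (x t - x s))"

section \<open>The transport inequality\<close>

definition couplings :: "'a measure \<Rightarrow> 'b measure \<Rightarrow> ('a \<times> 'b) measure set" where
  "couplings \<mu> \<nu> =
     {\<pi>. sets \<pi> = sets (\<mu> \<Otimes>\<^sub>M \<nu>) \<and> distr \<pi> \<mu> fst = \<mu> \<and> distr \<pi> \<nu> snd = \<nu>}"

definition wasserstein1 :: "'a metric \<Rightarrow> 'a measure \<Rightarrow> 'a measure \<Rightarrow> ennreal" where
  "wasserstein1 m \<mu> \<nu> =
     (INF \<pi>\<in>couplings \<mu> \<nu>. \<integral>\<^sup>+z. ennreal (mdist m (fst z) (snd z)) \<partial>\<pi>)"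

text \<open>Relative entropy of \<open>\<nu>\<close> with respect to \<open>\<mu>\<close>, for probability measures. The negative part
  of the log-density is always \<open>\<nu>\<close>-integrable, so failure of integrability means that the
  entropy is infinite; \<^const>\<open>KL_divergence\<close> alone would be 0 there. Its reference measure is
  the second argument.\<close>

definition relative_entropy :: "'a measure \<Rightarrow> 'a measure \<Rightarrow> ennreal" where
  "relative_entropy \<nu> \<mu> =
     (if absolutely_continuous \<mu> \<nu> \<and> integrable \<nu> (entropy_density (exp 1) \<mu> \<nu>)
      then ennreal (KL_divergence (exp 1) \<mu> \<nu>) else \<infinity>)"

definition T1_inequality :: "'a metric \<Rightarrow> 'a measure \<Rightarrow> real \<Rightarrow> bool" where
  "T1_inequality m \<mu> \<kappa> \<longleftrightarrow>
     (\<forall>\<nu>. prob_space \<nu> \<longrightarrow> sets \<nu> = sets \<mu> \<longrightarrow> absolutely_continuous \<mu> \<nu> \<longrightarrow>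
        (wasserstein1 m \<mu> \<nu>)\<^sup>2 \<le> ennreal (2 * \<kappa>\<^sup>2) * relative_entropy \<nu> \<mu>)"

section \<open>The rate\<close>

text \<open>The argument \<open>m\<close> stands for the second moment of the supremum norm under \<open>\<mu>\<close>.\<close>

definition rate ::
    "real \<Rightarrow> real \<Rightarrow> real \<Rightarrow> real \<Rightarrow> real \<Rightarrow> real \<Rightarrow> real \<Rightarrow> real \<Rightarrow> nat \<Rightarrow> real" where
  "rate A1 A2 A3 T Q \<alpha> \<beta> m n =
     2 * ((A3 + 8 * max A1 A2) / sqrt (real n)
          + 8 * max A1 A2 * sqrt (ln (2 powr (2 * \<alpha>) * real n) / (2 * \<alpha> * real n)))
       * sqrt (m + 1)
     + 2 * A1 * Q * T powr \<alpha> / sqrt (real n)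
       * (ln (2 powr (4 * \<alpha>) * real n) / (2 * \<alpha>)) powr \<beta>"

end

(*
The empirical deviation sup_t D_Phi(mu_t, mubar_t^n) is a function G(X^1, ..., X^n) of i.i.d. paths
that is A1/n-Lipschitz in each path for the uniform distance.

Mean: symmetrization replaces G by the Rademacher average sup_{t,f} |1/n sum xi_i f(X^i_t)|.
On a grid of N ~ n^(1/(2 alpha)) times, each supremum over f concentrates (bounded differences in the
signs), so the maximum over the grid costs only sqrt(log N); the error off the grid is controlled by
the modulus of continuity at scale T/N.  Second moment: Efron-Stein.  Tail: by the
Bobkov-Goetze argument, the T1 inequality bounds the exponential moments of Lipschitz functions;
this bound tensorises, and Chernoff's inequality concludes.
*)

theory Submission
  imports Defs
begin

section \<open>Maximal inequality for Rademacher signs\<close>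

text \<open>The sample is therefore frozen: given it, only the signs are random, with difference
  bounds proportional to max A1 A2 * (1 + sup norm). In the mean bound the second moment enters only
  afterwards, through concavity of the square root. The grid size makes (T/N)^\<alpha> of order
  n^(-1/2) while log N grows only like log n. In \<open>rate\<close>, the factor 2^(2 \<alpha>)
  under the logarithm pays for rounding N up to an integer; 2^(4 \<alpha>) also contains the 2 of
  log(2T/h). The suprema run over uncountably many times and test functions. Both indices are merged
  into one class of A1-Lipschitz functions of the path, and a countable subclass, dense for
  pointwise convergence, carries measurability and symmetrization. Second and exponential moments on
  products are treated by adding one coordinate at a time, with nonnegative integrals, so that their
  finiteness is a conclusion of the induction and not a premise.\<close>

abbreviation rademacher :: "'i set \<Rightarrow> ('i \<Rightarrow> real) pmf" where
  "rademacher I \<equiv> Pi_pmf I 0 (\<lambda>_. pmf_of_set {- 1, 1})"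

lemma finite_set_rademacher:
  assumes "finite I" shows "finite (set_pmf (rademacher I))"
  by (rule finite_subset[OF set_Pi_pmf_subset'[OF assms]]) (use assms in auto)

lemma abs_rademacher:
  assumes "finite I" "\<xi> \<in> set_pmf (rademacher I)" "i \<in> I" shows "\<bar>\<xi> i\<bar> = 1"
proof -
  have "\<xi> i \<in> {- 1, 1}"
    using set_Pi_pmf[OF assms(1), of 0 "\<lambda>_. pmf_of_set {- 1, 1 :: real}"] assms(2,3)
    by (auto simp: PiE_dflt_def)
  then show ?thesis by auto
qed

lemma expectation_rademacher_insert:
  fixes F :: "('i \<Rightarrow> real) \<Rightarrow> real"
  assumes "finite I" "i \<notin> I"
  shows "measure_pmf.expectation (rademacher (insert i I)) F =
    measure_pmf.expectation (rademacher I) (\<lambda>\<xi>. (F (\<xi>(i := 1)) + F (\<xi>(i := - 1))) / 2)"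
proof -
  have fin: "finite (set_pmf (rademacher I))" by (rule finite_set_rademacher) fact
  \<comment> \<open>\<open>Pi_pmf_insert'\<close> draws the new sign first. Commuting the two draws
    makes it the inner one, so that its two values are averaged for each fixed \<xi>.\<close>
  have "rademacher (insert i I) =
     bind_pmf (rademacher I) (\<lambda>\<xi>. map_pmf (\<lambda>y. \<xi>(i := y)) (pmf_of_set {- 1, 1}))"
    unfolding Pi_pmf_insert'[OF assms] by (subst bind_commute_pmf) (simp add: map_pmf_def)
  then have "measure_pmf.expectation (rademacher (insert i I)) F =
     measure_pmf.expectation (bind_pmf (rademacher I) (\<lambda>\<xi>. map_pmf (\<lambda>y. \<xi>(i := y)) (pmf_of_set {- 1, 1}))) F"
    by simp
  also have "\<dots> = (\<Sum>\<xi>\<in>set_pmf (rademacher I). pmf (rademacher I) \<xi> *\<^sub>R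
      measure_pmf.expectation (map_pmf (\<lambda>y. \<xi>(i := y)) (pmf_of_set {- 1, 1})) F)"
    by (rule pmf_expectation_bind) (use fin in auto)
  also have "\<dots> = (\<Sum>\<xi>\<in>set_pmf (rademacher I). pmf (rademacher I) \<xi> *\<^sub>R
      ((F (\<xi>(i := 1)) + F (\<xi>(i := - 1))) / 2))"
    by (intro sum.cong refl) (simp add: integral_pmf_of_set)
  also have "\<dots> = measure_pmf.expectation (rademacher I) (\<lambda>\<xi>. (F (\<xi>(i := 1)) + F (\<xi>(i := - 1))) / 2)"
    by (rule integral_measure_pmf[symmetric]) (use fin in auto)
  finally show ?thesis .
qed

text \<open>Hoeffding's lemma for the uniform law on two points, equivalently cosh u \<le> exp (u^2
  / 2) at u = (a - b) / 2.\<close>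

lemma exp_mean_two_point:
  fixes a b :: real
  shows "(exp a + exp b) / 2 \<le> exp ((a + b) / 2 + (a - b)\<^sup>2 / 8)"
proof -
  have *: "(exp a + exp b) / 2 \<le> exp ((a + b) / 2 + (a - b)\<^sup>2 / 8)" if "a \<le> b" for a b :: real
  proof -
    have pos: "1 + 1/2 * (exp (b - a) - 1) > 0" using exp_gt_zero[of "b - a"] by (simp add: field_simps add_pos_pos)
    have "ln (1 + 1/2 * (exp (b - a) - 1)) \<le> (b - a) / 2 + (b - a)\<^sup>2 / 8"
    proof -
      have "- (b - a) * (1/2) + ln (1 + 1/2 * (exp (b - a) - 1)) \<le> (b - a)\<^sup>2 / 8"
        by (rule Hoeffdings_lemma_aux) (use that in auto)
      then show ?thesis by linarith
    qed
    then have "1 + 1/2 * (exp (b - a) - 1) \<le> exp ((b - a) / 2 + (b - a)\<^sup>2 / 8)"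
      using pos by (metis exp_le_cancel_iff exp_ln)
    then have "exp a * (1 + 1/2 * (exp (b - a) - 1)) \<le> exp a * exp ((b - a) / 2 + (b - a)\<^sup>2 / 8)"
      by simp
    moreover have "exp a * (1 + 1/2 * (exp (b - a) - 1)) = (exp a + exp b) / 2"
      by (simp add: field_simps flip: exp_add)
    moreover have "exp a * exp ((b - a) / 2 + (b - a)\<^sup>2 / 8) = exp ((a + b) / 2 + (a - b)\<^sup>2 / 8)"
      by (simp flip: exp_add add: power2_commute field_simps)
    ultimately show ?thesis by simp
  qed
  show ?thesis
    using *[of a b] *[of b a] by (cases "a \<le> b") (auto simp: add.commute power2_commute)
qed

text \<open>Averaging over one sign leaves a function with the same difference bounds in the
  remaining signs, so the signs are removed one by one. A difference of at most 2 * b i costs (2 * s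
  * b i)^2 / 8 in the exponent. The hypothesis ranges over all \<xi>, not only over sign vectors, so
  that the induction carries no support condition.\<close>

lemma rademacher_mgf:
  fixes F :: "('i \<Rightarrow> real) \<Rightarrow> real"
  assumes "finite I"
    and "\<And>\<xi> i. i \<in> I \<Longrightarrow> \<bar>F (\<xi>(i := 1)) - F (\<xi>(i := - 1))\<bar> \<le> 2 * b i"
  shows "measure_pmf.expectation (rademacher I) (\<lambda>\<xi>. exp (s * F \<xi>))
    \<le> exp (s * measure_pmf.expectation (rademacher I) F + s\<^sup>2 * (\<Sum>i\<in>I. (b i)\<^sup>2) / 2)"
  using assms
proof (induction I arbitrary: F rule: finite_induct)
  case empty
  then show ?case by simp
next
  case (insert i I)
  let ?E = "measure_pmf.expectation (rademacher I)"
  define G where "G = (\<lambda>\<xi>. (F (\<xi>(i := 1)) + F (\<xi>(i := - 1))) / 2)"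
  have fin: "finite (set_pmf (rademacher I))" by (rule finite_set_rademacher) fact
  have int: "integrable (measure_pmf (rademacher I)) h" for h :: "_ \<Rightarrow> real"
    by (rule integrable_measure_pmf_finite) fact
  have G: "\<bar>G (\<xi>(j := 1)) - G (\<xi>(j := - 1))\<bar> \<le> 2 * b j" if "j \<in> I" for \<xi> j
  proof -
    have "i \<noteq> j" using that insert by auto
    then have tw: "\<xi>(j := c, i := d) = \<xi>(i := d, j := c)" for c d by (rule fun_upd_twist[symmetric])
    have avg: "\<bar>(a + c) / 2 - (a' + c') / 2\<bar> \<le> e"
      if "\<bar>a - a'\<bar> \<le> e" "\<bar>c - c'\<bar> \<le> e" for a a' c c' e :: real
      using that unfolding abs_le_iff by (auto simp: field_simps)
    show ?thesis
      unfolding G_def tw by (rule avg) (rule insert.prems[OF insertI2[OF that]])+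
  qed
  have "measure_pmf.expectation (rademacher (insert i I)) (\<lambda>\<xi>. exp (s * F \<xi>))
    = ?E (\<lambda>\<xi>. (exp (s * F (\<xi>(i := 1))) + exp (s * F (\<xi>(i := - 1)))) / 2)"
    by (rule expectation_rademacher_insert) fact+
  also have "\<dots> \<le> ?E (\<lambda>\<xi>. exp (s\<^sup>2 * (b i)\<^sup>2 / 2) * exp (s * G \<xi>))"
  proof (rule integral_mono[OF int int])
    fix \<xi>
    have "(F (\<xi>(i := 1)) - F (\<xi>(i := - 1)))\<^sup>2 \<le> (2 * b i)\<^sup>2"
      by (rule abs_le_square_iff[THEN iffD1], rule order_trans[OF insert.prems[OF insertI1] abs_ge_self])
    then have "s\<^sup>2 * (F (\<xi>(i := 1)) - F (\<xi>(i := - 1)))\<^sup>2 \<le> s\<^sup>2 * (2 * b i)\<^sup>2"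
      by (rule mult_left_mono) simp
    moreover have "s\<^sup>2 * (F (\<xi>(i := 1)) - F (\<xi>(i := - 1)))\<^sup>2 = (s * F (\<xi>(i := 1)) - s * F (\<xi>(i := - 1)))\<^sup>2"
      by (simp add: power_mult_distrib flip: right_diff_distrib)
    ultimately have "(s * F (\<xi>(i := 1)) + s * F (\<xi>(i := - 1))) / 2 + (s * F (\<xi>(i := 1)) - s * F (\<xi>(i := - 1)))\<^sup>2 / 8
       \<le> s\<^sup>2 * (b i)\<^sup>2 / 2 + s * G \<xi>"
      by (simp add: G_def field_simps power_mult_distrib)
    with exp_mean_two_point[of "s * F (\<xi>(i := 1))" "s * F (\<xi>(i := - 1))"]
    show "(exp (s * F (\<xi>(i := 1))) + exp (s * F (\<xi>(i := - 1)))) / 2 \<le> exp (s\<^sup>2 * (b i)\<^sup>2 / 2) * exp (s * G \<xi>)"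
      unfolding exp_add[symmetric] by (meson exp_le_cancel_iff order_trans)
  qed
  also have "\<dots> \<le> exp (s\<^sup>2 * (b i)\<^sup>2 / 2) * exp (s * ?E G + s\<^sup>2 * (\<Sum>i\<in>I. (b i)\<^sup>2) / 2)"
    using insert.IH[OF G] by simp
  also have "\<dots> = exp (s * ?E G + s\<^sup>2 * (\<Sum>i\<in>insert i I. (b i)\<^sup>2) / 2)"
    using insert by (simp flip: exp_add add: field_simps)
  also have "?E G = measure_pmf.expectation (rademacher (insert i I)) F"
    unfolding G_def by (rule expectation_rademacher_insert[symmetric]) fact+
  finally show ?case .
qed

text \<open>The logarithm of the cardinality is only bounded by \<open>L\<close> because the grid size is a
  rounded power of \<open>n\<close>.\<close>

lemma rademacher_maximal_inequality:
  fixes Z :: "'j \<Rightarrow> ('i \<Rightarrow> real) \<Rightarrow> real"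
  assumes I: "finite I" and J: "finite J" "J \<noteq> {}" "ln (card J) \<le> L"
    and diff: "\<And>j \<xi> i. j \<in> J \<Longrightarrow> i \<in> I \<Longrightarrow> \<bar>Z j (\<xi>(i := 1)) - Z j (\<xi>(i := - 1))\<bar> \<le> 2 * b i"
    and mean: "\<And>j. j \<in> J \<Longrightarrow> measure_pmf.expectation (rademacher I) (Z j) \<le> B"
    and V: "(\<Sum>i\<in>I. (b i)\<^sup>2) \<le> V"
  shows "measure_pmf.expectation (rademacher I) (\<lambda>\<xi>. MAX j\<in>J. Z j \<xi>) \<le> B + sqrt (2 * L * V)"
proof -
  let ?E = "measure_pmf.expectation (rademacher I)"
  let ?Y = "\<lambda>\<xi>. MAX j\<in>J. Z j \<xi>"
  have int: "integrable (measure_pmf (rademacher I)) h" for h :: "_ \<Rightarrow> real"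
    by (intro integrable_measure_pmf_finite finite_set_rademacher I)
  have "real (card J) \<ge> 1" using J(1,2) by (simp add: Suc_le_eq card_gt_0_iff)
  then have L: "L \<ge> 0" using J(3) ln_ge_zero order_trans by blast
  have V0: "V \<ge> 0" using V sum_nonneg[of I "\<lambda>i. (b i)\<^sup>2"] by auto
  \<comment> \<open>The exponential of the maximum is at most the sum of the exponentials. Jensen's
    inequality moves the expectation inside, and taking logarithms and dividing by s produces the
    entropy term L / s.\<close>
  have *: "?E ?Y \<le> B + L / s + s * V / 2" if s: "s > 0" for s
  proof -
    have "exp (?E (\<lambda>\<xi>. s * ?Y \<xi>)) \<le> ?E (\<lambda>\<xi>. exp (s * ?Y \<xi>))"
      by (rule measure_pmf.jensens_inequality[where I = UNIV]) (use convex_on_exp[of 1] in \<open>auto intro!: int\<close>)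
    also have "\<dots> \<le> ?E (\<lambda>\<xi>. \<Sum>j\<in>J. exp (s * Z j \<xi>))"
    proof (rule integral_mono[OF int int])
      fix \<xi>
      have "?Y \<xi> \<in> (\<lambda>j. Z j \<xi>) ` J" using J by (intro Max_in) auto
      then obtain j where "j \<in> J" "?Y \<xi> = Z j \<xi>" by auto
      then show "exp (s * ?Y \<xi>) \<le> (\<Sum>j\<in>J. exp (s * Z j \<xi>))"
        using J by (auto intro!: member_le_sum)
    qed
    also have "\<dots> = (\<Sum>j\<in>J. ?E (\<lambda>\<xi>. exp (s * Z j \<xi>)))"
      by (rule Bochner_Integration.integral_sum) (rule int)
    also have "\<dots> \<le> (\<Sum>j\<in>J. exp (s * B + s\<^sup>2 * V / 2))"
    proof (rule sum_mono)
      fix j assume j: "j \<in> J"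
      have "?E (\<lambda>\<xi>. exp (s * Z j \<xi>)) \<le> exp (s * ?E (Z j) + s\<^sup>2 * (\<Sum>i\<in>I. (b i)\<^sup>2) / 2)"
        by (rule rademacher_mgf[OF I diff[OF j]])
      also have "\<dots> \<le> exp (s * B + s\<^sup>2 * V / 2)"
        using s mean[OF j] V by (auto intro!: add_mono mult_left_mono)
      finally show "?E (\<lambda>\<xi>. exp (s * Z j \<xi>)) \<le> exp (s * B + s\<^sup>2 * V / 2)" .
    qed
    also have "\<dots> = exp (ln (card J)) * exp (s * B + s\<^sup>2 * V / 2)"
      using J by (simp add: card_gt_0_iff)
    also have "\<dots> \<le> exp (L + (s * B + s\<^sup>2 * V / 2))"
      unfolding exp_add using J by (intro mult_right_mono) auto
    finally have "s * ?E ?Y \<le> L + (s * B + s\<^sup>2 * V / 2)" by simp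
    then show ?thesis using s by (simp add: field_simps power2_eq_square)
  qed
  show ?thesis
  proof (cases "L > 0 \<and> V > 0")
    case True
    \<comment> \<open>This s minimises L / s + s * V / 2; both summands are then equal.\<close>
    define s where "s = sqrt (2 * L / V)"
    have s: "s > 0" using True by (simp add: s_def)
    have "sqrt (2 * L * V) = s * V"
      using True by (simp add: s_def real_sqrt_mult real_sqrt_divide field_simps)
    moreover have "L / s = s * V / 2"
    proof -
      have "s * s = 2 * L / V" using True by (simp add: s_def)
      then show ?thesis using s True by (simp add: field_simps)
    qed
    ultimately show ?thesis using *[OF s] by simp
  next
    \<comment> \<open>The infimum over s is now approached only in a limit: s tends to 0 if L = 0,
      and to infinity if V = 0. Hence the detour through an arbitrary e > 0.\<close>
    case False
    then consider "L = 0" | "V = 0" using L V0 by fastforce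
    then have "?E ?Y \<le> B + e" if "e > 0" for e
    proof cases
      case 1
      have "?E ?Y \<le> B + 0 + (e / (V + 1)) * V / 2" using *[of "e / (V + 1)"] 1 V0 that by simp
      also have "(e / (V + 1)) * V / 2 \<le> e" using V0 that by (simp add: field_simps mult_nonneg_nonneg)
      finally show ?thesis by simp
    next
      case 2
      have "?E ?Y \<le> B + L / ((L + 1) / e)" using *[of "(L + 1) / e"] 2 L that by simp
      also have "L / ((L + 1) / e) \<le> e" using L that by (simp add: field_simps)
      finally show ?thesis by simp
    qed
    then have "?E ?Y \<le> B" by (rule field_le_epsilon)
    moreover have "sqrt (2 * L * V) \<ge> 0" using L V0 by simp
    ultimately show ?thesis by linarith
  qed
qed

section \<open>Symmetrization\<close>

text \<open>Invariance of product laws under injective relabelling. Symmetrization uses it to place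
  the sample inside the doubled index set and to exchange the sample with its copy.\<close>

lemma nn_integral_PiM_reindex:
  assumes "prob_space M" "inj_on f I" "f \<in> I \<rightarrow> K" "h \<in> borel_measurable (PiM I (\<lambda>_. M))"
  shows "(\<integral>\<^sup>+\<omega>. h (\<lambda>i\<in>I. \<omega> (f i)) \<partial>PiM K (\<lambda>_. M)) = (\<integral>\<^sup>+x. h x \<partial>PiM I (\<lambda>_. M))"
proof -
  have meas: "(\<lambda>\<omega>. \<lambda>i\<in>I. \<omega> (f i)) \<in> measurable (PiM K (\<lambda>_. M)) (PiM I (\<lambda>_. M))"
    using assms(3) by (intro measurable_restrict measurable_component_singleton) auto
  have "distr (PiM K (\<lambda>_. M)) (PiM I (\<lambda>_. M)) (\<lambda>\<omega>. \<lambda>i\<in>I. \<omega> (f i)) = PiM I (\<lambda>_. M)"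
    using distr_PiM_reindex[of K "\<lambda>_. M" f I] assms by simp
  then have "(\<integral>\<^sup>+x. h x \<partial>PiM I (\<lambda>_. M)) =
      (\<integral>\<^sup>+x. h x \<partial>distr (PiM K (\<lambda>_. M)) (PiM I (\<lambda>_. M)) (\<lambda>\<omega>. \<lambda>i\<in>I. \<omega> (f i)))"
    by simp
  also have "\<dots> = (\<integral>\<^sup>+\<omega>. h (\<lambda>i\<in>I. \<omega> (f i)) \<partial>PiM K (\<lambda>_. M))"
    by (rule nn_integral_distr[OF meas]) (use assms(4) in simp)
  finally show ?thesis ..
qed

lemma integrable_PiM_component:
  fixes g :: "'s \<Rightarrow> 'b::{banach, second_countable_topology}"
  assumes "prob_space M" "i \<in> I" "integrable M g"
  shows "integrable (PiM I (\<lambda>_. M)) (\<lambda>x. g (x i))"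
    and "(\<integral>x. g (x i) \<partial>PiM I (\<lambda>_. M)) = (\<integral>x. g x \<partial>M)"
proof -
  have eq: "distr (PiM I (\<lambda>_. M)) M (\<lambda>x. x i) = M"
    using distr_PiM_component[of I "\<lambda>_. M" i] assms by simp
  have meas: "(\<lambda>x. x i) \<in> measurable (PiM I (\<lambda>_. M)) M" using assms(2) by measurable
  show "integrable (PiM I (\<lambda>_. M)) (\<lambda>x. g (x i))"
    by (rule integrable_distr[OF meas]) (simp add: eq assms(3))
  show "(\<integral>x. g (x i) \<partial>PiM I (\<lambda>_. M)) = (\<integral>x. g x \<partial>M)"
    using integral_distr[OF meas, of g] assms(3) by (simp add: eq)
qed

text \<open>The index set I \<times> bool carries the sample and an independent copy. Jensen's
  inequality replaces the mean by the copy; exchanging the two entries wherever \<epsilon> i = -1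
  preserves the product law and creates the sign; the triangle inequality then costs the factor 2.
  Values are in \<open>ennreal\<close> because the supremum over C may be infinite.\<close>

lemma symmetrization:
  fixes M :: "'s measure" and C :: "('s \<Rightarrow> real) set" and \<epsilon> :: "'i \<Rightarrow> real"
  assumes M: "prob_space M" and I: "finite I" and C: "countable C"
    and int: "\<And>g. g \<in> C \<Longrightarrow> integrable M g"
    and sgn: "\<And>i. i \<in> I \<Longrightarrow> \<bar>\<epsilon> i\<bar> = 1"
  shows "(\<integral>\<^sup>+x. (SUP g\<in>C. ennreal \<bar>\<Sum>i\<in>I. g (x i) - (\<integral>y. g y \<partial>M)\<bar>) \<partial>PiM I (\<lambda>_. M))
    \<le> 2 * (\<integral>\<^sup>+x. (SUP g\<in>C. ennreal \<bar>\<Sum>i\<in>I. \<epsilon> i * g (x i)\<bar>) \<partial>PiM I (\<lambda>_. M))"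
proof -
  interpret M: prob_space M by fact
  interpret product_sigma_finite "\<lambda>_ :: 'i \<times> bool. M" by unfold_locales
  have meas[measurable]: "g \<in> borel_measurable M" if "g \<in> C" for g using int[OF that] by simp
  define K1 where "K1 = I \<times> {True}"
  define K2 where "K2 = I \<times> {False}"
  define K where "K = I \<times> (UNIV :: bool set)"
  have K: "K = K1 \<union> K2" "K1 \<inter> K2 = {}" "finite K1" "finite K2"
    using I by (auto simp: K_def K1_def K2_def)
  have memK [simp]: "(i, b) \<in> K" "(i, True) \<in> K1" "(i, False) \<in> K2" if "i \<in> I" for i b
    using that by (auto simp: K_def K1_def K2_def)
  define R where "R = (\<lambda>x. SUP g\<in>C. ennreal \<bar>\<Sum>i\<in>I. \<epsilon> i * g (x i)\<bar>)"
  define G where "G = (\<lambda>x. SUP g\<in>C. ennreal \<bar>\<Sum>i\<in>I. g (x i) - (\<integral>y. g y \<partial>M)\<bar>)"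
  define H where "H = (\<lambda>\<omega> :: 'i \<times> bool \<Rightarrow> 's. SUP g\<in>C. ennreal \<bar>\<Sum>i\<in>I. g (\<omega> (i, True)) - g (\<omega> (i, False))\<bar>)"
  have R[measurable]: "R \<in> borel_measurable (PiM I (\<lambda>_. M))" and G[measurable]: "G \<in> borel_measurable (PiM I (\<lambda>_. M))"
    unfolding R_def G_def using C by measurable
  have H[measurable]: "H \<in> borel_measurable (PiM K (\<lambda>_. M))"
    unfolding H_def using C by measurable
  have R_reindex: "(\<integral>\<^sup>+\<omega>. R (\<lambda>i\<in>I. \<omega> (i, b)) \<partial>PiM K (\<lambda>_. M)) = (\<integral>\<^sup>+x. R x \<partial>PiM I (\<lambda>_. M))" for b
    by (rule nn_integral_PiM_reindex[OF M _ _ R]) (auto simp: inj_on_def)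
  have "(\<integral>\<^sup>+x. G x \<partial>PiM I (\<lambda>_. M)) = (\<integral>\<^sup>+a. G (\<lambda>i\<in>I. a (i, True)) \<partial>PiM K1 (\<lambda>_. M))"
    by (rule nn_integral_PiM_reindex[OF M _ _ G, symmetric]) (auto simp: inj_on_def)
  also have "\<dots> \<le> (\<integral>\<^sup>+a. \<integral>\<^sup>+b. H (merge K1 K2 (a, b)) \<partial>PiM K2 (\<lambda>_. M) \<partial>PiM K1 (\<lambda>_. M))"
  proof (rule nn_integral_mono)
    fix a assume a: "a \<in> space (PiM K1 (\<lambda>_. M))"
    have "ennreal \<bar>\<Sum>i\<in>I. g (a (i, True)) - (\<integral>y. g y \<partial>M)\<bar> \<le> (\<integral>\<^sup>+b. H (merge K1 K2 (a, b)) \<partial>PiM K2 (\<lambda>_. M))"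
      if g: "g \<in> C" for g
    proof -
      have i1: "integrable (PiM K2 (\<lambda>_. M)) (\<lambda>b. g (b (i, False)))" if "i \<in> I" for i
        by (rule integrable_PiM_component(1)[OF M _ int[OF g]]) (use that in simp)
      have i2: "(\<integral>b. g (b (i, False)) \<partial>PiM K2 (\<lambda>_. M)) = (\<integral>y. g y \<partial>M)" if "i \<in> I" for i
        by (rule integrable_PiM_component(2)[OF M _ int[OF g]]) (use that in simp)
      interpret K2: prob_space "PiM K2 (\<lambda>_. M)" by (intro prob_space_PiM M)
      have i3: "integrable (PiM K2 (\<lambda>_. M)) (\<lambda>b. \<Sum>i\<in>I. g (a (i, True)) - g (b (i, False)))"
        by (intro Bochner_Integration.integrable_sum Bochner_Integration.integrable_diff i1) auto
      have "(\<Sum>i\<in>I. g (a (i, True)) - (\<integral>y. g y \<partial>M)) = (\<integral>b. (\<Sum>i\<in>I. g (a (i, True)) - g (b (i, False))) \<partial>PiM K2 (\<lambda>_. M))"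
        by (subst Bochner_Integration.integral_sum)
          (auto intro!: sum.cong Bochner_Integration.integrable_diff i1
             simp: Bochner_Integration.integral_diff i1 i2 K2.prob_space)
      then have "ennreal \<bar>\<Sum>i\<in>I. g (a (i, True)) - (\<integral>y. g y \<partial>M)\<bar> \<le>
          (\<integral>\<^sup>+b. ennreal \<bar>\<Sum>i\<in>I. g (a (i, True)) - g (b (i, False))\<bar> \<partial>PiM K2 (\<lambda>_. M))"
        using integral_norm_bound_ennreal[OF i3] by simp
      also have "\<dots> \<le> (\<integral>\<^sup>+b. H (merge K1 K2 (a, b)) \<partial>PiM K2 (\<lambda>_. M))"
      proof (rule nn_integral_mono)
        fix b
        have "(\<Sum>i\<in>I. g (a (i, True)) - g (b (i, False))) =
          (\<Sum>i\<in>I. g (merge K1 K2 (a, b) (i, True)) - g (merge K1 K2 (a, b) (i, False)))"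
          by (rule sum.cong) (auto simp: merge_def K1_def K2_def)
        then show "ennreal \<bar>\<Sum>i\<in>I. g (a (i, True)) - g (b (i, False))\<bar> \<le> H (merge K1 K2 (a, b))"
          unfolding H_def using g by (auto intro!: SUP_upper2)
      qed
      finally show ?thesis .
    qed
    moreover have "(\<Sum>i\<in>I. g ((\<lambda>i\<in>I. a (i, True)) i) - (\<integral>y. g y \<partial>M)) = (\<Sum>i\<in>I. g (a (i, True)) - (\<integral>y. g y \<partial>M))" for g :: "'s \<Rightarrow> real"
      by (rule sum.cong) auto
    ultimately show "G (\<lambda>i\<in>I. a (i, True)) \<le> (\<integral>\<^sup>+b. H (merge K1 K2 (a, b)) \<partial>PiM K2 (\<lambda>_. M))"
      unfolding G_def by (auto intro!: SUP_least)
  qed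
  also have "\<dots> = (\<integral>\<^sup>+\<omega>. H \<omega> \<partial>PiM K (\<lambda>_. M))"
    using product_nn_integral_fold[OF K(2-4), of H] H unfolding K(1) by simp
  \<comment> \<open>The relabelling fixes \<open>(i, b)\<close> if \<epsilon> i = 1 and swaps
    \<open>(i, True)\<close> with \<open>(i, False)\<close> otherwise.\<close>
  also have "\<dots> = (\<integral>\<^sup>+\<omega>. H (\<lambda>k\<in>K. \<omega> (case k of (i, b) \<Rightarrow> (i, b = (\<epsilon> i = 1)))) \<partial>PiM K (\<lambda>_. M))"
    by (rule nn_integral_PiM_reindex[OF M _ _ H, symmetric]) (auto simp: inj_on_def K_def)
  also have "\<dots> \<le> (\<integral>\<^sup>+\<omega>. R (\<lambda>i\<in>I. \<omega> (i, True)) + R (\<lambda>i\<in>I. \<omega> (i, False)) \<partial>PiM K (\<lambda>_. M))"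
  proof (rule nn_integral_mono)
    fix \<omega> :: "'i \<times> bool \<Rightarrow> 's"
    let ?w = "\<lambda>k\<in>K. \<omega> (case k of (i, b) \<Rightarrow> (i, b = (\<epsilon> i = 1)))"
    show "H ?w \<le> R (\<lambda>i\<in>I. \<omega> (i, True)) + R (\<lambda>i\<in>I. \<omega> (i, False))"
      unfolding H_def
    proof (rule SUP_least)
      fix g assume g: "g \<in> C"
      have "(\<Sum>i\<in>I. g (?w (i, True)) - g (?w (i, False))) =
        (\<Sum>i\<in>I. \<epsilon> i * g (\<omega> (i, True)) - \<epsilon> i * g (\<omega> (i, False)))"
      proof (rule sum.cong[OF refl])
        fix i assume i: "i \<in> I"
        from sgn[OF i] have "\<epsilon> i = 1 \<or> \<epsilon> i = - 1" by linarith
        then show "g (?w (i, True)) - g (?w (i, False)) = \<epsilon> i * g (\<omega> (i, True)) - \<epsilon> i * g (\<omega> (i, False))"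
          using i by auto
      qed
      also have "\<dots> = (\<Sum>i\<in>I. \<epsilon> i * g ((\<lambda>i\<in>I. \<omega> (i, True)) i)) - (\<Sum>i\<in>I. \<epsilon> i * g ((\<lambda>i\<in>I. \<omega> (i, False)) i))"
        by (simp add: sum_subtractf)
      finally have "\<bar>\<Sum>i\<in>I. g (?w (i, True)) - g (?w (i, False))\<bar> \<le>
        \<bar>\<Sum>i\<in>I. \<epsilon> i * g ((\<lambda>i\<in>I. \<omega> (i, True)) i)\<bar> + \<bar>\<Sum>i\<in>I. \<epsilon> i * g ((\<lambda>i\<in>I. \<omega> (i, False)) i)\<bar>"
        by (simp only: abs_triangle_ineq4)
      then have "ennreal \<bar>\<Sum>i\<in>I. g (?w (i, True)) - g (?w (i, False))\<bar> \<le>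
        ennreal \<bar>\<Sum>i\<in>I. \<epsilon> i * g ((\<lambda>i\<in>I. \<omega> (i, True)) i)\<bar> + ennreal \<bar>\<Sum>i\<in>I. \<epsilon> i * g ((\<lambda>i\<in>I. \<omega> (i, False)) i)\<bar>"
        by (simp only: ennreal_leI ennreal_plus[symmetric] abs_ge_zero)
      also have "\<dots> \<le> R (\<lambda>i\<in>I. \<omega> (i, True)) + R (\<lambda>i\<in>I. \<omega> (i, False))"
        unfolding R_def by (intro add_mono SUP_upper g)
      finally show "ennreal \<bar>\<Sum>i\<in>I. g (?w (i, True)) - g (?w (i, False))\<bar> \<le> R (\<lambda>i\<in>I. \<omega> (i, True)) + R (\<lambda>i\<in>I. \<omega> (i, False))" .
    qed
  qed
  also have "\<dots> = (\<integral>\<^sup>+\<omega>. R (\<lambda>i\<in>I. \<omega> (i, True)) \<partial>PiM K (\<lambda>_. M)) + (\<integral>\<^sup>+\<omega>. R (\<lambda>i\<in>I. \<omega> (i, False)) \<partial>PiM K (\<lambda>_. M))"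
  proof (rule nn_integral_add)
    show "(\<lambda>\<omega>. R (\<lambda>i\<in>I. \<omega> (i, b))) \<in> borel_measurable (PiM K (\<lambda>_. M))" for b
      by (rule measurable_compose[OF _ R]) (auto intro!: measurable_restrict measurable_component_singleton)
    then show "(\<lambda>\<omega>. R (\<lambda>i\<in>I. \<omega> (i, False))) \<in> borel_measurable (PiM K (\<lambda>_. M))" .
  qed
  also have "\<dots> = 2 * (\<integral>\<^sup>+x. R x \<partial>PiM I (\<lambda>_. M))"
    by (simp only: R_reindex mult_2)
  finally show ?thesis unfolding G_def R_def .
qed

text \<open>The previous bound holds for every sign vector, hence on average. The sign expectation
  is moved inside because the maximal inequality will be applied at a fixed sample; as the signs
  have finite support, the exchange is that of an integral with a finite sum.\<close>

lemma symmetrization_rademacher: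
  fixes M :: "'s measure" and C :: "('s \<Rightarrow> real) set" and I :: "'i set"
  assumes M: "prob_space M" and I: "finite I" and C: "countable C"
    and int: "\<And>g. g \<in> C \<Longrightarrow> integrable M g"
  shows "(\<integral>\<^sup>+x. (SUP g\<in>C. ennreal \<bar>\<Sum>i\<in>I. g (x i) - (\<integral>y. g y \<partial>M)\<bar>) \<partial>PiM I (\<lambda>_. M))
    \<le> 2 * (\<integral>\<^sup>+x. \<integral>\<^sup>+\<xi>. (SUP g\<in>C. ennreal \<bar>\<Sum>i\<in>I. \<xi> i * g (x i)\<bar>) \<partial>rademacher I \<partial>PiM I (\<lambda>_. M))"
proof -
  let ?p = "rademacher I"
  have [measurable]: "g \<in> borel_measurable M" if "g \<in> C" for g using int[OF that] by simp
  have fin: "finite (set_pmf ?p)" by (rule finite_set_rademacher[OF I])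
  define R where "R = (\<lambda>\<xi> x. SUP g\<in>C. ennreal \<bar>\<Sum>i\<in>I. \<xi> i * g (x i)\<bar>)"
  have [measurable]: "R \<xi> \<in> borel_measurable (PiM I (\<lambda>_. M))" for \<xi> :: "'i \<Rightarrow> real"
    unfolding R_def using C by measurable
  let ?A = "\<integral>\<^sup>+x. (SUP g\<in>C. ennreal \<bar>\<Sum>i\<in>I. g (x i) - (\<integral>y. g y \<partial>M)\<bar>) \<partial>PiM I (\<lambda>_. M)"
  have "?A = (\<integral>\<^sup>+\<xi>. ?A \<partial>?p)" by simp
  also have "\<dots> \<le> (\<integral>\<^sup>+\<xi>. 2 * (\<integral>\<^sup>+x. R \<xi> x \<partial>PiM I (\<lambda>_. M)) \<partial>?p)"
  proof (rule nn_integral_mono_AE)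
    show "AE \<xi> in ?p. ?A \<le> 2 * (\<integral>\<^sup>+x. R \<xi> x \<partial>PiM I (\<lambda>_. M))"
      unfolding R_def by (rule AE_pmfI, rule symmetrization[OF M I C int]) (auto intro: abs_rademacher[OF I])
  qed
  also have "\<dots> = 2 * (\<integral>\<^sup>+\<xi>. (\<integral>\<^sup>+x. R \<xi> x \<partial>PiM I (\<lambda>_. M)) \<partial>?p)"
    by (rule nn_integral_cmult) simp
  also have "(\<integral>\<^sup>+\<xi>. (\<integral>\<^sup>+x. R \<xi> x \<partial>PiM I (\<lambda>_. M)) \<partial>?p) =
     (\<integral>\<^sup>+x. \<integral>\<^sup>+\<xi>. R \<xi> x \<partial>?p \<partial>PiM I (\<lambda>_. M))"
    using fin by (simp add: nn_integral_measure_pmf_finite nn_integral_sum nn_integral_multc)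
  finally show ?thesis by (simp only: R_def)
qed

section \<open>Path space\<close>

lemma space_metric_borel [simp]: "space (metric_borel m) = mspace m"
  by (simp add: metric_borel_def space_measure_of_conv)

lemma sets_metric_borel:
  "sets (metric_borel m) = sigma_sets (mspace m) {U. openin (mtopology_of m) U}"
  unfolding metric_borel_def using openin_subset[of "mtopology_of m"]
  by (intro sets_measure_of) auto

lemma measurable_metric_borel:
  fixes f :: "'a \<Rightarrow> 'b::metric_space"
  assumes lip: "\<And>x y. x \<in> mspace m \<Longrightarrow> y \<in> mspace m \<Longrightarrow> dist (f x) (f y) \<le> L * mdist m x y"
  shows "f \<in> borel_measurable (metric_borel m)"
proof (rule borel_measurableI)
  fix S :: "'b set" assume S: "open S"
  have "Lipschitz_continuous_map m euclidean_metric f"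
    unfolding Lipschitz_continuous_map_def using lip by (auto intro!: exI[of _ L])
  then have "continuous_map (mtopology_of m) euclidean f"
    using Lipschitz_continuous_imp_continuous_map by fastforce
  then have "openin (mtopology_of m) {x \<in> mspace m. f x \<in> S}"
    using S by (auto simp: continuous_map_def)
  moreover have "f -` S \<inter> space (metric_borel m) = {x \<in> mspace m. f x \<in> S}" by auto
  ultimately show "f -` S \<inter> space (metric_borel m) \<in> sets (metric_borel m)"
    by (auto simp: sets_metric_borel)
qed

text \<open>\<open>cfunspace\<close> consists of bounded continuous functions; boundedness is
  automatic on the compact interval.\<close>

lemma mspace_path_space:
  "mspace (path_space T) = {x. x \<in> extensional {0..T} \<and> continuous_on {0..T} x}"
  by (auto simp: path_space_def intro!: compact_imp_bounded compact_continuous_image)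

lemma norm_diff_le_mdist_path:
  assumes "x \<in> mspace (path_space T)" "y \<in> mspace (path_space T)" "t \<in> {0..T}"
  shows "norm (x t - y t) \<le> mdist (path_space T) x y"
  using mdist_cfunspace_imp_mdist_le[of x "top_of_set {0..T}" euclidean_metric y _ t] assms
  by (auto simp: path_space_def dist_norm simp del: mspace_cfunspace)

lemma mdist_path_space_le:
  assumes "B \<ge> 0" "\<And>t. t \<in> {0..T} \<Longrightarrow> norm (x t - y t) \<le> B"
  shows "mdist (path_space T) x y \<le> B"
  unfolding path_space_def using assms by (intro mdist_cfunspace_le) (auto simp: dist_norm)

lemma bdd_above_norm_path:
  assumes "x \<in> mspace (path_space T)"
  shows "bdd_above ((\<lambda>t. norm (x t)) ` {0..T})"
proof -
  have "continuous_on {0..T} (\<lambda>t. norm (x t))"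
    using assms by (auto simp: mspace_path_space intro: continuous_on_norm)
  then show ?thesis by (intro bounded_imp_bdd_above compact_imp_bounded compact_continuous_image) auto
qed

lemma norm_le_path_sup_norm:
  assumes "x \<in> mspace (path_space T)" "t \<in> {0..T}"
  shows "norm (x t) \<le> path_sup_norm T x"
  unfolding path_sup_norm_def using bdd_above_norm_path[OF assms(1)] assms(2) by (rule cSUP_upper2) simp

lemma path_sup_norm_nonneg:
  assumes "x \<in> mspace (path_space T)" "T \<ge> 0"
  shows "path_sup_norm T x \<ge> 0"
  using norm_le_path_sup_norm[OF assms(1), of 0] assms(2) by (auto intro: order_trans[OF norm_ge_zero])

text \<open>The base point z0 of path space, from which the distance is the supremum norm. It is
  restricted to {0..T} because paths are extensional.\<close>

definition zero_path :: "real \<Rightarrow> real \<Rightarrow> 'a::euclidean_space" where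
  "zero_path T = (\<lambda>t\<in>{0..T}. 0)"

lemma zero_path_in_path_space [simp]: "zero_path T \<in> mspace (path_space T)"
  by (auto simp: mspace_path_space zero_path_def cong: continuous_on_cong_simp)

lemma mdist_zero_path:
  assumes "x \<in> mspace (path_space T)" "T \<ge> 0"
  shows "mdist (path_space T) x (zero_path T) = path_sup_norm T x"
proof (rule antisym)
  show "mdist (path_space T) x (zero_path T) \<le> path_sup_norm T x"
    by (rule mdist_path_space_le)
      (use path_sup_norm_nonneg[OF assms] norm_le_path_sup_norm[OF assms(1)] in \<open>auto simp: zero_path_def\<close>)
  show "path_sup_norm T x \<le> mdist (path_space T) x (zero_path T)"
    unfolding path_sup_norm_def
    by (rule cSUP_least) (use assms norm_diff_le_mdist_path[OF assms(1) zero_path_in_path_space] in \<open>auto simp: zero_path_def\<close>)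
qed

lemma measurable_path_eval:
  assumes "t \<in> {0..T}"
  shows "(\<lambda>x. x t) \<in> borel_measurable (metric_borel (path_space T))"
  by (rule measurable_metric_borel[where L = 1]) (use norm_diff_le_mdist_path assms in \<open>auto simp: dist_norm\<close>)

section \<open>Modulus of continuity of a path\<close>

lemma bdd_above_path_modulus:
  assumes "x \<in> mspace (path_space T)"
  shows "bdd_above ((\<lambda>(t, s). norm (x t - x s)) ` {(t, s). t \<in> {0..T} \<and> s \<in> {0..T} \<and> \<bar>t - s\<bar> \<le> h})"
proof (rule bdd_aboveI2)
  fix p assume "p \<in> {(t, s). t \<in> {0..T} \<and> s \<in> {0..T} \<and> \<bar>t - s\<bar> \<le> h}"
  then obtain t s where p: "p = (t, s)" "t \<in> {0..T}" "s \<in> {0..T}" by auto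
  show "(case p of (t, s) \<Rightarrow> norm (x t - x s)) \<le> path_sup_norm T x + path_sup_norm T x"
    unfolding p(1) prod.case
    using norm_triangle_ineq4[of "x t" "x s"] norm_le_path_sup_norm[OF assms p(2)] norm_le_path_sup_norm[OF assms p(3)]
    by linarith
qed

lemma norm_diff_le_path_modulus:
  assumes "x \<in> mspace (path_space T)" "t \<in> {0..T}" "s \<in> {0..T}" "\<bar>t - s\<bar> \<le> h"
  shows "norm (x t - x s) \<le> path_modulus T x h"
  unfolding path_modulus_def
  by (rule cSUP_upper2[OF bdd_above_path_modulus[OF assms(1)], of "(t, s)"]) (use assms in auto)

lemma path_modulus_le:
  assumes "T \<ge> 0" "h \<ge> 0"
    and "\<And>t s. t \<in> {0..T} \<Longrightarrow> s \<in> {0..T} \<Longrightarrow> \<bar>t - s\<bar> \<le> h \<Longrightarrow> norm (x t - x s) \<le> B"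
  shows "path_modulus T x h \<le> B"
  unfolding path_modulus_def
proof (rule cSUP_least)
  have "(0, 0) \<in> {(t, s). t \<in> {0..T} \<and> s \<in> {0..T} \<and> \<bar>t - s\<bar> \<le> h}" using assms by auto
  then show "{(t, s). t \<in> {0..T} \<and> s \<in> {0..T} \<and> \<bar>t - s\<bar> \<le> h} \<noteq> {}" by blast
qed (use assms in auto)

lemma path_modulus_nonneg:
  assumes "x \<in> mspace (path_space T)" "T \<ge> 0" "h \<ge> 0"
  shows "path_modulus T x h \<ge> 0"
  using norm_diff_le_path_modulus[OF assms(1), of 0 0 h] assms by auto

lemma path_modulus_le_sup_norm:
  assumes "x \<in> mspace (path_space T)" "T \<ge> 0" "h \<ge> 0"
  shows "path_modulus T x h \<le> 2 * path_sup_norm T x"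
proof (rule path_modulus_le[OF assms(2,3)])
  fix t s assume t: "t \<in> {0..T}" and s: "s \<in> {0..T}"
  show "norm (x t - x s) \<le> 2 * path_sup_norm T x"
    using norm_triangle_ineq4[of "x t" "x s"] norm_le_path_sup_norm[OF assms(1) t]
      norm_le_path_sup_norm[OF assms(1) s] by linarith
qed

text \<open>Replacing x by y moves both ends of an increment by at most the uniform distance. The
  modulus is therefore 2-Lipschitz on path space, and continuity gives measurability without a
  reduction to countably many times.\<close>

lemma measurable_path_modulus:
  fixes T h :: real
  assumes "T \<ge> 0" "h \<ge> 0"
  shows "(\<lambda>x :: real \<Rightarrow> 'a::euclidean_space. path_modulus T x h) \<in> borel_measurable (metric_borel (path_space T))"
proof -
  let ?m = "path_space T :: (real \<Rightarrow> 'a) metric"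
  interpret Metric_space "mspace ?m" "mdist ?m" by (rule Metric_space_mspace_mdist)
  have *: "path_modulus T x h \<le> path_modulus T y h + 2 * mdist ?m x y"
    if x: "x \<in> mspace ?m" and y: "y \<in> mspace ?m" for x y
  proof (rule path_modulus_le[OF assms])
    fix t s assume t: "t \<in> {0..T}" and s: "s \<in> {0..T}" and ts: "\<bar>t - s\<bar> \<le> h"
    have "norm (x t - x s) = norm ((x t - y t) + (y t - y s) + (y s - x s))" by simp
    also have "\<dots> \<le> norm (x t - y t) + norm (y t - y s) + norm (y s - x s)"
      by (intro norm_triangle_le add_right_mono norm_triangle_ineq)
    finally have "norm (x t - x s) \<le> norm (x t - y t) + norm (y t - y s) + norm (y s - x s)" .
    with ts show "norm (x t - x s) \<le> path_modulus T y h + 2 * mdist ?m x y"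
      using norm_diff_le_mdist_path[OF x y t] norm_diff_le_mdist_path[OF y x s]
        norm_diff_le_path_modulus[OF y t s ts] commute[of x y] by linarith
  qed
  show ?thesis
  proof (rule measurable_metric_borel[where L = 2])
    fix x y assume "x \<in> mspace ?m" "y \<in> mspace ?m"
    with *[of x y] *[of y x] show "dist (path_modulus T x h) (path_modulus T y h) \<le> 2 * mdist ?m x y"
      by (simp add: dist_real_def commute abs_le_iff)
  qed
qed

section \<open>Lipschitz functions of independent variables\<close>

text \<open>What the moment and tail arguments use of path space. The square-integrable distance to
  a base point makes every Lipschitz function square integrable.\<close>

locale metric_prob_space = prob_space \<mu> for \<mu> :: "'s measure" +
  fixes m :: "'s metric" and z0 :: 's
  assumes sets_eq: "sets \<mu> = sets (metric_borel m)"
    and base: "z0 \<in> mspace m"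
    and second_moment: "integrable \<mu> (\<lambda>y. (mdist m y z0)\<^sup>2)"
begin

lemma space_eq [simp]: "space \<mu> = mspace m"
  using sets_eq_imp_space_eq[OF sets_eq] by simp

lemma prob_mspace [simp]: "prob (mspace m) = 1"
  using prob_space by simp

lemma measurable_dist_base [measurable]: "(\<lambda>y. mdist m y z0) \<in> borel_measurable \<mu>"
proof -
  have "(\<lambda>y. mdist m y z0) \<in> borel_measurable (metric_borel m)"
  proof (rule measurable_metric_borel[where L = 1])
    interpret Metric_space "mspace m" "mdist m" by (rule Metric_space_mspace_mdist)
    fix x y assume "x \<in> mspace m" "y \<in> mspace m"
    then show "dist (mdist m x z0) (mdist m y z0) \<le> 1 * mdist m x y"
      using triangle[of x y z0] triangle[of y x z0] base by (simp add: dist_real_def commute abs_le_iff)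
  qed
  then show ?thesis by (simp cong: measurable_cong_sets add: sets_eq)
qed

lemma integrable_dist_base: "integrable \<mu> (\<lambda>y. mdist m y z0)"
proof (rule Bochner_Integration.integrable_bound)
  show "integrable \<mu> (\<lambda>y. 1 + (mdist m y z0)\<^sup>2)" using second_moment by simp
  show "AE y in \<mu>. norm (mdist m y z0) \<le> norm (1 + (mdist m y z0)\<^sup>2)"
  proof (rule AE_I2)
    fix y
    have "0 \<le> (\<bar>mdist m y z0\<bar> - 1)\<^sup>2" by simp
    then have "2 * \<bar>mdist m y z0\<bar> \<le> 1 + (mdist m y z0)\<^sup>2" by (simp add: power2_diff)
    then have "\<bar>mdist m y z0\<bar> \<le> 1 + (mdist m y z0)\<^sup>2" using abs_ge_zero[of "mdist m y z0"] by linarith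
    then show "norm (mdist m y z0) \<le> norm (1 + (mdist m y z0)\<^sup>2)"
      unfolding real_norm_def by (rule order_trans[OF _ abs_ge_self])
  qed
qed simp

definition lipschitz_fun :: "real \<Rightarrow> ('s \<Rightarrow> real) \<Rightarrow> bool" where
  "lipschitz_fun L f \<longleftrightarrow> (\<forall>x\<in>mspace m. \<forall>y\<in>mspace m. \<bar>f x - f y\<bar> \<le> L * mdist m x y)"

text \<open>Measurability is part of the definition: m is not assumed separable, and on a product of
  nonseparable spaces a Lipschitz function need not be measurable for the product sigma-algebra. In
  one variable \<open>lipschitz_measurable\<close> derives it.\<close>

definition sum_lipschitz :: "'i set \<Rightarrow> real \<Rightarrow> (('i \<Rightarrow> 's) \<Rightarrow> real) \<Rightarrow> bool" where
  "sum_lipschitz I L F \<longleftrightarrow> F \<in> borel_measurable (PiM I (\<lambda>_. \<mu>)) \<and>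
     (\<forall>x\<in>space (PiM I (\<lambda>_. \<mu>)). \<forall>y\<in>space (PiM I (\<lambda>_. \<mu>)).
        \<bar>F x - F y\<bar> \<le> L * (\<Sum>i\<in>I. mdist m (x i) (y i)))"

lemma lipschitz_measurable:
  assumes "lipschitz_fun L f" shows "f \<in> borel_measurable \<mu>"
proof -
  have "f \<in> borel_measurable (metric_borel m)"
    by (rule measurable_metric_borel[where L = L]) (use assms in \<open>auto simp: lipschitz_fun_def dist_real_def\<close>)
  then show ?thesis by (simp cong: measurable_cong_sets add: sets_eq)
qed

lemma lipschitz_integrable:
  assumes "lipschitz_fun L f" shows "integrable \<mu> f"
proof (rule Bochner_Integration.integrable_bound)
  show "integrable \<mu> (\<lambda>y. \<bar>f z0\<bar> + L * mdist m y z0)" using integrable_dist_base by simp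
  show "AE y in \<mu>. norm (f y) \<le> norm (\<bar>f z0\<bar> + L * mdist m y z0)"
    by (rule AE_I2) (use assms base in \<open>force simp: lipschitz_fun_def\<close>)
qed (rule lipschitz_measurable[OF assms])

lemma prob_space_PiM_power: "prob_space (PiM I (\<lambda>_. \<mu>))"
  by (intro prob_space_PiM) unfold_locales

lemma sum_lipschitz_integrable:
  assumes "finite I" "sum_lipschitz I L F" shows "integrable (PiM I (\<lambda>_. \<mu>)) F"
proof (rule Bochner_Integration.integrable_bound)
  interpret P: prob_space "PiM I (\<lambda>_. \<mu>)" by (rule prob_space_PiM_power)
  let ?z = "\<lambda>i\<in>I. z0"
  show "integrable (PiM I (\<lambda>_. \<mu>)) (\<lambda>x. \<bar>F ?z\<bar> + L * (\<Sum>i\<in>I. mdist m (x i) z0))"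
    by (intro Bochner_Integration.integrable_add integrable_mult_right Bochner_Integration.integrable_sum
          integrable_PiM_component(1)[OF prob_space_axioms _ integrable_dist_base]) auto
  show "AE x in PiM I (\<lambda>_. \<mu>). norm (F x) \<le> norm (\<bar>F ?z\<bar> + L * (\<Sum>i\<in>I. mdist m (x i) z0))"
  proof (rule AE_I2)
    fix x assume x: "x \<in> space (PiM I (\<lambda>_. \<mu>))"
    have "?z \<in> space (PiM I (\<lambda>_. \<mu>))" using base by (auto simp: space_PiM)
    with assms(2) x have "\<bar>F x - F ?z\<bar> \<le> L * (\<Sum>i\<in>I. mdist m (x i) (?z i))"
      unfolding sum_lipschitz_def by blast
    also have "(\<Sum>i\<in>I. mdist m (x i) (?z i)) = (\<Sum>i\<in>I. mdist m (x i) z0)" by (rule sum.cong) auto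
    finally have "\<bar>F x\<bar> \<le> \<bar>F ?z\<bar> + L * (\<Sum>i\<in>I. mdist m (x i) z0)"
      using abs_triangle_ineq2[of "F x" "F ?z"] by linarith
    then show "norm (F x) \<le> norm (\<bar>F ?z\<bar> + L * (\<Sum>i\<in>I. mdist m (x i) z0))"
      unfolding real_norm_def by (rule order_trans[OF _ abs_ge_self])
  qed
qed (use assms(2) in \<open>simp add: sum_lipschitz_def\<close>)

lemma sum_lipschitz_section:
  assumes F: "sum_lipschitz (insert i I) L F" and I: "finite I" "i \<notin> I" and x: "x \<in> space (PiM I (\<lambda>_. \<mu>))"
  shows "lipschitz_fun L (\<lambda>y. F (x(i := y)))"
  unfolding lipschitz_fun_def
proof (intro ballI)
  fix y z assume y: "y \<in> mspace m" and z: "z \<in> mspace m"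
  interpret Metric_space "mspace m" "mdist m" by (rule Metric_space_mspace_mdist)
  have sp: "x(i := u) \<in> space (PiM (insert i I) (\<lambda>_. \<mu>))" if "u \<in> mspace m" for u
    using that x by (auto simp: space_PiM intro!: PiE_fun_upd)
  have "\<bar>F (x(i := y)) - F (x(i := z))\<bar> \<le> L * (\<Sum>j\<in>insert i I. mdist m ((x(i := y)) j) ((x(i := z)) j))"
    using F sp[OF y] sp[OF z] unfolding sum_lipschitz_def by blast
  also have "(\<Sum>j\<in>insert i I. mdist m ((x(i := y)) j) ((x(i := z)) j)) = mdist m y z + (\<Sum>j\<in>I. 0)"
  proof -
    have "(\<Sum>j\<in>I. mdist m ((x(i := y)) j) ((x(i := z)) j)) = (\<Sum>j\<in>I. 0)"
    proof (rule sum.cong[OF refl])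
      fix j assume "j \<in> I"
      then have "j \<noteq> i" "x j \<in> mspace m" using I x by (auto simp: space_PiM)
      then show "mdist m ((x(i := y)) j) ((x(i := z)) j) = 0" by simp
    qed
    then show ?thesis using I by simp
  qed
  finally show "\<bar>F (x(i := y)) - F (x(i := z))\<bar> \<le> L * mdist m y z" by (simp del: fun_upd_apply)
qed

text \<open>The constant L survives the integration of one coordinate. This is what lets the second
  moment and the exponential moment be bounded by induction on the index set, with a one-dimensional
  estimate at the added coordinate.\<close>

lemma sum_lipschitz_integrate_out:
  assumes F: "sum_lipschitz (insert i I) L F" and I: "finite I" "i \<notin> I"
  shows "sum_lipschitz I L (\<lambda>x. \<integral>y. F (x(i := y)) \<partial>\<mu>)"
  unfolding sum_lipschitz_def
proof (intro conjI ballI)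
  have "(\<lambda>(x, y). x(i := y)) \<in> measurable (PiM I (\<lambda>_. \<mu>) \<Otimes>\<^sub>M \<mu>) (PiM (insert i I) (\<lambda>_. \<mu>))"
    by (rule measurable_add_dim)
  then have "(\<lambda>p. F (case p of (x, y) \<Rightarrow> x(i := y))) \<in> borel_measurable (PiM I (\<lambda>_. \<mu>) \<Otimes>\<^sub>M \<mu>)"
    by (rule measurable_compose) (use F in \<open>simp add: sum_lipschitz_def\<close>)
  then show "(\<lambda>x. \<integral>y. F (x(i := y)) \<partial>\<mu>) \<in> borel_measurable (PiM I (\<lambda>_. \<mu>))"
    by (intro borel_measurable_lebesgue_integral) (simp add: case_prod_beta')
next
  fix x x' assume x: "x \<in> space (PiM I (\<lambda>_. \<mu>))" and x': "x' \<in> space (PiM I (\<lambda>_. \<mu>))"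
  interpret Metric_space "mspace m" "mdist m" by (rule Metric_space_mspace_mdist)
  note int = lipschitz_integrable[OF sum_lipschitz_section[OF F I x]]
    lipschitz_integrable[OF sum_lipschitz_section[OF F I x']]
  have "\<bar>(\<integral>y. F (x(i := y)) \<partial>\<mu>) - (\<integral>y. F (x'(i := y)) \<partial>\<mu>)\<bar> = \<bar>\<integral>y. F (x(i := y)) - F (x'(i := y)) \<partial>\<mu>\<bar>"
    using int by simp
  also have "\<dots> \<le> (\<integral>y. \<bar>F (x(i := y)) - F (x'(i := y))\<bar> \<partial>\<mu>)"
    by (rule integral_abs_bound)
  also have "\<dots> \<le> (\<integral>y. L * (\<Sum>j\<in>I. mdist m (x j) (x' j)) \<partial>\<mu>)"
  proof (rule integral_mono)
    fix y assume "y \<in> space \<mu>"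
    then have y: "y \<in> mspace m" by simp
    have sp: "z(i := y) \<in> space (PiM (insert i I) (\<lambda>_. \<mu>))" if "z \<in> space (PiM I (\<lambda>_. \<mu>))" for z
      using that y by (auto simp: space_PiM intro!: PiE_fun_upd)
    have "\<bar>F (x(i := y)) - F (x'(i := y))\<bar> \<le> L * (\<Sum>j\<in>insert i I. mdist m ((x(i := y)) j) ((x'(i := y)) j))"
      using F sp[OF x] sp[OF x'] unfolding sum_lipschitz_def by blast
    also have "(\<Sum>j\<in>insert i I. mdist m ((x(i := y)) j) ((x'(i := y)) j)) = (\<Sum>j\<in>I. mdist m (x j) (x' j))"
    proof -
      have "(\<Sum>j\<in>I. mdist m ((x(i := y)) j) ((x'(i := y)) j)) = (\<Sum>j\<in>I. mdist m (x j) (x' j))"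
        using I by (intro sum.cong) auto
      then show ?thesis using I y by simp
    qed
    finally show "\<bar>F (x(i := y)) - F (x'(i := y))\<bar> \<le> L * (\<Sum>j\<in>I. mdist m (x j) (x' j))" .
  qed (use int in auto)
  also have "\<dots> = L * (\<Sum>j\<in>I. mdist m (x j) (x' j))" by (simp add: prob_space)
  finally show "\<bar>(\<integral>y. F (x(i := y)) \<partial>\<mu>) - (\<integral>y. F (x'(i := y)) \<partial>\<mu>)\<bar> \<le> L * (\<Sum>j\<in>I. mdist m (x j) (x' j))" .
qed

section \<open>Fubini's theorem for one added coordinate, and the empty product\<close>

lemma integral_sum_lipschitz_insert:
  assumes F: "sum_lipschitz (insert i I) L F" and I: "finite I" "i \<notin> I"
  shows "(\<integral>x. (\<integral>y. F (x(i := y)) \<partial>\<mu>) \<partial>PiM I (\<lambda>_. \<mu>)) = (\<integral>x. F x \<partial>PiM (insert i I) (\<lambda>_. \<mu>))"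
proof -
  interpret product_sigma_finite "\<lambda>_. \<mu>" by unfold_locales
  show ?thesis
    using product_integral_insert[OF I, of F] sum_lipschitz_integrable[OF _ F] I by simp
qed

lemma nn_integral_PiM_insert:
  assumes "h \<in> borel_measurable (PiM (insert i I) (\<lambda>_. \<mu>))" and I: "finite I" "i \<notin> I"
  shows "(\<integral>\<^sup>+x. h x \<partial>PiM (insert i I) (\<lambda>_. \<mu>)) = (\<integral>\<^sup>+x. \<integral>\<^sup>+y. h (x(i := y)) \<partial>\<mu> \<partial>PiM I (\<lambda>_. \<mu>))"
proof -
  interpret product_sigma_finite "\<lambda>_. \<mu>" by unfold_locales
  show ?thesis using product_nn_integral_insert[OF I, of h] assms(1) by simp
qed

lemma nn_integral_PiM_empty_power: "(\<integral>\<^sup>+x. h x \<partial>PiM {} (\<lambda>_. \<mu>)) = h (\<lambda>_. undefined)"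
proof -
  interpret product_sigma_finite "\<lambda>_. \<mu>" by unfold_locales
  show ?thesis by (rule nn_integral_empty) simp
qed

lemma integral_PiM_empty_power: "(\<integral>x. F x \<partial>PiM {} (\<lambda>_. \<mu>)) = (F (\<lambda>_. undefined) :: real)"
proof -
  interpret product_sigma_finite "\<lambda>_. \<mu>" by unfold_locales
  show ?thesis by (simp add: PiM_empty lebesgue_integral_count_space_finite)
qed

text \<open>Variance plus squared bias, the variance being at most the second moment about f z0. The
  centre c is arbitrary so that the induction can keep it: integrating out one coordinate leaves a
  constant plus the squared distance of the conditional mean from the same c.\<close>

lemma lipschitz_second_moment:
  assumes f: "lipschitz_fun L f"
  shows "(\<integral>\<^sup>+y. ennreal ((f y - c)\<^sup>2) \<partial>\<mu>) \<le>
    ennreal (L\<^sup>2 * (\<integral>y. (mdist m y z0)\<^sup>2 \<partial>\<mu>) + ((\<integral>y. f y \<partial>\<mu>) - c)\<^sup>2)"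
proof -
  note [measurable] = lipschitz_measurable[OF f]
  note int = lipschitz_integrable[OF f]
  have bound: "(f y - f z0)\<^sup>2 \<le> L\<^sup>2 * (mdist m y z0)\<^sup>2" if "y \<in> mspace m" for y
  proof -
    have "\<bar>f y - f z0\<bar>\<^sup>2 \<le> (L * mdist m y z0)\<^sup>2"
      by (rule power_mono) (use f base that in \<open>auto simp: lipschitz_fun_def\<close>)
    then show ?thesis by (simp add: power_mult_distrib)
  qed
  have int0: "integrable \<mu> (\<lambda>y. (f y - f z0)\<^sup>2)"
    by (rule Bochner_Integration.integrable_bound[of _ "\<lambda>y. L\<^sup>2 * (mdist m y z0)\<^sup>2"])
      (use second_moment bound in auto)
  have eq: "(f y - c)\<^sup>2 = (f y - f z0)\<^sup>2 + 2 * (f z0 - c) * f y + ((c\<^sup>2 - (f z0)\<^sup>2))" for y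
    by (simp add: power2_eq_square algebra_simps)
  have int1: "integrable \<mu> (\<lambda>y. (f y - c)\<^sup>2)"
    unfolding eq using int int0 by simp
  have "(\<integral>y. (f y - c)\<^sup>2 \<partial>\<mu>) = (\<integral>y. (f y - f z0)\<^sup>2 \<partial>\<mu>) + 2 * (f z0 - c) * (\<integral>y. f y \<partial>\<mu>) + (c\<^sup>2 - (f z0)\<^sup>2)"
    unfolding eq using int int0 by (simp add: prob_space)
  also have "\<dots> = (\<integral>y. (f y - f z0)\<^sup>2 \<partial>\<mu>) - ((\<integral>y. f y \<partial>\<mu>) - f z0)\<^sup>2 + ((\<integral>y. f y \<partial>\<mu>) - c)\<^sup>2"
    by (simp add: power2_eq_square algebra_simps)
  also have "\<dots> \<le> (\<integral>y. (f y - f z0)\<^sup>2 \<partial>\<mu>) + ((\<integral>y. f y \<partial>\<mu>) - c)\<^sup>2" by simp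
  also have "(\<integral>y. (f y - f z0)\<^sup>2 \<partial>\<mu>) \<le> (\<integral>y. L\<^sup>2 * (mdist m y z0)\<^sup>2 \<partial>\<mu>)"
    by (rule integral_mono) (use int0 second_moment bound in auto)
  finally have "(\<integral>y. (f y - c)\<^sup>2 \<partial>\<mu>) \<le> L\<^sup>2 * (\<integral>y. (mdist m y z0)\<^sup>2 \<partial>\<mu>) + ((\<integral>y. f y \<partial>\<mu>) - c)\<^sup>2"
    by simp
  then show ?thesis
    by (subst nn_integral_eq_integral[OF int1]) (auto intro: ennreal_leI simp del: ennreal_plus)
qed

text \<open>Efron--Stein, each coordinate being compared with the base point rather than with an
  independent copy; this avoids a factor 2.\<close>

lemma sum_lipschitz_second_moment:
  fixes L c :: real
  assumes "finite I" "sum_lipschitz I L F"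
  shows "(\<integral>\<^sup>+x. ennreal ((F x - c)\<^sup>2) \<partial>PiM I (\<lambda>_. \<mu>)) \<le>
    ennreal (card I * L\<^sup>2 * (\<integral>y. (mdist m y z0)\<^sup>2 \<partial>\<mu>) + ((\<integral>x. F x \<partial>PiM I (\<lambda>_. \<mu>)) - c)\<^sup>2)"
  using assms
proof (induction I arbitrary: F rule: finite_induct)
  case empty
  then show ?case by (simp add: nn_integral_PiM_empty_power integral_PiM_empty_power)
next
  case (insert i I)
  let ?v = "L\<^sup>2 * (\<integral>y. (mdist m y z0)\<^sup>2 \<partial>\<mu>)"
  let ?G = "\<lambda>x. \<integral>y. F (x(i := y)) \<partial>\<mu>"
  have v: "?v \<ge> 0" by simp
  have [measurable]: "F \<in> borel_measurable (PiM (insert i I) (\<lambda>_. \<mu>))" using insert.prems by (simp add: sum_lipschitz_def)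
  have G: "sum_lipschitz I L ?G" by (rule sum_lipschitz_integrate_out) fact+
  then have [measurable]: "?G \<in> borel_measurable (PiM I (\<lambda>_. \<mu>))" by (simp add: sum_lipschitz_def)
  interpret P: prob_space "PiM I (\<lambda>_. \<mu>)" by (rule prob_space_PiM_power)
  have "(\<integral>\<^sup>+x. ennreal ((F x - c)\<^sup>2) \<partial>PiM (insert i I) (\<lambda>_. \<mu>)) =
     (\<integral>\<^sup>+x. \<integral>\<^sup>+y. ennreal ((F (x(i := y)) - c)\<^sup>2) \<partial>\<mu> \<partial>PiM I (\<lambda>_. \<mu>))"
    by (rule nn_integral_PiM_insert[OF _ insert.hyps(1,2)]) measurable
  also have "\<dots> \<le> (\<integral>\<^sup>+x. ennreal ?v + ennreal ((?G x - c)\<^sup>2) \<partial>PiM I (\<lambda>_. \<mu>))"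
  proof (rule nn_integral_mono)
    fix x assume "x \<in> space (PiM I (\<lambda>_. \<mu>))"
    then have "lipschitz_fun L (\<lambda>y. F (x(i := y)))"
      by (rule sum_lipschitz_section[OF insert.prems insert.hyps(1,2)])
    from lipschitz_second_moment[OF this, of c]
    show "(\<integral>\<^sup>+y. ennreal ((F (x(i := y)) - c)\<^sup>2) \<partial>\<mu>) \<le> ennreal ?v + ennreal ((?G x - c)\<^sup>2)"
      by (subst ennreal_plus[symmetric]) (use v in \<open>simp_all del: ennreal_plus\<close>)
  qed
  also have "\<dots> = ennreal ?v + (\<integral>\<^sup>+x. ennreal ((?G x - c)\<^sup>2) \<partial>PiM I (\<lambda>_. \<mu>))"
    by (subst nn_integral_add) (auto simp: P.emeasure_space_1)
  also have "\<dots> \<le> ennreal ?v + ennreal (card I * L\<^sup>2 * (\<integral>y. (mdist m y z0)\<^sup>2 \<partial>\<mu>) + ((\<integral>x. ?G x \<partial>PiM I (\<lambda>_. \<mu>)) - c)\<^sup>2)"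
    by (intro add_left_mono insert.IH G)
  also have "(\<integral>x. ?G x \<partial>PiM I (\<lambda>_. \<mu>)) = (\<integral>x. F x \<partial>PiM (insert i I) (\<lambda>_. \<mu>))"
    by (rule integral_sum_lipschitz_insert) fact+
  also have "ennreal ?v + ennreal (card I * L\<^sup>2 * (\<integral>y. (mdist m y z0)\<^sup>2 \<partial>\<mu>) + ((\<integral>x. F x \<partial>PiM (insert i I) (\<lambda>_. \<mu>)) - c)\<^sup>2) =
    ennreal (card (insert i I) * L\<^sup>2 * (\<integral>y. (mdist m y z0)\<^sup>2 \<partial>\<mu>) + ((\<integral>x. F x \<partial>PiM (insert i I) (\<lambda>_. \<mu>)) - c)\<^sup>2)"
    using insert.hyps by (subst ennreal_plus[symmetric]) (auto simp: algebra_simps intro!: add_nonneg_nonneg)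
  finally show ?case .
qed

text \<open>With the other coordinates fixed, the inner integral is at most exp v times the
  exponential of s times the conditional mean, which is again of the form treated; each coordinate
  thus adds one v.\<close>

lemma sum_lipschitz_mgf:
  fixes s v :: real
  assumes dim1: "\<And>f. lipschitz_fun L f \<Longrightarrow> (\<integral>\<^sup>+y. ennreal (exp (s * f y)) \<partial>\<mu>) \<le> ennreal (exp (s * (\<integral>y. f y \<partial>\<mu>) + v))"
    and "finite I" "sum_lipschitz I L F"
  shows "(\<integral>\<^sup>+x. ennreal (exp (s * F x)) \<partial>PiM I (\<lambda>_. \<mu>)) \<le>
    ennreal (exp (s * (\<integral>x. F x \<partial>PiM I (\<lambda>_. \<mu>)) + card I * v))"
  using assms(2,3)
proof (induction I arbitrary: F rule: finite_induct)
  case empty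
  then show ?case by (simp add: nn_integral_PiM_empty_power integral_PiM_empty_power)
next
  case (insert i I)
  let ?G = "\<lambda>x. \<integral>y. F (x(i := y)) \<partial>\<mu>"
  have [measurable]: "F \<in> borel_measurable (PiM (insert i I) (\<lambda>_. \<mu>))" using insert.prems by (simp add: sum_lipschitz_def)
  have G: "sum_lipschitz I L ?G" by (rule sum_lipschitz_integrate_out) fact+
  then have [measurable]: "?G \<in> borel_measurable (PiM I (\<lambda>_. \<mu>))" by (simp add: sum_lipschitz_def)
  have "(\<integral>\<^sup>+x. ennreal (exp (s * F x)) \<partial>PiM (insert i I) (\<lambda>_. \<mu>)) =
     (\<integral>\<^sup>+x. \<integral>\<^sup>+y. ennreal (exp (s * F (x(i := y)))) \<partial>\<mu> \<partial>PiM I (\<lambda>_. \<mu>))"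
    by (rule nn_integral_PiM_insert[OF _ insert.hyps(1,2)]) measurable
  also have "\<dots> \<le> (\<integral>\<^sup>+x. ennreal (exp v) * ennreal (exp (s * ?G x)) \<partial>PiM I (\<lambda>_. \<mu>))"
  proof (rule nn_integral_mono)
    fix x assume "x \<in> space (PiM I (\<lambda>_. \<mu>))"
    then have "lipschitz_fun L (\<lambda>y. F (x(i := y)))"
      by (rule sum_lipschitz_section[OF insert.prems insert.hyps(1,2)])
    from dim1[OF this]
    show "(\<integral>\<^sup>+y. ennreal (exp (s * F (x(i := y)))) \<partial>\<mu>) \<le> ennreal (exp v) * ennreal (exp (s * ?G x))"
      by (simp add: exp_add ennreal_mult mult.commute)
  qed
  also have "\<dots> = ennreal (exp v) * (\<integral>\<^sup>+x. ennreal (exp (s * ?G x)) \<partial>PiM I (\<lambda>_. \<mu>))"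
    by (rule nn_integral_cmult) measurable
  also have "\<dots> \<le> ennreal (exp v) * ennreal (exp (s * (\<integral>x. ?G x \<partial>PiM I (\<lambda>_. \<mu>)) + card I * v))"
    by (intro mult_left_mono insert.IH G) auto
  also have "(\<integral>x. ?G x \<partial>PiM I (\<lambda>_. \<mu>)) = (\<integral>x. F x \<partial>PiM (insert i I) (\<lambda>_. \<mu>))"
    by (rule integral_sum_lipschitz_insert) fact+
  also have "ennreal (exp v) * ennreal (exp (s * (\<integral>x. F x \<partial>PiM (insert i I) (\<lambda>_. \<mu>)) + card I * v)) =
     ennreal (exp (s * (\<integral>x. F x \<partial>PiM (insert i I) (\<lambda>_. \<mu>)) + card (insert i I) * v))"
  proof -
    have "exp v * exp (s * c + card I * v) = exp (s * c + card (insert i I) * v)" for c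
      using insert.hyps unfolding exp_add[symmetric] by (simp add: algebra_simps)
    then show ?thesis by (subst ennreal_mult[symmetric]) simp_all
  qed
  finally show ?case .
qed

end

section \<open>Consequences of the transport inequality\<close>

context metric_prob_space
begin

text \<open>The easy half of Kantorovich-Rubinstein duality: under every coupling, the difference of
  the means is the integral of \<open>f (snd z) - f (fst z)\<close>, which is dominated by L times
  the distance.\<close>

lemma wasserstein1_lower_bound:
  assumes f: "lipschitz_fun L f" and L: "L > 0"
    and \<nu>: "prob_space \<nu>" "sets \<nu> = sets \<mu>" "integrable \<nu> f"
  shows "ennreal (\<bar>(\<integral>y. f y \<partial>\<nu>) - (\<integral>y. f y \<partial>\<mu>)\<bar> / L) \<le> wasserstein1 m \<mu> \<nu>"
  unfolding wasserstein1_def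
proof (rule INF_greatest)
  fix \<pi> assume \<pi>: "\<pi> \<in> couplings \<mu> \<nu>"
  interpret Metric_space "mspace m" "mdist m" by (rule Metric_space_mspace_mdist)
  have sets: "sets \<pi> = sets (\<mu> \<Otimes>\<^sub>M \<nu>)" and d1: "distr \<pi> \<mu> fst = \<mu>" and d2: "distr \<pi> \<nu> snd = \<nu>"
    using \<pi> by (auto simp: couplings_def)
  have [measurable]: "fst \<in> measurable \<pi> \<mu>" "snd \<in> measurable \<pi> \<nu>"
    by (simp_all cong: measurable_cong_sets add: sets)
  have space: "space \<pi> = mspace m \<times> mspace m"
    using sets_eq_imp_space_eq[OF sets] sets_eq_imp_space_eq[OF \<nu>(2)] by (simp add: space_pair_measure)
  have int: "integrable \<pi> (\<lambda>z. f (fst z))" "integrable \<pi> (\<lambda>z. f (snd z))"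
    by (rule integrable_distr[where M' = \<mu>]; use lipschitz_integrable[OF f] in \<open>simp add: d1\<close>)
      (rule integrable_distr[where M' = \<nu>]; use \<nu>(3) in \<open>simp add: d2\<close>)
  have "(\<integral>z. f (fst z) \<partial>\<pi>) = (\<integral>y. f y \<partial>\<mu>)"
    using integral_distr[of fst \<pi> \<mu> f] lipschitz_measurable[OF f] by (simp add: d1)
  moreover have "(\<integral>z. f (snd z) \<partial>\<pi>) = (\<integral>y. f y \<partial>\<nu>)"
    using integral_distr[of snd \<pi> \<nu> f] \<nu>(3) by (simp add: d2)
  ultimately have "((\<integral>y. f y \<partial>\<nu>) - (\<integral>y. f y \<partial>\<mu>)) / L = (\<integral>z. (f (snd z) - f (fst z)) / L \<partial>\<pi>)"
    using int by simp
  then have "ennreal (\<bar>(\<integral>y. f y \<partial>\<nu>) - (\<integral>y. f y \<partial>\<mu>)\<bar> / L) = ennreal (norm (\<integral>z. (f (snd z) - f (fst z)) / L \<partial>\<pi>))"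
    using L by simp
  also have "\<dots> \<le> (\<integral>\<^sup>+z. ennreal (norm ((f (snd z) - f (fst z)) / L)) \<partial>\<pi>)"
    by (rule integral_norm_bound_ennreal) (use int in simp)
  also have "\<dots> \<le> (\<integral>\<^sup>+z. ennreal (mdist m (fst z) (snd z)) \<partial>\<pi>)"
  proof (rule nn_integral_mono)
    fix z assume "z \<in> space \<pi>"
    then have "\<bar>f (snd z) - f (fst z)\<bar> \<le> L * mdist m (snd z) (fst z)"
      using f by (auto simp: space lipschitz_fun_def)
    then show "ennreal (norm ((f (snd z) - f (fst z)) / L)) \<le> ennreal (mdist m (fst z) (snd z))"
      using L by (intro ennreal_leI) (simp add: field_simps commute)
  qed
  finally show "ennreal (\<bar>(\<integral>y. f y \<partial>\<nu>) - (\<integral>y. f y \<partial>\<mu>)\<bar> / L) \<le> (\<integral>\<^sup>+z. ennreal (mdist m (fst z) (snd z)) \<partial>\<pi>)" .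
qed

text \<open>The transport inequality is applied to the Gibbs measure with density proportional to
  \<open>exp f\<close>, whose entropy is \<open>\<integral>f d\<nu> - ln \<integral>exp f d\<mu>\<close>.\<close>

lemma T1_exponential_moment_bounded:
  assumes T1: "T1_inequality m \<mu> \<kappa>" and f: "lipschitz_fun L f" and L: "L > 0"
    and bd: "\<And>y. y \<in> mspace m \<Longrightarrow> \<bar>f y\<bar> \<le> K"
  shows "(\<integral>y. exp (f y) \<partial>\<mu>) \<le> exp ((\<integral>y. f y \<partial>\<mu>) + \<kappa>\<^sup>2 * L\<^sup>2 / 2)"
proof -
  note f_meas [measurable] = lipschitz_measurable[OF f]
  have int_exp: "integrable \<mu> (\<lambda>y. exp (f y))"
    by (rule integrable_const_bound[where B = "exp K"]) (use bd in \<open>auto simp: abs_le_iff\<close>)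
  define Z where "Z = (\<integral>y. exp (f y) \<partial>\<mu>)"
  have Z: "Z > 0"
  proof -
    have "exp (- K) = (\<integral>y. exp (- K) \<partial>\<mu>)" by simp
    also have "\<dots> \<le> Z"
      unfolding Z_def by (rule integral_mono) (use bd int_exp in \<open>auto simp: abs_le_iff minus_le_iff\<close>)
    finally show ?thesis by (rule less_le_trans[OF exp_gt_zero])
  qed
  define g where "g = (\<lambda>y. exp (f y) / Z)"
  have g [measurable]: "g \<in> borel_measurable \<mu>" and g_pos: "g y > 0" for y
    using Z by (auto simp: g_def)
  have g_int: "integrable \<mu> g" "(\<integral>y. g y \<partial>\<mu>) = 1"
    using int_exp Z by (auto simp: g_def Z_def)
  define \<nu> where "\<nu> = density \<mu> (\<lambda>y. ennreal (g y))"
  have sets_\<nu>: "sets \<nu> = sets \<mu>" and space_\<nu>: "space \<nu> = mspace m" by (simp_all add: \<nu>_def)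
  have ac: "absolutely_continuous \<mu> \<nu>" unfolding \<nu>_def by (rule absolutely_continuousI_density) simp
  interpret \<nu>: prob_space \<nu>
  proof
    have "emeasure \<nu> (space \<nu>) = (\<integral>\<^sup>+y. ennreal (g y) * indicator (space \<mu>) y \<partial>\<mu>)"
      unfolding \<nu>_def space_density by (rule emeasure_density) (simp, rule sets.top)
    also have "\<dots> = (\<integral>\<^sup>+y. ennreal (g y) \<partial>\<mu>)"
      by (rule nn_integral_cong) simp
    also have "\<dots> = ennreal (\<integral>y. g y \<partial>\<mu>)"
      by (rule nn_integral_eq_integral[OF g_int(1)]) (use g_pos in \<open>auto intro: less_imp_le\<close>)
    finally show "emeasure \<nu> (space \<nu>) = 1" by (simp add: g_int)
  qed
  have [measurable]: "f \<in> borel_measurable \<nu>" by (simp add: \<nu>_def)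
  have int_f: "integrable \<nu> f"
    by (rule \<nu>.integrable_const_bound[where B = K]) (use bd in \<open>auto simp: space_\<nu>\<close>)
  define A where "A = (\<integral>y. f y \<partial>\<nu>) - (\<integral>y. f y \<partial>\<mu>)"
  define H where "H = (\<integral>y. f y \<partial>\<nu>) - ln Z"
  have "AE y in \<mu>. ennreal (g y) = RN_deriv \<mu> \<nu> y"
    by (rule RN_deriv_unique) (simp_all add: \<nu>_def)
  then have "AE y in \<nu>. ennreal (g y) = RN_deriv \<mu> \<nu> y"
    by (rule absolutely_continuous_AE[OF sets_\<nu> ac])
  then have ent: "AE y in \<nu>. entropy_density (exp 1) \<mu> \<nu> y = f y - ln Z"
  proof eventually_elim
    case (elim y)
    have "entropy_density (exp 1) \<mu> \<nu> y = ln (g y)"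
      using g_pos[of y] by (simp add: entropy_density_def log_def elim[symmetric])
    then show ?case using Z by (simp add: g_def ln_div)
  qed
  have ent_meas: "entropy_density (exp 1) \<mu> \<nu> \<in> borel_measurable \<nu>"
    using measurable_entropy_density[of "exp 1" \<mu> \<nu>] by (simp cong: measurable_cong_sets add: sets_\<nu>)
  have ent_int: "integrable \<nu> (entropy_density (exp 1) \<mu> \<nu>)"
    using int_f by (subst integrable_cong_AE[OF ent_meas _ ent]) auto
  have "KL_divergence (exp 1) \<mu> \<nu> = (\<integral>y. f y - ln Z \<partial>\<nu>)"
    unfolding KL_divergence_def by (rule integral_cong_AE[OF ent_meas _ ent]) simp
  also have "\<dots> = H" using int_f by (simp add: H_def \<nu>.prob_space)
  finally have KL: "relative_entropy \<nu> \<mu> = ennreal H"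
    using ac ent_int by (simp add: relative_entropy_def)
  \<comment> \<open>\<open>ennreal\<close> would truncate a negative H, so its sign is needed before
    the transport inequality can be read in the reals. It follows from exp u \<ge> 1 + u at u = ln Z
    - f y, whose exponential has \<nu>-integral 1.\<close>
  have H: "H \<ge> 0"
  proof -
    have "(\<integral>y. exp (ln Z - f y) \<partial>\<nu>) = (\<integral>y. g y * exp (ln Z - f y) \<partial>\<mu>)"
      unfolding \<nu>_def by (subst integral_density) (use g_pos in \<open>auto intro: less_imp_le\<close>)
    also have "\<dots> = (\<integral>y. 1 \<partial>\<mu>)"
      using Z by (intro Bochner_Integration.integral_cong) (auto simp: g_def exp_diff)
    finally have "(\<integral>y. exp (ln Z - f y) \<partial>\<nu>) = 1" by simp
    moreover have "(\<integral>y. 1 + (ln Z - f y) \<partial>\<nu>) \<le> (\<integral>y. exp (ln Z - f y) \<partial>\<nu>)"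
    proof (rule integral_mono)
      show "integrable \<nu> (\<lambda>y. exp (ln Z - f y))"
        by (rule \<nu>.integrable_const_bound[where B = "exp (ln Z + K)"])
          (use bd in \<open>auto simp: space_\<nu> abs_le_iff minus_le_iff\<close>)
    qed (use int_f in \<open>auto simp: exp_ge_add_one_self\<close>)
    ultimately show ?thesis using int_f by (simp add: H_def \<nu>.prob_space)
  qed
  have "(ennreal (\<bar>A\<bar> / L))\<^sup>2 \<le> (wasserstein1 m \<mu> \<nu>)\<^sup>2"
    using wasserstein1_lower_bound[OF f L \<nu>.prob_space_axioms sets_\<nu> int_f]
    by (intro power_mono) (auto simp: A_def)
  also have "\<dots> \<le> ennreal (2 * \<kappa>\<^sup>2) * ennreal H"
    using T1 \<nu>.prob_space_axioms sets_\<nu> ac KL unfolding T1_inequality_def by metis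
  finally have "ennreal ((\<bar>A\<bar> / L)\<^sup>2) \<le> ennreal (2 * \<kappa>\<^sup>2 * H)"
    using L H by (simp add: ennreal_power ennreal_mult)
  then have "(\<bar>A\<bar> / L)\<^sup>2 \<le> 2 * \<kappa>\<^sup>2 * H" using H by simp
  then have "\<bar>A\<bar>\<^sup>2 \<le> 2 * \<kappa>\<^sup>2 * H * L\<^sup>2" using L by (simp add: power_divide field_simps)
  \<comment> \<open>Arithmetic-geometric mean: the left side is 4 * H * (\<kappa>^2 * L^2 / 2).
    Since A - H = ln Z - \<integral>f d\<mu>, the entropy cancels and the claim about Z
    remains.\<close>
  also have "\<dots> \<le> (H + \<kappa>\<^sup>2 * L\<^sup>2 / 2)\<^sup>2"
    using zero_le_power2[of "H - \<kappa>\<^sup>2 * L\<^sup>2 / 2"] by (simp add: power2_sum power2_diff algebra_simps)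
  finally have "\<bar>A\<bar> \<le> H + \<kappa>\<^sup>2 * L\<^sup>2 / 2" by (rule power2_le_imp_le) (use H in simp)
  then have "ln Z \<le> (\<integral>y. f y \<partial>\<mu>) + \<kappa>\<^sup>2 * L\<^sup>2 / 2"
    unfolding A_def H_def by linarith
  then show ?thesis unfolding Z_def[symmetric] using Z by (metis exp_le_cancel_iff exp_ln)
qed

text \<open>Truncation at height k keeps the Lipschitz constant. As k grows, Fatou's lemma handles
  the exponential moments and dominated convergence the means in the exponent.\<close>

lemma T1_exponential_moment:
  assumes T1: "T1_inequality m \<mu> \<kappa>" and f: "lipschitz_fun L f" and L: "L > 0"
  shows "(\<integral>\<^sup>+y. ennreal (exp (f y)) \<partial>\<mu>) \<le> ennreal (exp ((\<integral>y. f y \<partial>\<mu>) + \<kappa>\<^sup>2 * L\<^sup>2 / 2))"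
proof -
  define h where "h = (\<lambda>(k::nat) y. max (- real k) (min (f y) (real k)))"
  have h_lip: "lipschitz_fun L (h k)" for k
    unfolding lipschitz_fun_def
  proof (intro ballI)
    fix x y assume "x \<in> mspace m" "y \<in> mspace m"
    then have "\<bar>f x - f y\<bar> \<le> L * mdist m x y" using f by (auto simp: lipschitz_fun_def)
    moreover have "\<bar>h k x - h k y\<bar> \<le> \<bar>f x - f y\<bar>" by (auto simp: h_def max_def min_def)
    ultimately show "\<bar>h k x - h k y\<bar> \<le> L * mdist m x y" by linarith
  qed
  note [measurable] = lipschitz_measurable[OF f] lipschitz_measurable[OF h_lip]
  have lim: "(\<lambda>k. h k y) \<longlonglongrightarrow> f y" for y
  proof (rule tendsto_eventually)
    obtain k0 :: nat where "\<bar>f y\<bar> \<le> real k0" using real_arch_simple by blast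
    then have "h k y = f y" if "k \<ge> k0" for k
      using that by (auto simp: h_def max_def min_def abs_le_iff)
    then show "\<forall>\<^sub>F k in sequentially. h k y = f y" by (auto simp: eventually_sequentially)
  qed
  have "(\<lambda>k. \<integral>y. h k y \<partial>\<mu>) \<longlonglongrightarrow> (\<integral>y. f y \<partial>\<mu>)"
    by (rule integral_dominated_convergence[where w = "\<lambda>y. \<bar>f y\<bar>"])
      (use lim lipschitz_integrable[OF f] in \<open>auto simp: h_def max_def min_def\<close>)
  then have lim_rhs: "(\<lambda>k. ennreal (exp ((\<integral>y. h k y \<partial>\<mu>) + \<kappa>\<^sup>2 * L\<^sup>2 / 2))) \<longlonglongrightarrow> ennreal (exp ((\<integral>y. f y \<partial>\<mu>) + \<kappa>\<^sup>2 * L\<^sup>2 / 2))"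
    by (intro tendsto_ennrealI tendsto_intros)
  have bd: "(\<integral>\<^sup>+y. ennreal (exp (h k y)) \<partial>\<mu>) \<le> ennreal (exp ((\<integral>y. h k y \<partial>\<mu>) + \<kappa>\<^sup>2 * L\<^sup>2 / 2))" for k
  proof -
    have "integrable \<mu> (\<lambda>y. exp (h k y))"
      by (rule integrable_const_bound[where B = "exp (real k)"]) (auto simp: h_def)
    then have "(\<integral>\<^sup>+y. ennreal (exp (h k y)) \<partial>\<mu>) = ennreal (\<integral>y. exp (h k y) \<partial>\<mu>)"
      by (rule nn_integral_eq_integral) simp
    moreover have "\<bar>h k y\<bar> \<le> real k" for y by (auto simp: h_def)
    ultimately show ?thesis
      using T1_exponential_moment_bounded[OF T1 h_lip L, of k "real k"] by (auto intro: ennreal_leI)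
  qed
  have "(\<integral>\<^sup>+y. ennreal (exp (f y)) \<partial>\<mu>) = (\<integral>\<^sup>+y. liminf (\<lambda>k. ennreal (exp (h k y))) \<partial>\<mu>)"
    by (intro nn_integral_cong lim_imp_Liminf[symmetric] tendsto_ennrealI tendsto_exp lim) simp
  also have "\<dots> \<le> liminf (\<lambda>k. \<integral>\<^sup>+y. ennreal (exp (h k y)) \<partial>\<mu>)"
    by (rule nn_integral_liminf) measurable
  also have "\<dots> \<le> liminf (\<lambda>k. ennreal (exp ((\<integral>y. h k y \<partial>\<mu>) + \<kappa>\<^sup>2 * L\<^sup>2 / 2)))"
    by (rule Liminf_mono) (use bd in simp)
  also have "\<dots> = ennreal (exp ((\<integral>y. f y \<partial>\<mu>) + \<kappa>\<^sup>2 * L\<^sup>2 / 2))"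
    by (rule lim_imp_Liminf[OF _ lim_rhs]) simp
  finally show ?thesis .
qed

text \<open>Chernoff's bound. Here b is any upper bound of the mean, so that the rate can take its
  place.\<close>

lemma T1_concentration:
  fixes \<kappa> L a b :: real
  assumes T1: "T1_inequality m \<mu> \<kappa>" and \<kappa>: "\<kappa> > 0" and L: "L > 0"
    and I: "finite I" "I \<noteq> {}" and F: "sum_lipschitz I L F"
    and mean: "(\<integral>x. F x \<partial>PiM I (\<lambda>_. \<mu>)) \<le> b" and a: "a > 0"
  shows "measure (PiM I (\<lambda>_. \<mu>)) {x \<in> space (PiM I (\<lambda>_. \<mu>)). F x - b \<ge> a}
    \<le> exp (- a\<^sup>2 / (2 * card I * L\<^sup>2 * \<kappa>\<^sup>2))"
proof -
  let ?P = "PiM I (\<lambda>_. \<mu>)"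
  interpret P: prob_space ?P by (rule prob_space_PiM_power)
  have [measurable]: "F \<in> borel_measurable ?P" using F by (simp add: sum_lipschitz_def)
  define n where "n = real (card I)"
  have n: "n > 0" using I by (simp add: n_def card_gt_0_iff)
  \<comment> \<open>Minimiser of - s * a + n * \<kappa>^2 * (s * L)^2 / 2, the exponent that
    Markov's inequality leaves.\<close>
  define s where "s = a / (n * L\<^sup>2 * \<kappa>\<^sup>2)"
  have s: "s > 0" using a n L \<kappa> by (simp add: s_def)
  have dim1: "(\<integral>\<^sup>+y. ennreal (exp (s * f y)) \<partial>\<mu>) \<le> ennreal (exp (s * (\<integral>y. f y \<partial>\<mu>) + \<kappa>\<^sup>2 * (s * L)\<^sup>2 / 2))"
    if f: "lipschitz_fun L f" for f
  proof -
    have "lipschitz_fun (s * L) (\<lambda>y. s * f y)"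
      using f s by (auto simp: lipschitz_fun_def mult.assoc abs_mult simp flip: right_diff_distrib)
    from T1_exponential_moment[OF T1 this] show ?thesis using s L by simp
  qed
  have mgf: "(\<integral>\<^sup>+x. ennreal (exp (s * F x)) \<partial>?P) \<le> ennreal (exp (s * (\<integral>x. F x \<partial>?P) + n * (\<kappa>\<^sup>2 * (s * L)\<^sup>2 / 2)))"
    unfolding n_def by (rule sum_lipschitz_mgf[OF dim1 I(1) F])
  let ?c = "exp (s * (b + a))"
  have "emeasure ?P {x \<in> space ?P. F x - b \<ge> a} \<le>
     emeasure ?P ({x \<in> space ?P. 1 \<le> ennreal (1 / ?c) * ennreal (exp (s * F x))})"
  proof (rule emeasure_mono)
    show "{x \<in> space ?P. F x - b \<ge> a} \<subseteq> {x \<in> space ?P. 1 \<le> ennreal (1 / ?c) * ennreal (exp (s * F x))}"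
    proof safe
      fix x assume "F x - b \<ge> a"
      then have "s * (b + a) \<le> s * F x" using s by (intro mult_left_mono) auto
      then have "1 \<le> 1 / ?c * exp (s * F x)" by (simp add: field_simps)
      then have "ennreal 1 \<le> ennreal (1 / ?c * exp (s * F x))" by (rule ennreal_leI)
      also have "\<dots> = ennreal (1 / ?c) * ennreal (exp (s * F x))" by (rule ennreal_mult) auto
      finally show "1 \<le> ennreal (1 / ?c) * ennreal (exp (s * F x))" unfolding ennreal_1 .
    qed
  qed measurable
  also have "\<dots> \<le> ennreal (1 / ?c) * (\<integral>\<^sup>+x. ennreal (exp (s * F x)) * indicator (space ?P) x \<partial>?P)"
    by (rule nn_integral_Markov_inequality) measurable
  also have "(\<integral>\<^sup>+x. ennreal (exp (s * F x)) * indicator (space ?P) x \<partial>?P) = (\<integral>\<^sup>+x. ennreal (exp (s * F x)) \<partial>?P)"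
    by (rule nn_integral_cong) simp
  also have "ennreal (1 / ?c) * (\<integral>\<^sup>+x. ennreal (exp (s * F x)) \<partial>?P) \<le>
      ennreal (1 / ?c) * ennreal (exp (s * b + n * (\<kappa>\<^sup>2 * (s * L)\<^sup>2 / 2)))"
    using s mean by (intro mult_left_mono order_trans[OF mgf] ennreal_leI) (auto intro: mult_left_mono)
  also have "\<dots> = ennreal (exp (- a\<^sup>2 / (2 * n * L\<^sup>2 * \<kappa>\<^sup>2)))"
  proof -
    have "- (s * (b + a)) + (s * b + n * (\<kappa>\<^sup>2 * (s * L)\<^sup>2 / 2)) = - s * a + s * (n * L\<^sup>2 * \<kappa>\<^sup>2 * s) / 2"
      by (simp add: power2_eq_square algebra_simps)
    also have "n * L\<^sup>2 * \<kappa>\<^sup>2 * s = a" using n L \<kappa> by (simp add: s_def)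
    also have "- s * a + s * a / 2 = - a\<^sup>2 / (2 * n * L\<^sup>2 * \<kappa>\<^sup>2)"
      by (simp add: s_def power2_eq_square field_simps)
    finally have "- (s * (b + a)) + (s * b + n * (\<kappa>\<^sup>2 * (s * L)\<^sup>2 / 2)) = - a\<^sup>2 / (2 * n * L\<^sup>2 * \<kappa>\<^sup>2)" .
    moreover have "1 / ?c * exp (s * b + n * (\<kappa>\<^sup>2 * (s * L)\<^sup>2 / 2)) =
       exp (- (s * (b + a)) + (s * b + n * (\<kappa>\<^sup>2 * (s * L)\<^sup>2 / 2)))"
      unfolding exp_add exp_minus by (simp add: field_simps)
    ultimately show ?thesis by (simp add: ennreal_mult[symmetric])
  qed
  finally show ?thesis by (simp add: P.emeasure_eq_measure n_def)
qed

end

section \<open>Separability of the test class\<close>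

text \<open>A pointwise limit on a countable dense set is a limit in the second countable space
  \<open>nat \<Rightarrow> real\<close>; the common Lipschitz constant extends it to the whole space.\<close>

lemma lipschitz_class_separable:
  fixes \<Phi> :: "('a::euclidean_space \<Rightarrow> real) set"
  assumes lip: "\<And>f x y. f \<in> \<Phi> \<Longrightarrow> \<bar>f x - f y\<bar> \<le> L * norm (x - y)"
  obtains \<Phi>0 where "\<Phi>0 \<subseteq> \<Phi>" "countable \<Phi>0"
    "\<And>f. f \<in> \<Phi> \<Longrightarrow> \<exists>s. (\<forall>k::nat. s k \<in> \<Phi>0) \<and> (\<forall>x. (\<lambda>k. s k x) \<longlonglongrightarrow> f x)"
proof -
  obtain D :: "'a set" where D: "countable D" "\<And>X. open X \<Longrightarrow> X \<noteq> {} \<Longrightarrow> \<exists>d\<in>D. d \<in> X"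
    using countable_dense_exists by blast
  have "D \<noteq> {}" using D(2)[of UNIV] by auto
  define d where "d = from_nat_into D"
  have rd: "range d = D" using range_from_nat_into[OF \<open>D \<noteq> {}\<close> D(1)] by (simp add: d_def)
  define \<iota> where "\<iota> = (\<lambda>(f :: 'a \<Rightarrow> real) (k::nat). f (d k))"
  obtain S where S: "countable S" "S \<subseteq> \<iota> ` \<Phi>" "\<iota> ` \<Phi> \<subseteq> closure S"
    using separable[of "\<iota> ` \<Phi>"] by auto
  \<comment> \<open>S is dense inside the image of \<Phi>, so each of its elements has a preimage in
    \<Phi>; choosing one for each keeps \<Phi>0 a countable subset of \<Phi>.\<close>
  define \<Phi>0 where "\<Phi>0 = inv_into \<Phi> \<iota> ` S"
  have inv: "inv_into \<Phi> \<iota> u \<in> \<Phi>" "\<iota> (inv_into \<Phi> \<iota> u) = u" if "u \<in> S" for u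
  proof -
    have "u \<in> \<iota> ` \<Phi>" using that S(2) by blast
    then show "inv_into \<Phi> \<iota> u \<in> \<Phi>" "\<iota> (inv_into \<Phi> \<iota> u) = u"
      by (rule inv_into_into, rule f_inv_into_f)
  qed
  show thesis
  proof
    show "\<Phi>0 \<subseteq> \<Phi>" "countable \<Phi>0" using inv S(1) by (auto simp: \<Phi>0_def)
    fix f assume f: "f \<in> \<Phi>"
    then have "\<iota> f \<in> closure S" using S(3) by auto
    then obtain u where u: "\<And>k. u k \<in> S" "u \<longlonglongrightarrow> \<iota> f" unfolding closure_sequential by blast
    define s where "s = (\<lambda>k. inv_into \<Phi> \<iota> (u k))"
    have s: "s k \<in> \<Phi>" "\<iota> (s k) = u k" for k using inv u(1) by (auto simp: s_def)
    have lim_d: "(\<lambda>k. s k (d j)) \<longlonglongrightarrow> f (d j)" for j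
    proof -
      have "(\<lambda>k. u k j) \<longlonglongrightarrow> \<iota> f j"
        by (rule continuous_on_tendsto_compose[OF continuous_on_product_coordinates u(2)]) auto
      moreover have "u k j = s k (d j)" for k using fun_cong[OF s(2)[of k], of j] by (simp add: \<iota>_def)
      ultimately show ?thesis by (simp add: \<iota>_def)
    qed
    have "(\<lambda>k. s k x) \<longlonglongrightarrow> f x" for x
    proof (rule LIMSEQ_I)
      fix r :: real assume r: "0 < r"
      \<comment> \<open>One third of r is spent on moving x to d j under s k, one on the same move
        under f, and one on the convergence at d j. The added 1 avoids a division by zero when L =
        0.\<close>
      define e where "e = r / (3 * (\<bar>L\<bar> + 1))"
      have e: "e > 0" using r by (simp add: e_def)
      have Le: "\<bar>L\<bar> * e \<le> r / 3"
      proof -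
        have "\<bar>L\<bar> * e \<le> (\<bar>L\<bar> + 1) * e" using e by simp
        also have "\<dots> = r / 3" unfolding e_def by (simp add: field_simps)
        finally show ?thesis .
      qed
      obtain j where j: "d j \<in> ball x e"
        using D(2)[of "ball x e"] e rd by (metis centre_in_ball empty_iff open_ball rangeE)
      then have nx: "norm (x - d j) \<le> e" by (simp add: dist_norm)
      have close: "\<bar>g x - g (d j)\<bar> \<le> r / 3" if "g \<in> \<Phi>" for g
      proof -
        have "\<bar>g x - g (d j)\<bar> \<le> L * norm (x - d j)" by (rule lip[OF that])
        also have "\<dots> \<le> \<bar>L\<bar> * e" by (rule mult_mono) (use nx in auto)
        finally show ?thesis using Le by linarith
      qed
      from LIMSEQ_D[OF lim_d[of j], of "r / 3"] r
      obtain k0 where k0: "\<And>k. k \<ge> k0 \<Longrightarrow> norm (s k (d j) - f (d j)) < r / 3" by auto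
      have "norm (s k x - f x) < r" if "k \<ge> k0" for k
        using close[OF s(1)[of k]] close[OF f] k0[OF that] unfolding real_norm_def by linarith
      then show "\<exists>k0. \<forall>k\<ge>k0. norm (s k x - f x) < r" by blast
    qed
    moreover have "s k \<in> \<Phi>0" for k using u(1) by (auto simp: s_def \<Phi>0_def)
    ultimately show "\<exists>s. (\<forall>k::nat. s k \<in> \<Phi>0) \<and> (\<forall>x. (\<lambda>k. s k x) \<longlonglongrightarrow> f x)" by blast
  qed
qed

text \<open>Merges the time and the test function into one index, so that the supremum over t of the
  integral probability metric is a single supremum over functions that are Lipschitz for the uniform
  distance.\<close>

definition eval_class :: "real \<Rightarrow> ('a \<Rightarrow> real) set \<Rightarrow> ((real \<Rightarrow> 'a) \<Rightarrow> real) set" where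
  "eval_class T \<Phi> = (\<lambda>(t, f) y. f (y t)) ` ({0..T} \<times> \<Phi>)"

text \<open>The times and the test functions are approximated simultaneously:
  \<open>s k (y (\<tau> k))\<close> differs from \<open>s k (y t)\<close> by at most L times an
  increment of y, which vanishes by continuity, and \<open>s k (y t)\<close> converges by the choice
  of s. Continuity is why the limit is claimed for y in path space only.\<close>

lemma eval_class_separable:
  fixes \<Phi> :: "('a::euclidean_space \<Rightarrow> real) set"
  assumes lip: "\<And>f x y. f \<in> \<Phi> \<Longrightarrow> \<bar>f x - f y\<bar> \<le> L * norm (x - y)"
  obtains C where "C \<subseteq> eval_class T \<Phi>" "countable C"
    "\<And>g. g \<in> eval_class T \<Phi> \<Longrightarrow>
       \<exists>s. (\<forall>k::nat. s k \<in> C) \<and> (\<forall>y\<in>mspace (path_space T). (\<lambda>k. s k y) \<longlonglongrightarrow> g y)"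
proof -
  obtain \<Phi>0 where \<Phi>0: "\<Phi>0 \<subseteq> \<Phi>" "countable \<Phi>0"
    "\<And>f. f \<in> \<Phi> \<Longrightarrow> \<exists>s. (\<forall>k::nat. s k \<in> \<Phi>0) \<and> (\<forall>x. (\<lambda>k. s k x) \<longlonglongrightarrow> f x)"
    using lipschitz_class_separable[OF lip] by blast
  obtain T0 where T0: "countable T0" "T0 \<subseteq> {0..T}" "{0..T} \<subseteq> closure T0"
    using separable[of "{0..T}"] by auto
  show thesis
  proof
    show "(\<lambda>(t, f) y. f (y t)) ` (T0 \<times> \<Phi>0) \<subseteq> eval_class T \<Phi>"
      using \<Phi>0(1) T0(2) by (auto simp: eval_class_def)
    show "countable ((\<lambda>(t, f) y. f (y t)) ` (T0 \<times> \<Phi>0))"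
      using T0(1) \<Phi>0(2) by auto
    fix g assume "g \<in> eval_class T \<Phi>"
    then obtain t f where t: "t \<in> {0..T}" and f: "f \<in> \<Phi>" and g: "g = (\<lambda>y. f (y t))"
      by (auto simp: eval_class_def)
    from \<Phi>0(3)[OF f] obtain s where s: "\<And>k::nat. s k \<in> \<Phi>0" "\<And>x. (\<lambda>k. s k x) \<longlonglongrightarrow> f x" by blast
    have "t \<in> closure T0" using t T0(3) by auto
    then obtain \<tau> where \<tau>: "\<And>k. \<tau> k \<in> T0" "\<tau> \<longlonglongrightarrow> t" unfolding closure_sequential by blast
    have "(\<lambda>k. s k (y (\<tau> k))) \<longlonglongrightarrow> f (y t)" if y: "y \<in> mspace (path_space T)" for y
    proof -
      have "continuous_on {0..T} y" using y by (simp add: mspace_path_space)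
      then have "(\<lambda>k. y (\<tau> k)) \<longlonglongrightarrow> y t"
        by (rule continuous_on_tendsto_compose[OF _ \<tau>(2) t]) (rule always_eventually, use \<tau>(1) T0(2) in blast)
      then have "(\<lambda>k. norm (y (\<tau> k) - y t)) \<longlonglongrightarrow> 0"
        by (simp add: tendsto_norm_zero_iff LIM_zero)
      then have "(\<lambda>k. L * norm (y (\<tau> k) - y t)) \<longlonglongrightarrow> 0" by (rule tendsto_mult_right_zero)
      moreover have "\<forall>\<^sub>F k in sequentially. norm (s k (y (\<tau> k)) - s k (y t)) \<le> L * norm (y (\<tau> k) - y t)"
        unfolding real_norm_def using s(1) \<Phi>0(1) by (intro always_eventually allI lip) blast
      ultimately have "(\<lambda>k. s k (y (\<tau> k)) - s k (y t)) \<longlonglongrightarrow> 0" by (rule Lim_null_comparison[rotated])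
      from tendsto_add[OF this s(2)[of "y t"]] show ?thesis by simp
    qed
    moreover have "(\<lambda>y. s k (y (\<tau> k))) \<in> (\<lambda>(t, f) y. f (y t)) ` (T0 \<times> \<Phi>0)" for k
      using s(1) \<tau>(1) by auto
    ultimately show "\<exists>s. (\<forall>k::nat. s k \<in> (\<lambda>(t, f) y. f (y t)) ` (T0 \<times> \<Phi>0)) \<and>
        (\<forall>y\<in>mspace (path_space T). (\<lambda>k. s k y) \<longlonglongrightarrow> g y)"
      unfolding g by (intro exI[of _ "\<lambda>k y. s k (y (\<tau> k))"]) auto
  qed
qed

section \<open>Uniform empirical deviations\<close>

lemma abs_cSUP_diff_le:
  fixes u v :: "'b \<Rightarrow> real"
  assumes "S \<noteq> {}" "bdd_above (u ` S)" "bdd_above (v ` S)" "\<And>f. f \<in> S \<Longrightarrow> \<bar>u f - v f\<bar> \<le> c"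
  shows "\<bar>(SUP f\<in>S. u f) - (SUP f\<in>S. v f)\<bar> \<le> c"
proof -
  have "(SUP f\<in>S. u f) \<le> (SUP f\<in>S. v f) + c"
  proof (rule cSUP_least[OF assms(1)])
    fix f assume f: "f \<in> S"
    then have "u f \<le> v f + c" using assms(4)[OF f] by linarith
    then show "u f \<le> (SUP f\<in>S. v f) + c" using cSUP_upper[OF f assms(3)] by linarith
  qed
  moreover have "(SUP f\<in>S. v f) \<le> (SUP f\<in>S. u f) + c"
  proof (rule cSUP_least[OF assms(1)])
    fix f assume f: "f \<in> S"
    then have "v f \<le> u f + c" using assms(4)[OF f] by linarith
    then show "v f \<le> (SUP f\<in>S. u f) + c" using cSUP_upper[OF f assms(2)] by linarith
  qed
  ultimately show ?thesis by linarith
qed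

context metric_prob_space
begin

definition empirical_deviation :: "'i set \<Rightarrow> ('i \<Rightarrow> 's) \<Rightarrow> ('s \<Rightarrow> real) \<Rightarrow> real" where
  "empirical_deviation I x g = (\<integral>y. g y \<partial>\<mu>) - (\<Sum>i\<in>I. g (x i)) / card I"

definition empirical_sup :: "('s \<Rightarrow> real) set \<Rightarrow> 'i set \<Rightarrow> ('i \<Rightarrow> 's) \<Rightarrow> real" where
  "empirical_sup C I x = (SUP g\<in>C. \<bar>empirical_deviation I x g\<bar>)"

text \<open>Constants cancel between the two averages, so both are compared with g z0. The bound
  does not depend on g, which makes the real supremum in \<open>empirical_sup\<close> a genuine
  one.\<close>

lemma abs_empirical_deviation_le:
  assumes g: "lipschitz_fun A g" and I: "finite I" "I \<noteq> {}" and x: "x \<in> space (PiM I (\<lambda>_. \<mu>))"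
  shows "\<bar>empirical_deviation I x g\<bar> \<le> A * (\<integral>y. mdist m y z0 \<partial>\<mu>) + A * (\<Sum>i\<in>I. mdist m (x i) z0) / card I"
proof -
  have n: "real (card I) > 0" using I by (simp add: card_gt_0_iff)
  have xi: "x i \<in> mspace m" if "i \<in> I" for i using x that by (auto simp: space_PiM)
  have "\<bar>(\<integral>y. g y \<partial>\<mu>) - g z0\<bar> = \<bar>\<integral>y. g y - g z0 \<partial>\<mu>\<bar>"
    using lipschitz_integrable[OF g] by simp
  also have "\<dots> \<le> (\<integral>y. \<bar>g y - g z0\<bar> \<partial>\<mu>)" by (rule integral_abs_bound)
  also have "\<dots> \<le> (\<integral>y. A * mdist m y z0 \<partial>\<mu>)"
    using lipschitz_integrable[OF g] integrable_dist_base g base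
    by (intro integral_mono) (auto simp: lipschitz_fun_def)
  finally have 1: "\<bar>(\<integral>y. g y \<partial>\<mu>) - g z0\<bar> \<le> A * (\<integral>y. mdist m y z0 \<partial>\<mu>)" by simp
  have "\<bar>(\<Sum>i\<in>I. g (x i)) / card I - g z0\<bar> = \<bar>(\<Sum>i\<in>I. g (x i) - g z0) / card I\<bar>"
    using n by (simp add: sum_subtractf field_simps)
  also have "\<dots> = \<bar>\<Sum>i\<in>I. g (x i) - g z0\<bar> / card I" using n by simp
  also have "\<dots> \<le> (\<Sum>i\<in>I. A * mdist m (x i) z0) / card I"
    by (intro divide_right_mono order_trans[OF sum_abs] sum_mono) (use g base xi in \<open>auto simp: lipschitz_fun_def\<close>)
  also have "\<dots> = A * (\<Sum>i\<in>I. mdist m (x i) z0) / card I" by (simp add: sum_distrib_left)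
  finally have 2: "\<bar>(\<Sum>i\<in>I. g (x i)) / card I - g z0\<bar> \<le> A * (\<Sum>i\<in>I. mdist m (x i) z0) / card I" .
  show ?thesis
    unfolding empirical_deviation_def using 1 2 by linarith
qed

lemma bdd_above_empirical_deviation:
  assumes "\<And>g. g \<in> C \<Longrightarrow> lipschitz_fun A g" "finite I" "I \<noteq> {}" "x \<in> space (PiM I (\<lambda>_. \<mu>))"
  shows "bdd_above ((\<lambda>g. \<bar>empirical_deviation I x g\<bar>) ` C)"
  by (rule bdd_aboveI2) (rule abs_empirical_deviation_le, use assms in auto)

lemma empirical_sup_upper:
  assumes "\<And>g. g \<in> C \<Longrightarrow> lipschitz_fun A g" "finite I" "I \<noteq> {}" "x \<in> space (PiM I (\<lambda>_. \<mu>))" "g \<in> C"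
  shows "\<bar>empirical_deviation I x g\<bar> \<le> empirical_sup C I x"
  unfolding empirical_sup_def
  by (rule cSUP_upper[OF assms(5) bdd_above_empirical_deviation[OF assms(1-4)]])

text \<open>Replaces an uncountable supremum by a countable one. Pointwise limits pass to the
  empirical average directly and to the mean by dominated convergence: the values at z0 converge,
  hence are bounded, and the common Lipschitz constant supplies the dominating function.\<close>

lemma empirical_sup_eq_dense:
  assumes lip: "\<And>g. g \<in> C \<Longrightarrow> lipschitz_fun A g" and I: "finite I" "I \<noteq> {}"
    and C0: "C0 \<subseteq> C" "C \<noteq> {}"
    and dense: "\<And>g. g \<in> C \<Longrightarrow> \<exists>s. (\<forall>k::nat. s k \<in> C0) \<and> (\<forall>y\<in>mspace m. (\<lambda>k. s k y) \<longlonglongrightarrow> g y)"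
    and x: "x \<in> space (PiM I (\<lambda>_. \<mu>))"
  shows "empirical_sup C I x = empirical_sup C0 I x"
proof (rule antisym)
  have lip0: "lipschitz_fun A g" if "g \<in> C0" for g using that C0 lip by auto
  have ne0: "C0 \<noteq> {}" using C0(2) dense by blast
  show "empirical_sup C0 I x \<le> empirical_sup C I x"
    unfolding empirical_sup_def
    by (rule cSUP_subset_mono[OF ne0 bdd_above_empirical_deviation[OF lip I x] C0(1)]) auto
  show "empirical_sup C I x \<le> empirical_sup C0 I x"
    unfolding empirical_sup_def[of C]
  proof (rule cSUP_least[OF C0(2)])
    fix g assume g: "g \<in> C"
    from dense[OF g] obtain s where s: "\<And>k::nat. s k \<in> C0" "\<And>y. y \<in> mspace m \<Longrightarrow> (\<lambda>k. s k y) \<longlonglongrightarrow> g y"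
      by blast
    have "Bseq (\<lambda>k. s k z0)" using s(2)[OF base] by (rule convergentI[THEN convergent_imp_Bseq])
    then obtain B where B: "\<And>k. \<bar>s k z0\<bar> \<le> B" unfolding Bseq_def by auto
    have "(\<lambda>k. \<integral>y. s k y \<partial>\<mu>) \<longlonglongrightarrow> (\<integral>y. g y \<partial>\<mu>)"
    proof (rule integral_dominated_convergence[where w = "\<lambda>y. B + A * mdist m y z0"])
      show "integrable \<mu> (\<lambda>y. B + A * mdist m y z0)" using integrable_dist_base by simp
      show "AE y in \<mu>. norm (s k y) \<le> B + A * mdist m y z0" for k
      proof (rule AE_I2)
        fix y assume "y \<in> space \<mu>"
        then have "\<bar>s k y - s k z0\<bar> \<le> A * mdist m y z0" using lip0[OF s(1)] base by (auto simp: lipschitz_fun_def)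
        then show "norm (s k y) \<le> B + A * mdist m y z0" using B[of k] unfolding real_norm_def by linarith
      qed
    qed (use s lip[OF g] lip0[OF s(1)] lipschitz_measurable in auto)
    moreover have "(\<lambda>k. (\<Sum>i\<in>I. s k (x i)) / card I) \<longlonglongrightarrow> (\<Sum>i\<in>I. g (x i)) / card I"
      using I x by (intro tendsto_divide tendsto_sum s(2) tendsto_const) (auto simp: space_PiM)
    ultimately have "(\<lambda>k. \<bar>empirical_deviation I x (s k)\<bar>) \<longlonglongrightarrow> \<bar>empirical_deviation I x g\<bar>"
      unfolding empirical_deviation_def by (intro tendsto_rabs tendsto_diff)
    then show "\<bar>empirical_deviation I x g\<bar> \<le> empirical_sup C0 I x"
      by (rule LIMSEQ_le_const2) (use empirical_sup_upper[OF lip0 I x s(1)] in auto)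
  qed
qed

lemma abs_empirical_sup_diff_le:
  assumes lip: "\<And>g. g \<in> C \<Longrightarrow> lipschitz_fun A g" and C: "C \<noteq> {}" and I: "finite I" "I \<noteq> {}"
    and x: "x \<in> space (PiM I (\<lambda>_. \<mu>))" and x': "x' \<in> space (PiM I (\<lambda>_. \<mu>))"
  shows "\<bar>empirical_sup C I x - empirical_sup C I x'\<bar> \<le> A / real (card I) * (\<Sum>i\<in>I. mdist m (x i) (x' i))"
  unfolding empirical_sup_def
proof (rule abs_cSUP_diff_le[OF C])
  show "bdd_above ((\<lambda>g. \<bar>empirical_deviation I x g\<bar>) ` C)" "bdd_above ((\<lambda>g. \<bar>empirical_deviation I x' g\<bar>) ` C)"
    by (rule bdd_above_empirical_deviation[OF lip I x] bdd_above_empirical_deviation[OF lip I x']; assumption)+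
  fix g assume g: "g \<in> C"
  have n: "real (card I) > 0" using I by (simp add: card_gt_0_iff)
  have "\<bar>\<bar>empirical_deviation I x g\<bar> - \<bar>empirical_deviation I x' g\<bar>\<bar> \<le> \<bar>empirical_deviation I x g - empirical_deviation I x' g\<bar>"
    by (rule abs_triangle_ineq3)
  also have "empirical_deviation I x g - empirical_deviation I x' g = - (\<Sum>i\<in>I. g (x i) - g (x' i)) / card I"
    unfolding empirical_deviation_def using n by (simp add: sum_subtractf field_simps)
  also have "\<bar>\<dots>\<bar> = \<bar>\<Sum>i\<in>I. g (x i) - g (x' i)\<bar> / card I" using n by simp
  also have "\<dots> \<le> (\<Sum>i\<in>I. A * mdist m (x i) (x' i)) / card I"
    by (intro divide_right_mono order_trans[OF sum_abs] sum_mono)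
      (use lip[OF g] x x' in \<open>auto simp: lipschitz_fun_def space_PiM\<close>)
  also have "\<dots> = A / real (card I) * (\<Sum>i\<in>I. mdist m (x i) (x' i))" by (simp add: sum_distrib_left sum_divide_distrib)
  finally show "\<bar>\<bar>empirical_deviation I x g\<bar> - \<bar>empirical_deviation I x' g\<bar>\<bar> \<le> A / real (card I) * (\<Sum>i\<in>I. mdist m (x i) (x' i))" .
qed

lemma measurable_empirical_sup_countable:
  assumes lip: "\<And>g. g \<in> C \<Longrightarrow> lipschitz_fun A g" and "countable C" and I: "finite I" "I \<noteq> {}"
  shows "empirical_sup C I \<in> borel_measurable (PiM I (\<lambda>_. \<mu>))"
  unfolding empirical_sup_def[abs_def]
proof (rule borel_measurable_cSUP[OF assms(2)])
  fix g assume g: "g \<in> C"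
  note [measurable] = lipschitz_measurable[OF lip[OF g]]
  show "(\<lambda>x. \<bar>empirical_deviation I x g\<bar>) \<in> borel_measurable (PiM I (\<lambda>_. \<mu>))"
    unfolding empirical_deviation_def by measurable
qed (rule bdd_above_empirical_deviation[OF lip I])

text \<open>Measurability comes from the countable subclass, the Lipschitz estimate from the full
  one.\<close>

lemma sum_lipschitz_empirical_sup:
  assumes lip: "\<And>g. g \<in> C \<Longrightarrow> lipschitz_fun A g" and I: "finite I" "I \<noteq> {}"
    and C0: "C0 \<subseteq> C" "countable C0" "C \<noteq> {}"
    and dense: "\<And>g. g \<in> C \<Longrightarrow> \<exists>s. (\<forall>k::nat. s k \<in> C0) \<and> (\<forall>y\<in>mspace m. (\<lambda>k. s k y) \<longlonglongrightarrow> g y)"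
  shows "sum_lipschitz I (A / card I) (empirical_sup C I)"
  unfolding sum_lipschitz_def
proof (intro conjI ballI)
  have lip0: "lipschitz_fun A g" if "g \<in> C0" for g using that C0 lip by auto
  have "empirical_sup C0 I \<in> borel_measurable (PiM I (\<lambda>_. \<mu>))"
    by (rule measurable_empirical_sup_countable[OF lip0 C0(2) I])
  then show "empirical_sup C I \<in> borel_measurable (PiM I (\<lambda>_. \<mu>))"
    by (rule measurable_cong[THEN iffD1, rotated])
      (use empirical_sup_eq_dense[OF lip I C0(1,3) dense] in simp)
qed (rule abs_empirical_sup_diff_le[OF lip C0(3) I])

text \<open>Turns a bound on Rademacher averages at each fixed sample into a bound on the mean.
  Symmetrization is applied to the countable C0, whose Rademacher supremum is below that of C; the
  factor \<open>card I\<close> removes the normalisation of the empirical average.\<close>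

lemma expectation_empirical_sup_le:
  fixes I :: "'i set" and B :: "('i \<Rightarrow> 's) \<Rightarrow> real"
  assumes lip: "\<And>g. g \<in> C \<Longrightarrow> lipschitz_fun A g" and I: "finite I" "I \<noteq> {}"
    and C0: "C0 \<subseteq> C" "countable C0" "C \<noteq> {}"
    and dense: "\<And>g. g \<in> C \<Longrightarrow> \<exists>s. (\<forall>k::nat. s k \<in> C0) \<and> (\<forall>y\<in>mspace m. (\<lambda>k. s k y) \<longlonglongrightarrow> g y)"
    and B: "integrable (PiM I (\<lambda>_. \<mu>)) B" "\<And>x. x \<in> space (PiM I (\<lambda>_. \<mu>)) \<Longrightarrow> B x \<ge> 0"
    and bound: "\<And>x. x \<in> space (PiM I (\<lambda>_. \<mu>)) \<Longrightarrow>
      (\<integral>\<^sup>+\<xi>. (SUP g\<in>C. ennreal \<bar>\<Sum>i\<in>I. \<xi> i * g (x i)\<bar>) \<partial>rademacher I) \<le> ennreal (B x)"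
  shows "real (card I) * (\<integral>x. empirical_sup C I x \<partial>PiM I (\<lambda>_. \<mu>)) \<le> 2 * (\<integral>x. B x \<partial>PiM I (\<lambda>_. \<mu>))"
proof -
  let ?P = "PiM I (\<lambda>_. \<mu>)"
  have n: "real (card I) > 0" using I by (simp add: card_gt_0_iff)
  have lip0: "lipschitz_fun A g" if "g \<in> C0" for g using that C0 lip by auto
  have ne0: "C0 \<noteq> {}" using C0(3) dense by blast
  have int: "integrable ?P (empirical_sup C I)"
    by (rule sum_lipschitz_integrable[OF I(1) sum_lipschitz_empirical_sup[OF lip I C0 dense]])
  have nonneg: "empirical_sup C I x \<ge> 0" if "x \<in> space ?P" for x
  proof -
    obtain g where g: "g \<in> C" using C0(3) by blast
    show ?thesis using empirical_sup_upper[OF lip I that g] abs_ge_zero[of "empirical_deviation I x g"] by linarith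
  qed
  have "ennreal (card I * (\<integral>x. empirical_sup C I x \<partial>?P)) = ennreal (\<integral>x. real (card I) * empirical_sup C I x \<partial>?P)"
    by simp
  also have "\<dots> = (\<integral>\<^sup>+x. ennreal (card I * empirical_sup C I x) \<partial>?P)"
    by (rule nn_integral_eq_integral[symmetric]) (use int nonneg in auto)
  also have "\<dots> \<le> (\<integral>\<^sup>+x. (SUP g\<in>C0. ennreal \<bar>\<Sum>i\<in>I. g (x i) - (\<integral>y. g y \<partial>\<mu>)\<bar>) \<partial>?P)"
  proof (rule nn_integral_mono)
    fix x assume x: "x \<in> space ?P"
    define U where "U = (SUP g\<in>C0. ennreal \<bar>\<Sum>i\<in>I. g (x i) - (\<integral>y. g y \<partial>\<mu>)\<bar>)"
    have "ennreal (card I * empirical_sup C I x) \<le> U"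
    proof (cases U)
      case (real u)
      have "\<bar>empirical_deviation I x g\<bar> \<le> u / card I" if g: "g \<in> C0" for g
      proof -
        have "ennreal \<bar>\<Sum>i\<in>I. g (x i) - (\<integral>y. g y \<partial>\<mu>)\<bar> \<le> U" unfolding U_def by (rule SUP_upper[OF g])
        then have "\<bar>\<Sum>i\<in>I. g (x i) - (\<integral>y. g y \<partial>\<mu>)\<bar> \<le> u" using real by simp
        moreover have "(\<Sum>i\<in>I. g (x i) - (\<integral>y. g y \<partial>\<mu>)) = - (real (card I) * empirical_deviation I x g)"
          using n by (simp add: sum_subtractf empirical_deviation_def field_simps)
        ultimately have "real (card I) * \<bar>empirical_deviation I x g\<bar> \<le> u" by (simp add: abs_mult)
        then show ?thesis using n by (simp add: field_simps)
      qed
      then have "empirical_sup C0 I x \<le> u / card I"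
        unfolding empirical_sup_def by (rule cSUP_least[OF ne0])
      then have "real (card I) * empirical_sup C I x \<le> u"
        using n empirical_sup_eq_dense[OF lip I C0(1,3) dense x] by (simp add: field_simps)
      then show ?thesis unfolding real by (rule ennreal_leI)
    qed simp
    then show "ennreal (card I * empirical_sup C I x) \<le> (SUP g\<in>C0. ennreal \<bar>\<Sum>i\<in>I. g (x i) - (\<integral>y. g y \<partial>\<mu>)\<bar>)"
      unfolding U_def .
  qed
  also have "\<dots> \<le> 2 * (\<integral>\<^sup>+x. \<integral>\<^sup>+\<xi>. (SUP g\<in>C0. ennreal \<bar>\<Sum>i\<in>I. \<xi> i * g (x i)\<bar>) \<partial>rademacher I \<partial>?P)"
    by (rule symmetrization_rademacher[OF prob_space_axioms I(1) C0(2) lipschitz_integrable[OF lip0]])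
  also have "\<dots> \<le> 2 * (\<integral>\<^sup>+x. ennreal (B x) \<partial>?P)"
  proof (intro mult_left_mono nn_integral_mono)
    fix x assume x: "x \<in> space ?P"
    have "(\<integral>\<^sup>+\<xi>. (SUP g\<in>C0. ennreal \<bar>\<Sum>i\<in>I. \<xi> i * g (x i)\<bar>) \<partial>rademacher I) \<le>
       (\<integral>\<^sup>+\<xi>. (SUP g\<in>C. ennreal \<bar>\<Sum>i\<in>I. \<xi> i * g (x i)\<bar>) \<partial>rademacher I)"
      by (intro nn_integral_mono SUP_subset_mono C0(1)) auto
    also note bound[OF x]
    finally show "(\<integral>\<^sup>+\<xi>. (SUP g\<in>C0. ennreal \<bar>\<Sum>i\<in>I. \<xi> i * g (x i)\<bar>) \<partial>rademacher I) \<le> ennreal (B x)" .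
  qed simp
  also have "(\<integral>\<^sup>+x. ennreal (B x) \<partial>?P) = ennreal (\<integral>x. B x \<partial>?P)"
    by (rule nn_integral_eq_integral[OF B(1)]) (use B(2) in auto)
  also have "2 * ennreal (\<integral>x. B x \<partial>?P) = ennreal (2 * (\<integral>x. B x \<partial>?P))"
    by (simp add: ennreal_mult')
  finally show ?thesis
    by (subst (asm) ennreal_le_iff) (use B in \<open>auto intro!: integral_nonneg_AE\<close>)
qed

end

section \<open>Rademacher averages along paths\<close>

lemma admissible_test_classD:
  fixes \<Phi> :: "('a::euclidean_space \<Rightarrow> real) set" and n :: nat
  assumes "admissible_test_class \<Phi> A1 A2 A3"
  shows "\<Phi> \<noteq> {}" "A1 \<ge> 0" "A2 \<ge> 0" "A3 > 0"
    and "f \<in> \<Phi> \<Longrightarrow> \<bar>f x - f y\<bar> \<le> A1 * norm (x - y)"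
    and "f \<in> \<Phi> \<Longrightarrow> \<bar>f x\<bar> \<le> A2 + A1 * norm x"
    and "n \<ge> 1 \<Longrightarrow> measure_pmf.expectation (rademacher {1..n}) (\<lambda>\<xi>. SUP f\<in>\<Phi>. \<bar>\<Sum>i=1..n. \<xi> i * f (u i)\<bar>)
      \<le> A3 * sqrt (\<Sum>i=1..n. (norm (u i))\<^sup>2 + 1)"
proof -
  have A1: "ereal A1 = (SUP f\<in>\<Phi>. Lip f)" and A2: "ereal A2 = (SUP f\<in>\<Phi>. ereal \<bar>f 0\<bar>)"
    and rad: "\<And>n u. n \<ge> 1 \<Longrightarrow> 1 / real n *
       measure_pmf.expectation (rademacher {1..n}) (\<lambda>\<xi>. SUP f\<in>\<Phi>. \<bar>\<Sum>i=1..n. \<xi> i * f (u i)\<bar>)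
       \<le> A3 / real n * sqrt (\<Sum>i=1..n. (norm (u i))\<^sup>2 + 1)"
    using assms by (auto simp: admissible_test_class_def)
  show "A3 > 0" using assms by (auto simp: admissible_test_class_def)
  show ne: "\<Phi> \<noteq> {}" using A2 by (auto simp: bot_ereal_def)
  have lip: "\<bar>f x - f y\<bar> \<le> A1 * norm (x - y)" if f: "f \<in> \<Phi>" for f x y
  proof (cases "x = y")
    case False
    have "ereal (\<bar>f x - f y\<bar> / norm (x - y)) \<le> Lip f"
      unfolding Lip_def by (rule SUP_upper2[of "(x, y)"]) (use False in auto)
    also have "\<dots> \<le> ereal A1" unfolding A1 by (rule SUP_upper[OF f])
    finally show ?thesis using False by (simp add: field_simps)
  qed simp
  then show "f \<in> \<Phi> \<Longrightarrow> \<bar>f x - f y\<bar> \<le> A1 * norm (x - y)" .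
  obtain f0 where f0: "f0 \<in> \<Phi>" using ne by blast
  \<comment> \<open>A basis vector differs from 0, so the Lipschitz inequality between these two
    points forces the sign of A1.\<close>
  obtain b :: 'a where b: "b \<in> Basis" using nonempty_Basis by blast
  have "0 \<le> A1 * norm (b - 0)" using lip[OF f0, of b 0] by linarith
  then show "A1 \<ge> 0" using b by simp
  have f_0: "\<bar>f 0\<bar> \<le> A2" if "f \<in> \<Phi>" for f
  proof -
    have "ereal \<bar>f 0\<bar> \<le> ereal A2" unfolding A2 by (rule SUP_upper[OF that])
    then show ?thesis by simp
  qed
  show "A2 \<ge> 0" using f_0[OF f0] by linarith
  show "f \<in> \<Phi> \<Longrightarrow> \<bar>f x\<bar> \<le> A2 + A1 * norm x" using lip[of f x 0] f_0[of f] by auto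
  show "measure_pmf.expectation (rademacher {1..n}) (\<lambda>\<xi>. SUP f\<in>\<Phi>. \<bar>\<Sum>i=1..n. \<xi> i * f (u i)\<bar>)
      \<le> A3 * sqrt (\<Sum>i=1..n. (norm (u i))\<^sup>2 + 1)" if "n \<ge> 1"
    using rad[OF that, of u] that by (simp add: field_simps)
qed

text \<open>The grid omits 0 so as to have exactly N points; t = 0 is served by the first of them,
  at distance T / N. Every other t is rounded up.\<close>

lemma ex_grid_point:
  assumes "T > 0" "N \<ge> 1" "t \<in> {0..T}"
  obtains j where "j \<in> {1..N}" "\<bar>t - real j * T / real N\<bar> \<le> T / real N"
proof (cases "t = 0")
  case True
  show ?thesis by (rule that[of 1]) (use True assms in auto)
next
  case False
  then have t: "t > 0" "t \<le> T" using assms by auto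
  define j where "j = nat \<lceil>t * N / T\<rceil>"
  have pos: "t * N / T > 0" using t assms by simp
  have j: "real j = of_int \<lceil>t * N / T\<rceil>" using pos by (simp add: j_def)
  have j1: "t * N / T \<le> real j" "real j < t * N / T + 1" unfolding j by linarith+
  have "t * N / T \<le> real N" using t assms by (simp add: field_simps)
  then have "j \<le> N" by (simp add: j_def ceiling_le_iff)
  moreover have "j \<ge> 1" using pos by (simp add: j_def Suc_le_eq)
  moreover have "\<bar>t - real j * T / real N\<bar> \<le> T / real N"
  proof -
    have "t \<le> real j * T / N" using j1(1) assms by (simp add: field_simps)
    moreover have "real j * T / N \<le> t + T / N" using j1(2) assms by (simp add: field_simps)
    ultimately show ?thesis by linarith
  qed
  ultimately show ?thesis using that by auto
qed

text \<open>The sample is frozen here. The same sum of squared norms controls the mean at each grid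
  time, through the third admissibility condition, and the variance proxy of the maximal inequality;
  hence one common square root.\<close>

lemma rademacher_eval_class_bound:
  fixes \<Phi> :: "('a::euclidean_space \<Rightarrow> real) set" and x :: "nat \<Rightarrow> real \<Rightarrow> 'a" and n N :: nat
  assumes adm: "admissible_test_class \<Phi> A1 A2 A3" and T: "T > 0" and N: "N \<ge> 1" "ln (real N) \<le> L"
    and n: "n \<ge> 1" and x: "\<And>i. i \<in> {1..n} \<Longrightarrow> x i \<in> mspace (path_space T)"
  shows "(\<integral>\<^sup>+\<xi>. (SUP g\<in>eval_class T \<Phi>. ennreal \<bar>\<Sum>i=1..n. \<xi> i * g (x i)\<bar>) \<partial>rademacher {1..n}) \<le>
    ennreal ((A3 + 2 * max A1 A2 * sqrt L) * sqrt (\<Sum>i=1..n. (path_sup_norm T (x i))\<^sup>2 + 1)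
      + A1 * (\<Sum>i=1..n. path_modulus T (x i) (T / N)))"
proof -
  note adm' = admissible_test_classD[OF adm]
  let ?p = "rademacher {1..n}"
  define m where "m = max A1 A2"
  have m: "m \<ge> 0" "A1 \<le> m" "A2 \<le> m" using adm'(2) by (auto simp: m_def)
  define \<rho> where "\<rho> i = path_sup_norm T (x i)" for i
  have \<rho>: "\<rho> i \<ge> 0" if "i \<in> {1..n}" for i using path_sup_norm_nonneg[OF x[OF that]] T by (simp add: \<rho>_def)
  define S where "S = (\<Sum>i=1..n. (\<rho> i)\<^sup>2 + 1)"
  define D where "D = (\<Sum>i=1..n. path_modulus T (x i) (T / N))"
  have D: "D \<ge> 0" unfolding D_def using x T by (intro sum_nonneg path_modulus_nonneg) auto
  have S0: "S \<ge> 0" unfolding S_def by (intro sum_nonneg) auto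
  define \<tau> where "\<tau> j = real j * T / real N" for j :: nat
  have \<tau>: "\<tau> j \<in> {0..T}" if "j \<in> {1..N}" for j
    using that T by (auto simp: \<tau>_def field_simps)
  have f_bd: "\<bar>f (x i t)\<bar> \<le> m * (1 + \<rho> i)" if "f \<in> \<Phi>" "i \<in> {1..n}" "t \<in> {0..T}" for f i t
  proof -
    have "\<bar>f (x i t)\<bar> \<le> A2 + A1 * norm (x i t)" by (rule adm'(6)[OF that(1)])
    also have "\<dots> \<le> m + m * \<rho> i"
      using m adm'(2) norm_le_path_sup_norm[OF x[OF that(2)] that(3)]
      by (intro add_mono mult_mono) (auto simp: \<rho>_def)
    finally show ?thesis by (simp add: algebra_simps)
  qed
  define Z where "Z j \<xi> = (SUP f\<in>\<Phi>. \<bar>\<Sum>i=1..n. \<xi> i * f (x i (\<tau> j))\<bar>)" for j :: nat and \<xi> :: "nat \<Rightarrow> real"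
  have bdd: "bdd_above ((\<lambda>f. \<bar>\<Sum>i=1..n. \<xi> i * f (x i (\<tau> j))\<bar>) ` \<Phi>)" if "j \<in> {1..N}" for j and \<xi> :: "nat \<Rightarrow> real"
  proof (rule bdd_aboveI2)
    fix f assume f: "f \<in> \<Phi>"
    show "\<bar>\<Sum>i=1..n. \<xi> i * f (x i (\<tau> j))\<bar> \<le> (\<Sum>i=1..n. \<bar>\<xi> i\<bar> * (m * (1 + \<rho> i)))"
      by (rule order_trans[OF sum_abs sum_mono]) (use f_bd[OF f _ \<tau>[OF that]] in \<open>auto simp: abs_mult intro!: mult_left_mono\<close>)
  qed
  \<comment> \<open>Flipping sign i changes \<open>Z j\<close> by at most twice the bound m * (1 +
    \<rho> i) on the test functions. As (1 + \<rho> i)^2 \<le> 2 * ((\<rho> i)^2 + 1), the squared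
    bounds sum to at most 2 * m^2 * S; this is the origin of the coefficient 2 * max A1 A2 * sqrt
    L.\<close>
  have maximal: "measure_pmf.expectation ?p (\<lambda>\<xi>. MAX j\<in>{1..N}. Z j \<xi>) \<le> A3 * sqrt S + sqrt (2 * L * (2 * m\<^sup>2 * S))"
  proof (rule rademacher_maximal_inequality)
    show "finite {1..n}" "finite {1..N}" "{1..N} \<noteq> {}" "ln (card {1..N}) \<le> L" using N by auto
    show "\<bar>Z j (\<xi>(i := 1)) - Z j (\<xi>(i := - 1))\<bar> \<le> 2 * (m * (1 + \<rho> i))"
      if j: "j \<in> {1..N}" and i: "i \<in> {1..n}" for j i \<xi>
      unfolding Z_def
    proof (rule abs_cSUP_diff_le[OF adm'(1) bdd[OF j] bdd[OF j]])
      fix f assume f: "f \<in> \<Phi>"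
      have split: "(\<Sum>k=1..n. (\<xi>(i := c)) k * f (x k (\<tau> j))) =
         c * f (x i (\<tau> j)) + (\<Sum>k\<in>{1..n} - {i}. \<xi> k * f (x k (\<tau> j)))" for c
        using i by (subst sum.remove[of _ i]) (auto intro!: sum.cong)
      have "\<bar>\<bar>\<Sum>k=1..n. (\<xi>(i := 1)) k * f (x k (\<tau> j))\<bar> - \<bar>\<Sum>k=1..n. (\<xi>(i := - 1)) k * f (x k (\<tau> j))\<bar>\<bar>
        \<le> \<bar>(\<Sum>k=1..n. (\<xi>(i := 1)) k * f (x k (\<tau> j))) - (\<Sum>k=1..n. (\<xi>(i := - 1)) k * f (x k (\<tau> j)))\<bar>"
        by (rule abs_triangle_ineq3)
      also have "\<dots> = \<bar>2 * f (x i (\<tau> j))\<bar>" unfolding split by simp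
      also have "\<dots> \<le> 2 * (m * (1 + \<rho> i))" using f_bd[OF f i \<tau>[OF j]] by simp
      finally show "\<bar>\<bar>\<Sum>k=1..n. (\<xi>(i := 1)) k * f (x k (\<tau> j))\<bar> - \<bar>\<Sum>k=1..n. (\<xi>(i := - 1)) k * f (x k (\<tau> j))\<bar>\<bar>
        \<le> 2 * (m * (1 + \<rho> i))" .
    qed
    show "measure_pmf.expectation ?p (Z j) \<le> A3 * sqrt S" if j: "j \<in> {1..N}" for j
    proof -
      have "measure_pmf.expectation ?p (Z j) \<le> A3 * sqrt (\<Sum>i=1..n. (norm (x i (\<tau> j)))\<^sup>2 + 1)"
        unfolding Z_def[abs_def] by (rule adm'(7)[OF n])
      also have "\<dots> \<le> A3 * sqrt S"
        unfolding S_def using adm'(4) norm_le_path_sup_norm[OF x \<tau>[OF j]]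
        by (intro mult_left_mono real_sqrt_le_mono sum_mono add_right_mono power_mono) (auto simp: \<rho>_def)
      finally show ?thesis .
    qed
    have "(\<Sum>i=1..n. (m * (1 + \<rho> i))\<^sup>2) \<le> (\<Sum>i=1..n. 2 * m\<^sup>2 * ((\<rho> i)\<^sup>2 + 1))"
    proof (rule sum_mono)
      fix i
      have "(1 + \<rho> i)\<^sup>2 \<le> 2 * ((\<rho> i)\<^sup>2 + 1)"
        using zero_le_power2[of "1 - \<rho> i"] by (simp add: power2_sum power2_diff)
      then have "m\<^sup>2 * (1 + \<rho> i)\<^sup>2 \<le> m\<^sup>2 * (2 * ((\<rho> i)\<^sup>2 + 1))" by (rule mult_left_mono) simp
      then show "(m * (1 + \<rho> i))\<^sup>2 \<le> 2 * m\<^sup>2 * ((\<rho> i)\<^sup>2 + 1)"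
        unfolding power_mult_distrib by (simp only: mult_ac)
    qed
    then show "(\<Sum>i\<in>{1..n}. (m * (1 + \<rho> i))\<^sup>2) \<le> 2 * m\<^sup>2 * S" by (simp add: S_def sum_distrib_left)
  qed
  have int: "integrable ?p h" for h :: "_ \<Rightarrow> real"
    by (intro integrable_measure_pmf_finite finite_set_rademacher) simp
  have Z0: "Z j \<xi> \<ge> 0" if "j \<in> {1..N}" for j \<xi>
  proof -
    obtain f where f: "f \<in> \<Phi>" using adm'(1) by blast
    show ?thesis unfolding Z_def by (rule cSUP_upper2[OF bdd[OF that] f]) simp
  qed
  have max0: "(MAX j\<in>{1..N}. Z j \<xi>) \<ge> 0" for \<xi>
    using Z0[of 1 \<xi>] N by (intro order_trans[OF _ Max_ge]) auto
  have "(\<integral>\<^sup>+\<xi>. (SUP g\<in>eval_class T \<Phi>. ennreal \<bar>\<Sum>i=1..n. \<xi> i * g (x i)\<bar>) \<partial>?p) \<le>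
      (\<integral>\<^sup>+\<xi>. ennreal ((MAX j\<in>{1..N}. Z j \<xi>) + A1 * D) \<partial>?p)"
  \<comment> \<open>On the support each sign has modulus 1, so moving t to a grid time costs at most
    A1 times the sum of the moduli of continuity.\<close>
  proof (intro nn_integral_mono_AE AE_pmfI SUP_least)
    fix \<xi> g assume \<xi>: "\<xi> \<in> set_pmf ?p" and "g \<in> eval_class T \<Phi>"
    then obtain t f where t: "t \<in> {0..T}" and f: "f \<in> \<Phi>" and g: "g = (\<lambda>y. f (y t))"
      by (auto simp: eval_class_def)
    obtain j where j: "j \<in> {1..N}" "\<bar>t - \<tau> j\<bar> \<le> T / N"
      using ex_grid_point[OF T N(1) t] unfolding \<tau>_def by blast
    have "\<bar>(\<Sum>i=1..n. \<xi> i * f (x i t)) - (\<Sum>i=1..n. \<xi> i * f (x i (\<tau> j)))\<bar> =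
        \<bar>\<Sum>i=1..n. \<xi> i * (f (x i t) - f (x i (\<tau> j)))\<bar>"
      by (simp add: sum_subtractf right_diff_distrib)
    also have "\<dots> \<le> (\<Sum>i=1..n. A1 * path_modulus T (x i) (T / N))"
    proof (rule order_trans[OF sum_abs sum_mono])
      fix i assume i: "i \<in> {1..n}"
      have "\<bar>\<xi> i * (f (x i t) - f (x i (\<tau> j)))\<bar> = \<bar>f (x i t) - f (x i (\<tau> j))\<bar>"
        using abs_rademacher[OF _ \<xi> i] by (simp add: abs_mult)
      also have "\<dots> \<le> A1 * norm (x i t - x i (\<tau> j))" by (rule adm'(5)[OF f])
      also have "\<dots> \<le> A1 * path_modulus T (x i) (T / N)"
        by (intro mult_left_mono norm_diff_le_path_modulus x i t \<tau> j adm'(2))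
      finally show "\<bar>\<xi> i * (f (x i t) - f (x i (\<tau> j)))\<bar> \<le> A1 * path_modulus T (x i) (T / N)" .
    qed
    also have "\<dots> = A1 * D" by (simp add: D_def sum_distrib_left)
    finally have 1: "\<bar>(\<Sum>i=1..n. \<xi> i * f (x i t)) - (\<Sum>i=1..n. \<xi> i * f (x i (\<tau> j)))\<bar> \<le> A1 * D" .
    have "\<bar>\<Sum>i=1..n. \<xi> i * f (x i (\<tau> j))\<bar> \<le> Z j \<xi>"
      unfolding Z_def by (rule cSUP_upper[OF f bdd[OF j(1)]])
    also have "\<dots> \<le> (MAX j\<in>{1..N}. Z j \<xi>)" using j(1) by (intro Max_ge) auto
    finally have "\<bar>\<Sum>i=1..n. \<xi> i * f (x i t)\<bar> \<le> (MAX j\<in>{1..N}. Z j \<xi>) + A1 * D" using 1 by linarith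
    then show "ennreal \<bar>\<Sum>i=1..n. \<xi> i * g (x i)\<bar> \<le> ennreal ((MAX j\<in>{1..N}. Z j \<xi>) + A1 * D)"
      unfolding g by (rule ennreal_leI)
  qed
  also have "\<dots> = ennreal (measure_pmf.expectation ?p (\<lambda>\<xi>. (MAX j\<in>{1..N}. Z j \<xi>) + A1 * D))"
    by (rule nn_integral_eq_integral[OF int]) (use max0 D adm'(2) in auto)
  also have "\<dots> \<le> ennreal (A3 * sqrt S + sqrt (2 * L * (2 * m\<^sup>2 * S)) + A1 * D)"
    unfolding Bochner_Integration.integral_add[OF int int]
    using maximal by (intro ennreal_leI) simp
  also have "sqrt (2 * L * (2 * m\<^sup>2 * S)) = 2 * m * sqrt L * sqrt S"
  proof -
    have "2 * L * (2 * m\<^sup>2 * S) = (2 * m)\<^sup>2 * (L * S)" by (simp add: power2_eq_square)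
    then show ?thesis using m by (simp add: real_sqrt_mult)
  qed
  finally show ?thesis unfolding S_def D_def m_def \<rho>_def by (simp add: algebra_simps)
qed

text \<open>With r = n^(1/(2 \<alpha>)) the discretisation error (T/r)^\<alpha> is exactly
  T^\<alpha> / sqrt n. Since r \<ge> 1, rounding up gives N \<le> 2 * r. Hence ln N \<le> ln (2 * r)
  and ln (2 * N) \<le> ln (4 * r), which are the two logarithms of \<open>rate\<close>.\<close>

lemma grid_size:
  fixes n :: nat and \<alpha> :: real
  assumes n: "n \<ge> 1" and \<alpha>: "\<alpha> > 0"
  defines "N \<equiv> nat \<lceil>real n powr (1 / (2 * \<alpha>))\<rceil>"
  shows "N \<ge> 1" "ln (real N) \<le> ln (2 powr (2 * \<alpha>) * real n) / (2 * \<alpha>)"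
    and "T > 0 \<Longrightarrow> (T / real N) powr \<alpha> \<le> T powr \<alpha> / sqrt (real n)"
    and "ln (2 * real N) \<le> ln (2 powr (4 * \<alpha>) * real n) / (2 * \<alpha>)"
proof -
  define r where "r = real n powr (1 / (2 * \<alpha>))"
  have r: "r \<ge> 1" using n \<alpha> by (auto simp: r_def intro!: ge_one_powr_ge_zero)
  have N: "real N = of_int \<lceil>r\<rceil>" using r by (simp add: N_def r_def)
  have N1: "r \<le> real N" "real N < r + 1" unfolding N by linarith+
  show "N \<ge> 1" using N1 r by linarith
  have lnr: "ln r = ln (real n) / (2 * \<alpha>)" using n by (simp add: r_def ln_powr)
  have ln2: "ln (2 * r) = ln (2 powr (2 * \<alpha>) * real n) / (2 * \<alpha>)"
    using r n \<alpha> by (simp add: ln_mult lnr ln_powr field_simps)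
  have ln4: "ln (4 * r) = ln (2 powr (4 * \<alpha>) * real n) / (2 * \<alpha>)"
  proof -
    have "ln (4::real) = 2 * ln 2" using ln_realpow[of 2 2] by simp
    then show ?thesis using r n \<alpha> by (simp add: ln_mult lnr ln_powr field_simps)
  qed
  have "ln (real N) \<le> ln (2 * r)" using N1 r by (intro ln_mono) auto
  then show "ln (real N) \<le> ln (2 powr (2 * \<alpha>) * real n) / (2 * \<alpha>)" unfolding ln2 .
  have "ln (2 * real N) \<le> ln (4 * r)" using N1 r by (intro ln_mono) auto
  then show "ln (2 * real N) \<le> ln (2 powr (4 * \<alpha>) * real n) / (2 * \<alpha>)" unfolding ln4 .
  show "(T / real N) powr \<alpha> \<le> T powr \<alpha> / sqrt (real n)" if "T > 0"
  proof -
    have "sqrt (real n) = r powr \<alpha>" using \<alpha> by (simp add: r_def powr_powr powr_half_sqrt)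
    moreover have "(T / real N) powr \<alpha> = T powr \<alpha> / real N powr \<alpha>" using that by (simp add: powr_divide)
    moreover have "r powr \<alpha> \<le> real N powr \<alpha>" using r N1 \<alpha> by (intro powr_mono2) auto
    ultimately show ?thesis using r N1 by (auto intro!: divide_left_mono mult_pos_pos)
  qed
qed

section \<open>The rate\<close>

lemma rate_bigo:
  assumes \<alpha>: "\<alpha> > 0" and \<beta>: "\<beta> > 0"
  shows "rate A1 A2 A3 T Q \<alpha> \<beta> M \<in> O(\<lambda>n. real n powr (- 1 / 2) * ln (real n) powr max \<beta> (1 / 2))"
proof -
  let ?g = "\<lambda>n::nat. real n powr (- 1 / 2) * ln (real n) powr max \<beta> (1 / 2)"
  \<comment> \<open>As ln 2 \<le> 1, ln (2^c * n) = c * ln 2 + ln n is at most (4 * \<alpha> + 1) *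
    ln n once ln n \<ge> 1 and c \<le> 4 * \<alpha>.\<close>
  define K where "K = 4 * \<alpha> + 1"
  have ev: "\<forall>\<^sub>F n::nat in sequentially. n \<ge> 1 \<and> ln (real n) \<ge> 1"
    by (intro eventually_conj eventually_ge_at_top) real_asymp
  have ln_le: "0 \<le> ln (2 powr c * real n)" "ln (2 powr c * real n) \<le> K * ln (real n)"
    if "n \<ge> 1" "ln (real n) \<ge> 1" "0 \<le> c" "c \<le> 4 * \<alpha>" for n :: nat and c
  proof -
    have eq: "ln (2 powr c * real n) = c * ln 2 + ln (real n)" using that by (simp add: ln_mult ln_powr)
    show "0 \<le> ln (2 powr c * real n)" unfolding eq using that by simp
    have "c * ln 2 \<le> 4 * \<alpha> * 1" using that ln_le_minus_one[of 2] by (intro mult_mono) auto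
    also have "\<dots> \<le> 4 * \<alpha> * ln (real n)" using that \<alpha> by (intro mult_left_mono) auto
    finally show "ln (2 powr c * real n) \<le> K * ln (real n)" unfolding eq K_def by (simp add: algebra_simps)
  qed
  have pow: "ln (real n) powr p \<le> ln (real n) powr max \<beta> (1 / 2)" if "ln (real n) \<ge> 1" "p \<le> max \<beta> (1/2)" for n :: nat and p
    using that by (intro powr_mono) auto
  have inv: "1 / sqrt (real n) = real n powr (- 1 / 2)" if "n \<ge> 1" for n :: nat
    using that by (simp add: powr_minus_divide powr_half_sqrt)
  have t1: "(\<lambda>n. 1 / sqrt (real n)) \<in> O(?g)"
  proof (rule bigoI[of _ 1], use ev in eventually_elim)
    fix n :: nat assume n: "n \<ge> 1 \<and> ln (real n) \<ge> 1"
    have "1 \<le> ln (real n) powr max \<beta> (1 / 2)" using n by (intro ge_one_powr_ge_zero) auto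
    then have "real n powr (- 1 / 2) * 1 \<le> ?g n" by (intro mult_left_mono) auto
    then show "norm (1 / sqrt (real n)) \<le> 1 * norm (?g n)" using inv[of n] n by simp
  qed
  have t2: "(\<lambda>n. sqrt (ln (2 powr (2 * \<alpha>) * real n) / (2 * \<alpha> * real n))) \<in> O(?g)"
  proof (rule bigoI[of _ "sqrt (K / (2 * \<alpha>))"], use ev in eventually_elim)
    fix n :: nat assume n: "n \<ge> 1 \<and> ln (real n) \<ge> 1"
    have "sqrt (ln (2 powr (2 * \<alpha>) * real n) / (2 * \<alpha> * real n)) \<le> sqrt (K * ln (real n) / (2 * \<alpha> * real n))"
      using ln_le[of n "2 * \<alpha>"] n \<alpha> by (intro real_sqrt_le_mono divide_right_mono) auto
    also have "\<dots> = sqrt (K / (2 * \<alpha>)) * (real n powr (- 1 / 2) * ln (real n) powr (1 / 2))"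
      using n unfolding inv[OF conjunct1[OF n], symmetric]
      by (simp add: real_sqrt_mult real_sqrt_divide powr_half_sqrt)
    also have "\<dots> \<le> sqrt (K / (2 * \<alpha>)) * ?g n"
      using n \<alpha> by (intro mult_left_mono pow) (auto simp: K_def)
    finally show "norm (sqrt (ln (2 powr (2 * \<alpha>) * real n) / (2 * \<alpha> * real n))) \<le> sqrt (K / (2 * \<alpha>)) * norm (?g n)"
      using ln_le(1)[of n "2 * \<alpha>"] n \<alpha> by simp
  qed
  have t3: "(\<lambda>n. 1 / sqrt (real n) * (ln (2 powr (4 * \<alpha>) * real n) / (2 * \<alpha>)) powr \<beta>) \<in> O(?g)"
  proof (rule bigoI[of _ "(K / (2 * \<alpha>)) powr \<beta>"], use ev in eventually_elim)
    fix n :: nat assume n: "n \<ge> 1 \<and> ln (real n) \<ge> 1"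
    have "(ln (2 powr (4 * \<alpha>) * real n) / (2 * \<alpha>)) powr \<beta> \<le> (K / (2 * \<alpha>) * ln (real n)) powr \<beta>"
      using ln_le[of n "4 * \<alpha>"] n \<alpha> \<beta> by (intro powr_mono2) (auto intro!: divide_right_mono)
    also have "\<dots> = (K / (2 * \<alpha>)) powr \<beta> * ln (real n) powr \<beta>"
      by (rule powr_mult)
    also have "\<dots> \<le> (K / (2 * \<alpha>)) powr \<beta> * ln (real n) powr max \<beta> (1 / 2)"
      using n by (intro mult_left_mono pow) auto
    finally have "real n powr (- 1 / 2) * (ln (2 powr (4 * \<alpha>) * real n) / (2 * \<alpha>)) powr \<beta> \<le>
       real n powr (- 1 / 2) * ((K / (2 * \<alpha>)) powr \<beta> * ln (real n) powr max \<beta> (1 / 2))"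
      by (intro mult_left_mono) auto
    then show "norm (1 / sqrt (real n) * (ln (2 powr (4 * \<alpha>) * real n) / (2 * \<alpha>)) powr \<beta>)
       \<le> (K / (2 * \<alpha>)) powr \<beta> * norm (?g n)"
      using n by (simp add: inv mult_ac)
  qed
  have eq: "rate A1 A2 A3 T Q \<alpha> \<beta> M = (\<lambda>n.
      (2 * (A3 + 8 * max A1 A2) * sqrt (M + 1)) * (1 / sqrt (real n))
      + (16 * max A1 A2 * sqrt (M + 1)) * sqrt (ln (2 powr (2 * \<alpha>) * real n) / (2 * \<alpha> * real n))
      + (2 * A1 * Q * T powr \<alpha>) * (1 / sqrt (real n) * (ln (2 powr (4 * \<alpha>) * real n) / (2 * \<alpha>)) powr \<beta>))"
    by (rule ext) (simp add: rate_def algebra_simps add_divide_distrib)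
  show ?thesis
    unfolding eq by (intro sum_in_bigo) (simp_all only: cmult_in_bigo_iff t1 t2 t3 simp_thms)
qed

section \<open>Bound on the mean\<close>

lemma lipschitz_borel_measurable:
  fixes f :: "'a::euclidean_space \<Rightarrow> real"
  assumes "\<And>x y. \<bar>f x - f y\<bar> \<le> L * norm (x - y)" "L \<ge> 0"
  shows "f \<in> borel_measurable borel"
proof -
  have "L-lipschitz_on UNIV f"
    by (rule lipschitz_onI) (use assms in \<open>auto simp: dist_norm\<close>)
  then show ?thesis
    by (intro borel_measurable_continuous_onI lipschitz_on_continuous_on)
qed

lemma metric_prob_space_path:
  fixes \<mu> :: "(real \<Rightarrow> 'a::euclidean_space) measure"
  assumes "T > 0" "prob_space \<mu>" "sets \<mu> = sets (metric_borel (path_space T))"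
    "integrable \<mu> (\<lambda>x. (path_sup_norm T x)\<^sup>2)"
  shows "metric_prob_space \<mu> (path_space T) (zero_path T)"
    and "(\<integral>x. (mdist (path_space T) x (zero_path T))\<^sup>2 \<partial>\<mu>) = (\<integral>x. (path_sup_norm T x)\<^sup>2 \<partial>\<mu>)"
proof -
  have sp: "space \<mu> = mspace (path_space T)"
    using sets_eq_imp_space_eq[OF assms(3)] by simp
  have eq: "(mdist (path_space T) x (zero_path T))\<^sup>2 = (path_sup_norm T x)\<^sup>2" if "x \<in> space \<mu>" for x
    using that assms(1) by (simp add: sp mdist_zero_path)
  interpret prob_space \<mu> by fact
  show "metric_prob_space \<mu> (path_space T) (zero_path T)"
  proof
    show "integrable \<mu> (\<lambda>x. (mdist (path_space T) x (zero_path T))\<^sup>2)"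
      using assms(4) by (subst Bochner_Integration.integrable_cong[OF refl eq])
  qed (use assms(3) in auto)
  show "(\<integral>x. (mdist (path_space T) x (zero_path T))\<^sup>2 \<partial>\<mu>) = (\<integral>x. (path_sup_norm T x)\<^sup>2 \<partial>\<mu>)"
    by (rule Bochner_Integration.integral_cong[OF refl eq])
qed

lemma lipschitz_fun_eval_class:
  fixes \<Phi> :: "('a::euclidean_space \<Rightarrow> real) set" and \<mu> :: "(real \<Rightarrow> 'a) measure"
  assumes "metric_prob_space \<mu> (path_space T) z"
    and lip: "\<And>f x y. f \<in> \<Phi> \<Longrightarrow> \<bar>f x - f y\<bar> \<le> L * norm (x - y)" and L: "L \<ge> 0"
    and g: "g \<in> eval_class T \<Phi>"
  shows "metric_prob_space.lipschitz_fun (path_space T) L g"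
proof -
  obtain t f where t: "t \<in> {0..T}" and f: "f \<in> \<Phi>" and g: "g = (\<lambda>y. f (y t))"
    using g by (auto simp: eval_class_def)
  show ?thesis
    unfolding metric_prob_space.lipschitz_fun_def[OF assms(1)] g
    using order_trans[OF lip[OF f] mult_left_mono[OF norm_diff_le_mdist_path[OF _ _ t] L]] by blast
qed

lemma expectation_sup_le_rate:
  fixes \<Phi> :: "('a::euclidean_space \<Rightarrow> real) set" and n :: nat
  assumes adm: "admissible_test_class \<Phi> A1 A2 A3" and T: "T > 0"
    and prob: "prob_space \<mu>" and sets_\<mu>: "sets \<mu> = sets (metric_borel (path_space T))"
    and moment: "integrable \<mu> (\<lambda>x. (path_sup_norm T x)\<^sup>2)"
    and pos: "Q > 0" "\<alpha> > 0" "\<beta> > 0"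
    and modulus: "\<And>h. 0 < h \<Longrightarrow> h \<le> T \<Longrightarrow>
           (\<integral>x. path_modulus T x h \<partial>\<mu>) \<le> Q * h powr \<alpha> * ln (2 * T / h) powr \<beta>"
    and n: "n \<ge> 1"
  shows "metric_prob_space.sum_lipschitz \<mu> (path_space T) {1..n} (A1 / n)
      (metric_prob_space.empirical_sup \<mu> (eval_class T \<Phi>) {1..n})" (is ?lip)
    and "(\<integral>x. metric_prob_space.empirical_sup \<mu> (eval_class T \<Phi>) {1..n} x \<partial>PiM {1..n} (\<lambda>_. \<mu>))
      \<le> rate A1 A2 A3 T Q \<alpha> \<beta> (\<integral>x. (path_sup_norm T x)\<^sup>2 \<partial>\<mu>) n" (is ?bound)
proof -
  \<comment> \<open>Keeps the simplifier from rewriting the index set {1..n} into {Suc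
    0..n}.\<close>
  note One_nat_def [simp del]
  note adm' = admissible_test_classD[OF adm]
  have mps: "metric_prob_space \<mu> (path_space T) (zero_path T)"
    by (rule metric_prob_space_path(1)) fact+
  then interpret metric_prob_space \<mu> "path_space T" "zero_path T" .
  let ?P = "PiM {1..n} (\<lambda>_. \<mu>)" and ?C = "eval_class T \<Phi>"
  have lip: "lipschitz_fun A1 g" if "g \<in> ?C" for g
    by (rule lipschitz_fun_eval_class[OF mps adm'(5) adm'(2) that])
  have I: "finite {1..n}" "{1..n} \<noteq> {}" using n by auto
  have ne: "?C \<noteq> {}" using adm'(1) T by (auto simp: eval_class_def)
  obtain C where C: "C \<subseteq> ?C" "countable C"
    "\<And>g. g \<in> ?C \<Longrightarrow> \<exists>s. (\<forall>k::nat. s k \<in> C) \<and> (\<forall>y\<in>mspace (path_space T). (\<lambda>k. s k y) \<longlonglongrightarrow> g y)"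
    using eval_class_separable[OF adm'(5), where T = T] by blast
  show ?lip
    using sum_lipschitz_empirical_sup[OF lip I C(1,2) ne C(3)] by simp
  define N where "N = nat \<lceil>real n powr (1 / (2 * \<alpha>))\<rceil>"
  define L where "L = ln (2 powr (2 * \<alpha>) * real n) / (2 * \<alpha>)"
  define M where "M = (\<integral>x. (path_sup_norm T x)\<^sup>2 \<partial>\<mu>)"
  define d where "d = (\<integral>x. path_modulus T x (T / N) \<partial>\<mu>)"
  define m where "m = max A1 A2"
  note N = grid_size[OF n pos(2), folded N_def, folded L_def]
  have m: "m \<ge> 0" using adm'(2) by (simp add: m_def)
  have "0 \<le> ln (real N)" using N(1) by simp
  then have L: "L \<ge> 0" using N(2) by linarith
  have M: "M \<ge> 0" unfolding M_def by simp
  have h: "0 < T / N" "T / N \<le> T" using T N(1) by (auto simp: field_simps)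
  \<comment> \<open>The Bochner integral of a non-integrable function is 0, so the hypothesis on the
    modulus says something only once integrability is known; it follows from comparison with twice
    the supremum norm.\<close>
  have d_int: "integrable \<mu> (\<lambda>x. path_modulus T x (T / N))"
  proof (rule Bochner_Integration.integrable_bound)
    show "integrable \<mu> (\<lambda>x. 2 * mdist (path_space T) x (zero_path T))" using integrable_dist_base by simp
    show "(\<lambda>x. path_modulus T x (T / N)) \<in> borel_measurable \<mu>"
      using measurable_path_modulus[of T "T / N"] T h by (simp cong: measurable_cong_sets add: sets_\<mu>)
    show "AE x in \<mu>. norm (path_modulus T x (T / N)) \<le> norm (2 * mdist (path_space T) x (zero_path T))"
    proof (rule AE_I2)
      fix x assume "x \<in> space \<mu>"
      then have x: "x \<in> mspace (path_space T)" by simp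
      then show "norm (path_modulus T x (T / N)) \<le> norm (2 * mdist (path_space T) x (zero_path T))"
        using path_modulus_le_sup_norm[OF x, of "T / N"] path_modulus_nonneg[OF x, of "T / N"] T h
        by (simp add: mdist_zero_path)
    qed
  qed
  define S where "S x = (\<Sum>i=1..n. (path_sup_norm T (x i))\<^sup>2 + 1)" for x :: "nat \<Rightarrow> real \<Rightarrow> 'a"
  define D where "D x = (\<Sum>i=1..n. path_modulus T (x i) (T / N))" for x :: "nat \<Rightarrow> real \<Rightarrow> 'a"
  define B where "B x = (A3 + 2 * m * sqrt L) * sqrt (S x) + A1 * D x" for x
  interpret P: prob_space ?P by (rule prob_space_PiM_power)
  have S0: "S x \<ge> 0" for x unfolding S_def by (intro sum_nonneg) auto
  have moment1: "integrable \<mu> (\<lambda>y. (path_sup_norm T y)\<^sup>2 + 1)" using moment by simp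
  note comp_S = integrable_PiM_component[OF prob_space_axioms _ moment1, of _ "{1..n}"]
  note comp_D = integrable_PiM_component[OF prob_space_axioms _ d_int, of _ "{1..n}"]
  have S_int: "integrable ?P S" "(\<integral>x. S x \<partial>?P) = n * (M + 1)"
    unfolding S_def using comp_S moment by (auto simp: M_def Bochner_Integration.integral_sum)
  have D_int: "integrable ?P D" "(\<integral>x. D x \<partial>?P) = n * d"
    unfolding D_def using comp_D by (auto simp: d_def Bochner_Integration.integral_sum)
  \<comment> \<open>c is the square root of the mean of S. The tangent bound sqrt S \<le> (S / c +
    c) / 2 yields both the integrability of sqrt S and Jensen's bound c for its mean.\<close>
  define c where "c = sqrt (n * (M + 1))"
  have c: "c > 0" using n M by (simp add: c_def)
  have sqrt_le: "sqrt (S x) \<le> (S x / c + c) / 2" for x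
  proof -
    have "0 \<le> (sqrt (S x) - c)\<^sup>2" by simp
    then have "2 * c * sqrt (S x) \<le> S x + c\<^sup>2" using S0[of x] by (simp add: power2_diff mult_ac)
    then show ?thesis using c by (simp add: field_simps power2_eq_square)
  qed
  have sqrt_int: "integrable ?P (\<lambda>x. sqrt (S x))"
    by (rule Bochner_Integration.integrable_bound[where f = "\<lambda>x. (S x / c + c) / 2"])
      (use S_int sqrt_le S0 c in \<open>auto simp: abs_of_nonneg\<close>)
  have "(\<integral>x. sqrt (S x) \<partial>?P) \<le> (\<integral>x. (S x / c + c) / 2 \<partial>?P)"
    by (rule integral_mono) (use sqrt_int S_int sqrt_le in auto)
  also have "\<dots> = (n * (M + 1) / c + c) / 2" using S_int by (simp add: P.prob_space)
  also have "n * (M + 1) = c * c" using M by (simp add: c_def)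
  also have "(c * c / c + c) / 2 = c" using c by simp
  finally have sqrt_bound: "(\<integral>x. sqrt (S x) \<partial>?P) \<le> c" .
  have B_int: "integrable ?P B" unfolding B_def using sqrt_int D_int by simp
  have B0: "B x \<ge> 0" if "x \<in> space ?P" for x
  proof -
    have "D x \<ge> 0" unfolding D_def using that T h
      by (intro sum_nonneg path_modulus_nonneg) (auto simp: space_PiM)
    then show ?thesis unfolding B_def using adm'(2,4) m L S0[of x] by simp
  qed
  have "real (card {1..n}) * (\<integral>x. empirical_sup ?C {1..n} x \<partial>?P) \<le> 2 * (\<integral>x. B x \<partial>?P)"
  proof (rule expectation_empirical_sup_le[OF lip I C(1,2) ne C(3) B_int B0])
    fix x assume "x \<in> space ?P"
    then have x: "x i \<in> mspace (path_space T)" if "i \<in> {1..n}" for i using that by (auto simp: space_PiM)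
    show "(\<integral>\<^sup>+\<xi>. (SUP g\<in>?C. ennreal \<bar>\<Sum>i=1..n. \<xi> i * g (x i)\<bar>) \<partial>rademacher {1..n}) \<le> ennreal (B x)"
      unfolding B_def S_def D_def m_def by (rule rademacher_eval_class_bound[OF adm T N(1,2) n x])
  qed
  also have "(\<integral>x. B x \<partial>?P) = (A3 + 2 * m * sqrt L) * (\<integral>x. sqrt (S x) \<partial>?P) + A1 * (n * d)"
    unfolding B_def using sqrt_int D_int by simp
  also have "\<dots> \<le> (A3 + 2 * m * sqrt L) * c + A1 * (n * d)"
    using adm'(4) m L by (intro add_right_mono mult_left_mono sqrt_bound) simp
  finally have "n * (\<integral>x. empirical_sup ?C {1..n} x \<partial>?P) \<le> 2 * ((A3 + 2 * m * sqrt L) * c + A1 * (n * d))"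
    by simp
  then have "(\<integral>x. empirical_sup ?C {1..n} x \<partial>?P) \<le> 2 * ((A3 + 2 * m * sqrt L) * c + A1 * (n * d)) / n"
    using n by (simp add: field_simps)
  also have "\<dots> = 2 * (A3 / sqrt n + 2 * m * (sqrt L / sqrt n)) * sqrt (M + 1) + 2 * A1 * d"
  proof -
    have "c = sqrt n * sqrt (M + 1)" by (simp add: c_def real_sqrt_mult)
    moreover have "real n = sqrt n * sqrt n" by simp
    ultimately have "c / n = sqrt (M + 1) / sqrt n" using n by (metis (no_types, lifting) mult_divide_mult_cancel_left_if real_sqrt_eq_zero_cancel_iff of_nat_eq_0_iff not_one_le_zero)
    moreover have "2 * ((A3 + 2 * m * sqrt L) * c + A1 * (n * d)) / n = 2 * (A3 + 2 * m * sqrt L) * (c / n) + 2 * A1 * d"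
      using n by (simp add: field_simps)
    ultimately show ?thesis by (simp add: field_simps add_divide_distrib)
  qed
  \<comment> \<open>The estimate reached so far has A3 and 2 * m where \<open>rate\<close> has A3 +
    8 * m and 8 * m; these two terms are merely enlarged, and the modulus d is bounded at h = T /
    N.\<close>
  also have "\<dots> \<le> 2 * ((A3 + 8 * m) / sqrt n + 8 * m * (sqrt L / sqrt n)) * sqrt (M + 1)
      + 2 * A1 * (Q * (T powr \<alpha> / sqrt n) * (ln (2 powr (4 * \<alpha>) * real n) / (2 * \<alpha>)) powr \<beta>)"
  proof (intro add_mono mult_right_mono mult_left_mono)
    show "A3 / sqrt n \<le> (A3 + 8 * m) / sqrt n" using m by (intro divide_right_mono) auto
    have "2 * T / (T / N) = 2 * real N" using T by simp
    then have "d \<le> Q * (T / N) powr \<alpha> * ln (2 * real N) powr \<beta>"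
      using modulus[OF h] by (simp add: d_def)
    also have "\<dots> \<le> Q * (T powr \<alpha> / sqrt n) * (ln (2 powr (4 * \<alpha>) * real n) / (2 * \<alpha>)) powr \<beta>"
      using pos N(1) by (intro mult_mono powr_mono2 N(3)[OF T] N(4) mult_left_mono) auto
    finally show "d \<le> Q * (T powr \<alpha> / sqrt n) * (ln (2 powr (4 * \<alpha>) * real n) / (2 * \<alpha>)) powr \<beta>" .
  qed (use m L M adm'(2) in auto)
  also have "\<dots> = rate A1 A2 A3 T Q \<alpha> \<beta> M n"
    unfolding rate_def m_def L_def by (simp add: real_sqrt_divide real_sqrt_mult mult.assoc)
  finally show ?bound unfolding M_def .
qed

section \<open>Supremum of the integral probability metric\<close>

text \<open>The empirical measure is the image under x of the uniform law on the indices, which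
  counts coinciding points with their multiplicity.\<close>

lemma integral_empirical_measure:
  fixes x :: "nat \<Rightarrow> 'a::euclidean_space" and f :: "'a \<Rightarrow> real"
  assumes n: "n \<ge> 1" and f: "f \<in> borel_measurable borel"
  shows "(\<integral>y. f y \<partial>empirical_measure n x) = (\<Sum>i=1..n. f (x i)) / real n"
proof -
  let ?U = "uniform_count_measure {1..n}"
  let ?N = "distr ?U borel x"
  have meas [measurable]: "x \<in> measurable ?U borel"
    by (simp add: measurable_def uniform_count_measure_def space_point_measure sets_point_measure)
  have "(\<Sum>i=1..n. emeasure (return borel (x i)) A) / of_nat n = emeasure ?N A" if A: "A \<in> sets borel" for A
  proof -
    have fin: "finite (x -` A \<inter> {1..n})" by simp
    have "(\<Sum>i=1..n. emeasure (return borel (x i)) A) = (\<Sum>i=1..n. of_bool (i \<in> x -` A))"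
      using A by (intro sum.cong) (auto simp: indicator_def)
    also have "\<dots> = of_nat (card (x -` A \<inter> {1..n}))"
      by (simp add: sum.If_cases of_bool_def Int_commute Int_def vimage_def)
    also have "\<dots> / of_nat n = ennreal (real (card (x -` A \<inter> {1..n})) / real n)"
      using n by (simp add: ennreal_of_nat_eq_real_of_nat divide_ennreal)
    also have "\<dots> = emeasure ?U (x -` A \<inter> {1..n})"
      by (subst emeasure_uniform_count_measure) auto
    also have "\<dots> = emeasure ?N A"
      using A by (subst emeasure_distr[OF meas A]) (simp add: space_uniform_count_measure)
    finally show ?thesis .
  qed
  then have "empirical_measure n x = measure_of (space ?N) (sets ?N) (emeasure ?N)"
    unfolding empirical_measure_def
    by (subst measure_of_eq[where \<mu>' = "emeasure ?N"]) (auto simp: sets.sigma_sets_eq[of borel, simplified])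
  also have "\<dots> = ?N" by (rule measure_of_of_measure)
  finally have "(\<integral>y. f y \<partial>empirical_measure n x) = (\<integral>i. f (x i) \<partial>?U)"
    using integral_distr[OF meas f] by simp
  also have "\<dots> = (\<Sum>i=1..n. f (x i)) / real n"
    using n by (subst integral_uniform_count_measure) auto
  finally show ?thesis .
qed

text \<open>The second-moment claim takes the supremum of squares, whereas Efron-Stein bounds the
  square of a supremum.\<close>

lemma cSUP_power2:
  fixes u :: "'b \<Rightarrow> real"
  assumes S: "S \<noteq> {}" "bdd_above (u ` S)" and nonneg: "\<And>t. t \<in> S \<Longrightarrow> u t \<ge> 0"
  shows "(SUP t\<in>S. (u t)\<^sup>2) = (SUP t\<in>S. u t)\<^sup>2"
proof (rule antisym)
  have le: "(u t)\<^sup>2 \<le> (SUP t\<in>S. u t)\<^sup>2" if "t \<in> S" for t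
    using that by (intro power_mono cSUP_upper S nonneg)
  then show "(SUP t\<in>S. (u t)\<^sup>2) \<le> (SUP t\<in>S. u t)\<^sup>2" by (intro cSUP_least S)
  have bdd: "bdd_above ((\<lambda>t. (u t)\<^sup>2) ` S)" using le by (rule bdd_aboveI2)
  obtain t0 where t0: "t0 \<in> S" using S by blast
  have pos: "0 \<le> (SUP t\<in>S. u t)" using cSUP_upper[OF t0 S(2)] nonneg[OF t0] by linarith
  have "(SUP t\<in>S. u t) \<le> sqrt (SUP t\<in>S. (u t)\<^sup>2)"
  proof (rule cSUP_least[OF S(1)])
    fix t assume t: "t \<in> S"
    have "sqrt ((u t)\<^sup>2) \<le> sqrt (SUP t\<in>S. (u t)\<^sup>2)" by (intro real_sqrt_le_mono cSUP_upper[OF t bdd])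
    then show "u t \<le> sqrt (SUP t\<in>S. (u t)\<^sup>2)" using nonneg[OF t] by simp
  qed
  then have "(SUP t\<in>S. u t)\<^sup>2 \<le> (sqrt (SUP t\<in>S. (u t)\<^sup>2))\<^sup>2" by (intro power_mono pos)
  also have "(SUP t\<in>S. (u t)\<^sup>2) \<ge> 0" by (rule cSUP_upper2[OF bdd t0]) simp
  then have "(sqrt (SUP t\<in>S. (u t)\<^sup>2))\<^sup>2 = (SUP t\<in>S. (u t)\<^sup>2)" by simp
  finally show "(SUP t\<in>S. u t)\<^sup>2 \<le> (SUP t\<in>S. (u t)\<^sup>2)" .
qed

text \<open>Passage from the metric of the statement to the abstract functional. The sample is
  restricted to {1..n} because points of the product space are extensional in the index.\<close>

lemma sup_ipm_eq_empirical_sup: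
  fixes \<Phi> :: "('a::euclidean_space \<Rightarrow> real) set" and x :: "nat \<Rightarrow> real \<Rightarrow> 'a" and n :: nat
  assumes adm: "admissible_test_class \<Phi> A1 A2 A3" and T: "T > 0"
    and \<mu>: "metric_prob_space \<mu> (path_space T) (zero_path T)"
    and n: "n \<ge> 1" and x: "\<And>i. i \<in> {1..n} \<Longrightarrow> x i \<in> mspace (path_space T)"
    and law: "\<And>t f. t \<in> {0..T} \<Longrightarrow> f \<in> \<Phi> \<Longrightarrow> (\<integral>z. f z \<partial>\<nu> t) = (\<integral>y. f (y t) \<partial>\<mu>)"
  defines "D \<equiv> \<lambda>t. ipm \<Phi> (\<nu> t) (empirical_measure n (\<lambda>i. x i t))"
  shows "(SUP t\<in>{0..T}. D t) = metric_prob_space.empirical_sup \<mu> (eval_class T \<Phi>) {1..n} (\<lambda>i\<in>{1..n}. x i)"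
    and "(SUP t\<in>{0..T}. (D t)\<^sup>2) = (metric_prob_space.empirical_sup \<mu> (eval_class T \<Phi>) {1..n} (\<lambda>i\<in>{1..n}. x i))\<^sup>2"
proof -
  note adm' = admissible_test_classD[OF adm]
  interpret metric_prob_space \<mu> "path_space T" "zero_path T" by (rule \<mu>)
  let ?x = "\<lambda>i\<in>{1..n}. x i" and ?C = "eval_class T \<Phi>"
  have lip: "lipschitz_fun A1 g" if g_in: "g \<in> ?C" for g
    by (rule lipschitz_fun_eval_class[OF \<mu> adm'(5) adm'(2) g_in])
  have xP: "?x \<in> space (PiM {1..n} (\<lambda>_. \<mu>))" using x by (auto simp: space_PiM)
  have I: "finite {1..n}" "{1..n} \<noteq> {}" using n by auto
  have D_eq: "D t = (SUP f\<in>\<Phi>. \<bar>empirical_deviation {1..n} ?x (\<lambda>y. f (y t))\<bar>)" if t: "t \<in> {0..T}" for t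
    unfolding D_def ipm_def
  proof (rule SUP_cong[OF refl])
    fix f assume f: "f \<in> \<Phi>"
    have "(\<integral>y. f y \<partial>empirical_measure n (\<lambda>i. x i t)) = (\<Sum>i=1..n. f (x i t)) / real n"
      by (rule integral_empirical_measure[OF n lipschitz_borel_measurable[OF adm'(5)[OF f] adm'(2)]])
    also have "(\<Sum>i=1..n. f (x i t)) = (\<Sum>i=1..n. f (?x i t))" by (rule sum.cong) auto
    finally show "\<bar>(\<integral>z. f z \<partial>\<nu> t) - (\<integral>y. f y \<partial>empirical_measure n (\<lambda>i. x i t))\<bar> =
        \<bar>empirical_deviation {1..n} ?x (\<lambda>y. f (y t))\<bar>"
      by (simp add: law[OF t f] empirical_deviation_def)
  qed
  have C_eq: "?C = (\<Union>t\<in>{0..T}. (\<lambda>f y. f (y t)) ` \<Phi>)"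
    by (auto simp: eval_class_def)
  have bdd: "bdd_above ((\<lambda>g. \<bar>empirical_deviation {1..n} ?x g\<bar>) ` ?C)"
    by (rule bdd_above_empirical_deviation[OF lip I xP])
  have "empirical_sup ?C {1..n} ?x =
      (SUP t\<in>{0..T}. SUP g\<in>(\<lambda>f y. f (y t)) ` \<Phi>. \<bar>empirical_deviation {1..n} ?x g\<bar>)"
    unfolding empirical_sup_def C_eq
    by (rule cSUP_UNION) (use T adm'(1) bdd in \<open>auto simp: C_eq image_UN\<close>)
  also have "\<dots> = (SUP t\<in>{0..T}. D t)"
    by (intro SUP_cong refl) (simp add: D_eq image_image)
  finally show eq: "(SUP t\<in>{0..T}. D t) = empirical_sup ?C {1..n} ?x" ..
  obtain f0 where f0: "f0 \<in> \<Phi>" using adm'(1) by blast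
  have in_C: "(\<lambda>y. f (y t)) \<in> ?C" if "t \<in> {0..T}" "f \<in> \<Phi>" for t f
    using that unfolding C_eq by blast
  have D_le: "D t \<le> empirical_sup ?C {1..n} ?x" if t: "t \<in> {0..T}" for t
    unfolding D_eq[OF t] using empirical_sup_upper[OF lip I xP in_C[OF t]] by (intro cSUP_least[OF adm'(1)])
  have D_nonneg: "D t \<ge> 0" if t: "t \<in> {0..T}" for t
  proof -
    have "bdd_above ((\<lambda>f. \<bar>empirical_deviation {1..n} ?x (\<lambda>y. f (y t))\<bar>) ` \<Phi>)"
      using empirical_sup_upper[OF lip I xP in_C[OF t]] by (rule bdd_aboveI2)
    then show ?thesis unfolding D_eq[OF t] by (rule cSUP_upper2[OF _ f0]) simp
  qed
  have "bdd_above (D ` {0..T})" using D_le by (rule bdd_aboveI2)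
  then have "(SUP t\<in>{0..T}. (D t)\<^sup>2) = (SUP t\<in>{0..T}. D t)\<^sup>2"
    using T D_nonneg by (intro cSUP_power2) auto
  then show "(SUP t\<in>{0..T}. (D t)\<^sup>2) = (empirical_sup ?C {1..n} ?x)\<^sup>2" unfolding eq .
qed

theorem theorem2p11:
  fixes \<Phi> :: "('a::euclidean_space \<Rightarrow> real) set"
    and \<mu> :: "(real \<Rightarrow> 'a) measure"
    and A1 A2 A3 T Q \<alpha> \<beta> :: real
    and \<phi> :: "nat \<Rightarrow> real"
  assumes "admissible_test_class \<Phi> A1 A2 A3"
    and "T > 0"
    and "prob_space \<mu>"
    and "sets \<mu> = sets (metric_borel (path_space T))"
    and "integrable \<mu> (\<lambda>x. (path_sup_norm T x)\<^sup>2)"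
    and "Q > 0" and "\<alpha> > 0" and "\<beta> > 0"
    and "\<And>h. 0 < h \<Longrightarrow> h \<le> T \<Longrightarrow>
           (\<integral>x. path_modulus T x h \<partial>\<mu>) \<le> Q * h powr \<alpha> * ln (2 * T / h) powr \<beta>"
    and "\<phi> = rate A1 A2 A3 T Q \<alpha> \<beta> (\<integral>x. (path_sup_norm T x)\<^sup>2 \<partial>\<mu>)"
  shows
    "\<phi> \<in> O(\<lambda>n. real n powr (- 1 / 2) * ln (real n) powr max \<beta> (1 / 2)) \<and>
     (\<forall>(M :: 'b measure) (X :: nat \<Rightarrow> 'b \<Rightarrow> real \<Rightarrow> 'a) (n :: nat).
        prob_space M \<longrightarrow> n \<ge> 1 \<longrightarrow>
        prob_space.indep_vars M (\<lambda>_. metric_borel (path_space T)) X {1..n} \<longrightarrow>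
        (\<forall>i\<in>{1..n}. distr M (metric_borel (path_space T)) (X i) = \<mu>) \<longrightarrow>
        (let D = (\<lambda>\<omega> t. ipm \<Phi> (distr M borel (\<lambda>\<omega>. X 1 \<omega> t)) (empirical_measure n (\<lambda>i. X i \<omega> t)))
         in integrable M (\<lambda>\<omega>. SUP t\<in>{0..T}. D \<omega> t) \<and>
            (\<integral>\<omega>. (SUP t\<in>{0..T}. D \<omega> t) \<partial>M) \<le> \<phi> n \<and>
            integrable M (\<lambda>\<omega>. SUP t\<in>{0..T}. (D \<omega> t)\<^sup>2) \<and>
            (\<integral>\<omega>. (SUP t\<in>{0..T}. (D \<omega> t)\<^sup>2) \<partial>M)
              \<le> A1\<^sup>2 / real n * (\<integral>x. (path_sup_norm T x)\<^sup>2 \<partial>\<mu>) + (\<phi> n)\<^sup>2 \<and>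
            (\<forall>\<kappa>>0. T1_inequality (path_space T) \<mu> \<kappa> \<longrightarrow>
               (\<forall>a>0. measure M {\<omega> \<in> space M. (SUP t\<in>{0..T}. D \<omega> t) - \<phi> n \<ge> a}
                  \<le> exp (- (real n * a\<^sup>2) / (2 * A1\<^sup>2 * \<kappa>\<^sup>2))))))"
proof (intro conjI allI impI)
  show "\<phi> \<in> O(\<lambda>n. real n powr (- 1 / 2) * ln (real n) powr max \<beta> (1 / 2))"
    unfolding assms(10) by (rule rate_bigo) fact+
next
  fix M :: "'b measure" and X :: "nat \<Rightarrow> 'b \<Rightarrow> real \<Rightarrow> 'a" and n :: nat
  let ?B = "metric_borel (path_space T) :: (real \<Rightarrow> 'a) measure"
  assume "prob_space M" and n: "n \<ge> 1" and indep: "prob_space.indep_vars M (\<lambda>_. ?B) X {1..n}"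
    and law: "\<forall>i\<in>{1..n}. distr M ?B (X i) = \<mu>"
  note adm = admissible_test_classD[OF assms(1)]
  interpret M: prob_space M by fact
  note mps = metric_prob_space_path[OF assms(2-5)]
  interpret metric_prob_space \<mu> "path_space T" "zero_path T" by (rule mps(1))
  define I where "I = {1..n}"
  have I: "finite I" "I \<noteq> {}" "card I = n" using n by (auto simp: I_def)
  define F where "F = empirical_sup (eval_class T \<Phi>) I"
  define m2 where "m2 = (\<integral>x. (path_sup_norm T x)\<^sup>2 \<partial>\<mu>)"
  let ?P = "PiM I (\<lambda>_. \<mu>)"
  interpret P: prob_space ?P by (rule prob_space_PiM_power)
  have F_lip: "sum_lipschitz I (A1 / n) F"
    unfolding F_def I_def by (rule expectation_sup_le_rate(1)[OF assms(1-9) n])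
  have F_mean: "(\<integral>x. F x \<partial>?P) \<le> \<phi> n"
    unfolding F_def I_def assms(10) by (rule expectation_sup_le_rate(2)[OF assms(1-9) n])
  have F_int: "integrable ?P F" by (rule sum_lipschitz_integrable[OF I(1) F_lip])
  have F_meas [measurable]: "F \<in> borel_measurable ?P" using F_int by simp
  \<comment> \<open>Efron-Stein about the centre 0 with Lipschitz constant A1 / n; summing the n
    squares gives A1^2 / n.\<close>
  have F_second: "(\<integral>\<^sup>+x. ennreal ((F x)\<^sup>2) \<partial>?P) \<le> ennreal (A1\<^sup>2 / n * m2 + (\<integral>x. F x \<partial>?P)\<^sup>2)"
  proof -
    have "real (card I) * (A1 / n)\<^sup>2 = A1\<^sup>2 / n" using n I(3) by (simp add: power2_eq_square)
    then show ?thesis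
      using sum_lipschitz_second_moment[OF I(1) F_lip, of 0] by (simp only: mps(2) m2_def diff_zero)
  qed
  have F2_int: "integrable ?P (\<lambda>x. (F x)\<^sup>2)"
    by (rule integrableI_bounded) (use F_second in \<open>auto intro: le_less_trans\<close>)
  have rv [measurable]: "X i \<in> measurable M ?B" if "i \<in> I" for i
    using indep that unfolding M.indep_vars_def I_def by blast
  \<comment> \<open>Independence and equal laws make the law of Y the product measure, so every
    claim about X becomes one about F under that measure.\<close>
  define Y where "Y = (\<lambda>\<omega>. \<lambda>i\<in>I. X i \<omega>)"
  have sets_PiM: "sets (PiM I (\<lambda>_. ?B)) = sets ?P"
    by (intro sets_PiM_cong refl) (simp add: assms(4))
  have Y_meas: "Y \<in> measurable M ?P"
  proof -
    have "Y \<in> measurable M (PiM I (\<lambda>_. ?B))" unfolding Y_def by measurable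
    then show ?thesis by (simp cong: measurable_cong_sets add: sets_PiM)
  qed
  have distr_Y: "distr M ?P Y = ?P"
  proof -
    have "distr M ?P Y = distr M (PiM I (\<lambda>_. ?B)) Y"
      by (rule distr_cong) (simp_all add: sets_PiM)
    also have "\<dots> = PiM I (\<lambda>i. distr M ?B (X i))"
      unfolding Y_def using M.indep_vars_iff_distr_eq_PiM'[OF I(2) rv] indep by (simp add: I_def)
    also have "\<dots> = ?P" using law by (intro PiM_cong) (auto simp: I_def)
    finally show ?thesis .
  qed
  define D where "D = (\<lambda>\<omega> t. ipm \<Phi> (distr M borel (\<lambda>\<omega>. X 1 \<omega> t)) (empirical_measure n (\<lambda>i. X i \<omega> t)))"
  have D_eq: "(SUP t\<in>{0..T}. D \<omega> t) = F (Y \<omega>)" "(SUP t\<in>{0..T}. (D \<omega> t)\<^sup>2) = (F (Y \<omega>))\<^sup>2"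
    if \<omega>: "\<omega> \<in> space M" for \<omega>
  proof -
    have X: "X i \<omega> \<in> mspace (path_space T)" if "i \<in> {1..n}" for i
      using measurable_space[OF rv \<omega>, of i] that by (simp add: I_def)
    have one: "1 \<in> I" using n by (simp add: I_def)
    have law_1: "(\<integral>z. f z \<partial>distr M borel (\<lambda>\<omega>. X 1 \<omega> t)) = (\<integral>y. f (y t) \<partial>\<mu>)"
      if t: "t \<in> {0..T}" and f: "f \<in> \<Phi>" for t f
    proof -
      have f_meas [measurable]: "f \<in> borel_measurable borel"
        by (rule lipschitz_borel_measurable[OF adm(5)[OF f] adm(2)])
      note [measurable] = measurable_path_eval[OF t] rv[OF one]
      have "(\<integral>z. f z \<partial>distr M borel (\<lambda>\<omega>. X 1 \<omega> t)) = (\<integral>\<omega>. f (X 1 \<omega> t) \<partial>M)"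
        by (rule integral_distr) measurable
      also have "\<dots> = (\<integral>y. f (y t) \<partial>distr M ?B (X 1))"
        by (rule integral_distr[symmetric]) measurable
      also have "distr M ?B (X 1) = \<mu>" using law one by (simp add: I_def)
      finally show ?thesis .
    qed
    show "(SUP t\<in>{0..T}. D \<omega> t) = F (Y \<omega>)" "(SUP t\<in>{0..T}. (D \<omega> t)\<^sup>2) = (F (Y \<omega>))\<^sup>2"
      unfolding D_def F_def Y_def I_def
      by (rule sup_ipm_eq_empirical_sup[OF assms(1,2) mps(1) n X law_1]; assumption)+
  qed
  have D_int: "integrable M (\<lambda>\<omega>. SUP t\<in>{0..T}. D \<omega> t)"
    using integrable_distr[OF Y_meas, of F] F_int
    by (subst Bochner_Integration.integrable_cong[OF refl D_eq(1)]) (simp_all add: distr_Y)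
  have D_mean: "(\<integral>\<omega>. (SUP t\<in>{0..T}. D \<omega> t) \<partial>M) = (\<integral>x. F x \<partial>?P)"
    using integral_distr[OF Y_meas F_meas]
    by (subst Bochner_Integration.integral_cong[OF refl D_eq(1)]) (simp_all add: distr_Y)
  have D2_int: "integrable M (\<lambda>\<omega>. SUP t\<in>{0..T}. (D \<omega> t)\<^sup>2)"
    using integrable_distr[OF Y_meas, of "\<lambda>x. (F x)\<^sup>2"] F2_int
    by (subst Bochner_Integration.integrable_cong[OF refl D_eq(2)]) (simp_all add: distr_Y)
  have D2_mean: "(\<integral>\<omega>. (SUP t\<in>{0..T}. (D \<omega> t)\<^sup>2) \<partial>M) = (\<integral>x. (F x)\<^sup>2 \<partial>?P)"
    using integral_distr[OF Y_meas, of "\<lambda>x. (F x)\<^sup>2"]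
    by (subst Bochner_Integration.integral_cong[OF refl D_eq(2)]) (simp_all add: distr_Y)
  have m2: "m2 \<ge> 0" unfolding m2_def by simp
  have "ennreal (\<integral>x. (F x)\<^sup>2 \<partial>?P) \<le> ennreal (A1\<^sup>2 / n * m2 + (\<integral>x. F x \<partial>?P)\<^sup>2)"
    using F_second by (subst (asm) nn_integral_eq_integral[OF F2_int]) auto
  then have "(\<integral>x. (F x)\<^sup>2 \<partial>?P) \<le> A1\<^sup>2 / n * m2 + (\<integral>x. F x \<partial>?P)\<^sup>2"
    using m2 by (subst (asm) ennreal_le_iff) auto
  also have "(\<integral>x. F x \<partial>?P)\<^sup>2 \<le> (\<phi> n)\<^sup>2"
  proof (rule power_mono[OF F_mean])
    \<comment> \<open>Squaring the mean bound requires a nonnegative mean; any single member of the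
      class witnesses that F is nonnegative.\<close>
    show "0 \<le> (\<integral>x. F x \<partial>?P)"
    proof (rule Bochner_Integration.integral_nonneg)
      fix x assume x: "x \<in> space ?P"
      obtain f where "f \<in> \<Phi>" using adm(1) by blast
      then have g: "(\<lambda>y. f (y 0)) \<in> eval_class T \<Phi>" using assms(2) by (auto simp: eval_class_def)
      have "\<bar>empirical_deviation I x (\<lambda>y. f (y 0))\<bar> \<le> F x"
        unfolding F_def
        by (rule empirical_sup_upper[OF lipschitz_fun_eval_class[OF mps(1) adm(5) adm(2)] I(1,2) x g])
      then show "0 \<le> F x" by linarith
    qed
  qed
  finally have second: "(\<integral>x. (F x)\<^sup>2 \<partial>?P) \<le> A1\<^sup>2 / n * m2 + (\<phi> n)\<^sup>2" by simp
  have tail: "measure M {\<omega> \<in> space M. (SUP t\<in>{0..T}. D \<omega> t) - \<phi> n \<ge> a} \<le> exp (- (real n * a\<^sup>2) / (2 * A1\<^sup>2 * \<kappa>\<^sup>2))"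
    if \<kappa>: "\<kappa> > 0" and T1: "T1_inequality (path_space T) \<mu> \<kappa>" and a: "a > 0" for \<kappa> a
  \<comment> \<open>For A1 = 0 the exponent is a division by zero, hence 0, and the bound is the
    trivial 1. Otherwise A1 / n is a positive Lipschitz constant, as \<open>T1_concentration\<close>
    demands.\<close>
  proof (cases "A1 = 0")
    case False
    then have A1: "A1 / n > 0" using adm(2) n by simp
    have "{\<omega> \<in> space M. (SUP t\<in>{0..T}. D \<omega> t) - \<phi> n \<ge> a} =
        Y -` {x \<in> space ?P. F x - \<phi> n \<ge> a} \<inter> space M"
      using D_eq(1) measurable_space[OF Y_meas] by auto
    then have "measure M {\<omega> \<in> space M. (SUP t\<in>{0..T}. D \<omega> t) - \<phi> n \<ge> a} =
        measure (distr M ?P Y) {x \<in> space ?P. F x - \<phi> n \<ge> a}"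
      by (subst measure_distr[OF Y_meas]) auto
    also have "\<dots> \<le> exp (- a\<^sup>2 / (2 * card I * (A1 / n)\<^sup>2 * \<kappa>\<^sup>2))"
      unfolding distr_Y by (rule T1_concentration[OF T1 \<kappa> A1 I(1,2) F_lip F_mean a])
    also have "- a\<^sup>2 / (2 * card I * (A1 / n)\<^sup>2 * \<kappa>\<^sup>2) = - (real n * a\<^sup>2) / (2 * A1\<^sup>2 * \<kappa>\<^sup>2)"
      using n I(3) by (simp add: power2_eq_square)
    finally show ?thesis .
  qed simp
  show "let D = (\<lambda>\<omega> t. ipm \<Phi> (distr M borel (\<lambda>\<omega>. X 1 \<omega> t)) (empirical_measure n (\<lambda>i. X i \<omega> t)))
         in integrable M (\<lambda>\<omega>. SUP t\<in>{0..T}. D \<omega> t) \<and>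
            (\<integral>\<omega>. (SUP t\<in>{0..T}. D \<omega> t) \<partial>M) \<le> \<phi> n \<and>
            integrable M (\<lambda>\<omega>. SUP t\<in>{0..T}. (D \<omega> t)\<^sup>2) \<and>
            (\<integral>\<omega>. (SUP t\<in>{0..T}. (D \<omega> t)\<^sup>2) \<partial>M)
              \<le> A1\<^sup>2 / real n * (\<integral>x. (path_sup_norm T x)\<^sup>2 \<partial>\<mu>) + (\<phi> n)\<^sup>2 \<and>
            (\<forall>\<kappa>>0. T1_inequality (path_space T) \<mu> \<kappa> \<longrightarrow>
               (\<forall>a>0. measure M {\<omega> \<in> space M. (SUP t\<in>{0..T}. D \<omega> t) - \<phi> n \<ge> a}
                  \<le> exp (- (real n * a\<^sup>2) / (2 * A1\<^sup>2 * \<kappa>\<^sup>2))))"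
    unfolding Let_def D_def[symmetric] D_mean D2_mean m2_def[symmetric]
    using D_int D2_int F_mean second tail by blast
qed

end
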